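(* Let $A=\{a_0<a_1<\dots<a_{|A|-1}\}\subset\mathbb Z\setminus\{0\}$ be a finite set which affinely generates the lattice $\mathbb Z$, satisfies $a_{|A|-1}-a_0\ge 3$, and satisfies Assumption (G) of the context. Let $\mathcal M_A\subset\mathbb R^{|A|}$ be the Newton polytope of the Morse discriminant in $\mathbb C^A$, with support function $\mu_A$. Then $\mu_A$ is piecewise linear and convex, and it is linear on each of the cones in $(\mathbb R^{|A|})^*$ generated by the set of all covectors $\gamma\colon A\to\mathbb R_{\ge0}$ that satisfy the genericity conditions (A1), (A2) of the context and give one and the same combinatorial data $(W,Z,(M^j)_j)$. Associating with each such cone (equivalently, with each combinatorial type of tropical Morse polynomials with support $A$) the tuple of coefficients of the linear function $\mu_A$ on it defines a surjection from the set of these cones onto the set of vertices of $\mathcal M_A$.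
   Context: **Morse discriminant.** $\mathbb C^A$ is the space of Laurent polynomials $f(x)=\sum_{p\in A}c_px^p$. The caustic is the set of $f\in\mathbb C^A$ such that $f\colon\mathbb C\setminus 0\to\mathbb C$ has a degenerate critical point. The Maxwell stratum is the set of $f\in\mathbb C^A$ such that $f\colon\mathbb C\setminus0\to\mathbb C$ has a pair of coinciding critical values taken at distinct points. $f$ is Morse if it lies in neither set. The Morse discriminant is the closure of the set of non-Morse $f\in\mathbb C^A$; it is given by the polynomial $h_m^2h_c$ in the coefficients $(c_p)_{p\in A}$, where $h_m$ and $h_c$ are the (reduced) polynomials defining the (closures of the) Maxwell stratum and the caustic, if these are hypersurfaces; otherwise the corresponding polynomial is set to $1$. $\mathcal M_A\subset\mathbb R^{|A|}$ is the Newton polytope of $h_m^2h_c$, and its support function is $\mu_A(\gamma)=\max_{u\in\mathcal M_A}\gamma(u)$ for $\gamma\in(\mathbb R^{|A|})^*$. A covector $\gamma$ with non-negative entries is identified with a function $\gamma\colon A\to\mathbb R_{\ge0}$. **Assumption (G).** For a generic polynomial $f$ in the Morse discriminant, the map $f\colon\mathbb C\setminus0\to\mathbb C$ has exactly one pair of coinciding critical values or exactly one degenerate critical point (of multiplicity 2). **Combinatorial data of $\gamma$.** Let $N_\gamma=\operatorname{conv}\big(\{(p,\gamma(p)):p\in A\}\cup\{(a_0,0),(a_{|A|-1},0)\}\big)\subset\mathbb R^2$. The upper edges of $N_\gamma$, projected to the first coordinate, subdivide $\operatorname{conv}(A)$; $W=\{w_0<w_1<\dots<w_k\}\subset A$ is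 the set of vertices of this subdivision, so $w_0=a_0$, $w_k=a_{|A|-1}$. Let $\varphi_\gamma(X)=\max_{p\in A}(pX+\gamma(p))$; its tropical roots are $r_j=\frac{\gamma(w_j)-\gamma(w_{j+1})}{w_{j+1}-w_j}$, $0\le j\le k-1$. Genericity conditions: (A1) for any two distinct pairs $p<q$ and $r<s$ of elements of $A$, $\frac{\gamma(p)-\gamma(q)}{q-p}\ne\frac{\gamma(r)-\gamma(s)}{s-r}$; (A2) for all $0\le j<m\le k-1$, $\frac{w_{j+1}\gamma(w_j)-w_j\gamma(w_{j+1})}{w_{j+1}-w_j}\ne\frac{w_{m+1}\gamma(w_m)-w_m\gamma(w_{m+1})}{w_{m+1}-w_m}$ (i.e. $\varphi_\gamma(r_j)\neq\varphi_\gamma(r_m)$). The tropical polynomial $\varphi_\gamma$ is called Morse when $\gamma$ satisfies (A1) and (A2). The sequence $Z=(z_1,\dots,z_k)$ is the list of the indices $0,1,\dots,k-1$ in increasing order of the values $\varphi_\gamma(r_j)=w_jr_j+\gamma(w_j)$. For $0\le j\le k-1$, the sequence $M^j$ lists the elements $p\in A\setminus\{w_j,w_{j+1}\}$ in decreasing order of the values $pr_j+\gamma(p)$. The combinatorial data of $\gamma$ is the tuple $(W,Z,(M^j)_{0\le j\le k-1})$; a combinatorial type of tropical Morse polynomials is a tuple of this form arising from some such $\gamma$. *)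

theory Defs
  imports
    "HOL-Complex_Analysis.Complex_Analysis"
    "HOL-Computational_Algebra.Squarefree"
    "HOL-Library.Poly_Mapping"
begin

unbundle no fps_syntax

text \<open>
  A finite set \<open>A = {a_0 < a_1 < \<dots>}\<close> of integers is given by its strictly increasing
  enumeration \<open>a\<close> over a finite linearly ordered type \<open>'n\<close>; an index \<open>i\<close> stands for the
  element \<open>a i\<close> of \<open>A\<close>. The space of Laurent polynomials supported in \<open>A\<close> is then
  \<open>complex ^ 'n\<close>, and covectors are identified with vectors of \<open>real ^ 'n\<close> through the
  inner product.
\<close>

subsection \<open>Laurent polynomials and the Morse discriminant\<close>

definition laurent :: "('n::finite \<Rightarrow> int) \<Rightarrow> complex ^ 'n \<Rightarrow> complex \<Rightarrow> complex" where
  "laurent a c x = (\<Sum>i\<in>UNIV. c $ i * x powi a i)"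

definition critical_point :: "('n::finite \<Rightarrow> int) \<Rightarrow> complex ^ 'n \<Rightarrow> complex \<Rightarrow> bool" where
  "critical_point a c x \<longleftrightarrow> x \<noteq> 0 \<and> deriv (laurent a c) x = 0"

definition degenerate_critical_point :: "('n::finite \<Rightarrow> int) \<Rightarrow> complex ^ 'n \<Rightarrow> complex \<Rightarrow> bool" where
  "degenerate_critical_point a c x \<longleftrightarrow>
     critical_point a c x \<and> deriv (deriv (laurent a c)) x = 0"

definition critical_multiplicity :: "('n::finite \<Rightarrow> int) \<Rightarrow> complex ^ 'n \<Rightarrow> complex \<Rightarrow> int" where
  "critical_multiplicity a c x = zorder (deriv (laurent a c)) x"

definition coinciding_pairs :: "('n::finite \<Rightarrow> int) \<Rightarrow> complex ^ 'n \<Rightarrow> complex set set" where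
  "coinciding_pairs a c =
     {{x, y} | x y. x \<noteq> y \<and> critical_point a c x \<and> critical_point a c y \<and>
                    laurent a c x = laurent a c y}"

definition caustic :: "('n::finite \<Rightarrow> int) \<Rightarrow> (complex ^ 'n) set" where
  "caustic a = {c. \<exists>x. degenerate_critical_point a c x}"

definition maxwell_stratum :: "('n::finite \<Rightarrow> int) \<Rightarrow> (complex ^ 'n) set" where
  "maxwell_stratum a = {c. coinciding_pairs a c \<noteq> {}}"

definition is_morse :: "('n::finite \<Rightarrow> int) \<Rightarrow> complex ^ 'n \<Rightarrow> bool" where
  "is_morse a c \<longleftrightarrow> c \<notin> caustic a \<and> c \<notin> maxwell_stratum a"

text \<open>
  The strata are constructible, so their closures in the Euclidean and in the Zariski
  topology agree.
\<close>

definition morse_discriminant :: "('n::finite \<Rightarrow> int) \<Rightarrow> (complex ^ 'n) set" where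
  "morse_discriminant a = closure {c. \<not> is_morse a c}"

subsection \<open>Polynomials in the coefficients\<close>

type_synonym 'n cpoly = "('n \<Rightarrow>\<^sub>0 nat) \<Rightarrow>\<^sub>0 complex"

definition eval_cpoly :: "'n::finite cpoly \<Rightarrow> complex ^ 'n \<Rightarrow> complex" where
  "eval_cpoly h c =
     (\<Sum>u\<in>Poly_Mapping.keys h. Poly_Mapping.lookup h u * (\<Prod>i\<in>UNIV. (c $ i) ^ Poly_Mapping.lookup u i))"

definition zero_set :: "'n::finite cpoly \<Rightarrow> (complex ^ 'n) set" where
  "zero_set h = {c. eval_cpoly h c = 0}"

definition algebraic_set :: "(complex ^ 'n::finite) set \<Rightarrow> bool" where
  "algebraic_set Z \<longleftrightarrow> (\<exists>H. Z = (\<Inter>h\<in>H. zero_set h))"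

definition is_hypersurface :: "(complex ^ 'n::finite) set \<Rightarrow> bool" where
  "is_hypersurface V \<longleftrightarrow> (\<exists>h. h \<noteq> 0 \<and> \<not> h dvd 1 \<and> zero_set h = V)"

text \<open>
  The reduced equation of a hypersurface is unique up to a nonzero constant, so the Newton
  polytope below does not depend on the choice.
\<close>

definition reduced_equation :: "(complex ^ 'n::finite) set \<Rightarrow> 'n cpoly" where
  "reduced_equation V =
     (if is_hypersurface V
      then SOME h. h \<noteq> 0 \<and> \<not> h dvd 1 \<and> squarefree h \<and> zero_set h = V
      else 1)"

definition morse_poly :: "('n::finite \<Rightarrow> int) \<Rightarrow> 'n cpoly" where
  "morse_poly a =
     (reduced_equation (closure (maxwell_stratum a)))\<^sup>2 * reduced_equation (closure (caustic a))"

definition newton_polytope :: "'n::finite cpoly \<Rightarrow> (real ^ 'n) set" where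
  "newton_polytope h =
     convex hull ((\<lambda>u. \<chi> i. real (Poly_Mapping.lookup u i)) ` Poly_Mapping.keys h)"

definition morse_polytope :: "('n::finite \<Rightarrow> int) \<Rightarrow> (real ^ 'n) set" where
  "morse_polytope a = newton_polytope (morse_poly a)"

definition support_function :: "'a::euclidean_space set \<Rightarrow> 'a \<Rightarrow> real" where
  "support_function M \<gamma> = (SUP u\<in>M. \<gamma> \<bullet> u)"

definition mu_A :: "('n::finite \<Rightarrow> int) \<Rightarrow> real ^ 'n \<Rightarrow> real" where
  "mu_A a = support_function (morse_polytope a)"

definition piecewise_linear :: "('a::euclidean_space \<Rightarrow> real) \<Rightarrow> bool" where
  "piecewise_linear f \<longleftrightarrow>
     (\<exists>F. finite F \<and> \<Union>F = UNIV \<and>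
          (\<forall>P\<in>F. polyhedron P \<and> (\<exists>g. linear g \<and> (\<forall>x\<in>P. f x = g x))))"

subsection \<open>Hypotheses on the support\<close>

definition affinely_generates_int :: "('n::finite \<Rightarrow> int) \<Rightarrow> bool" where
  "affinely_generates_int a \<longleftrightarrow>
     (\<forall>z. \<exists>m :: 'n \<Rightarrow> int. (\<Sum>i\<in>UNIV. m i) = 1 \<and> (\<Sum>i\<in>UNIV. m i * a i) = z)"

text \<open>
  The two alternatives of the assumption describe the whole failure of the Morse property:
  one coincidence of critical values, or one double critical point, and nothing else.
\<close>

definition one_coinciding_pair :: "('n::finite \<Rightarrow> int) \<Rightarrow> complex ^ 'n \<Rightarrow> bool" where
  "one_coinciding_pair a c \<longleftrightarrow>
     (\<exists>!P. P \<in> coinciding_pairs a c) \<and> (\<nexists>x. degenerate_critical_point a c x)"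

definition one_degenerate_point :: "('n::finite \<Rightarrow> int) \<Rightarrow> complex ^ 'n \<Rightarrow> bool" where
  "one_degenerate_point a c \<longleftrightarrow>
     (\<exists>!x. degenerate_critical_point a c x) \<and>
     (\<forall>x. degenerate_critical_point a c x \<longrightarrow> critical_multiplicity a c x = 2) \<and>
     coinciding_pairs a c = {}"

text \<open>
  Generic means: on a Zariski open subset that is dense in the (possibly reducible) Morse
  discriminant, i.e. meets each of its components in a dense subset.
\<close>

definition assumption_G :: "('n::finite \<Rightarrow> int) \<Rightarrow> bool" where
  "assumption_G a \<longleftrightarrow>
     (\<exists>Z. algebraic_set Z \<and>
          morse_discriminant a \<subseteq> closure (morse_discriminant a - Z) \<and>
          (\<forall>c \<in> morse_discriminant a - Z. one_coinciding_pair a c \<or> one_degenerate_point a c))"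

subsection \<open>Tropical Morse polynomials and their combinatorial data\<close>

definition N_gamma :: "('n::{finite,linorder} \<Rightarrow> int) \<Rightarrow> (real, 'n) vec \<Rightarrow> (real \<times> real) set" where
  "N_gamma a \<gamma> = convex hull
     (range (\<lambda>i. (real_of_int (a i), \<gamma> $ i)) \<union>
      {(real_of_int (a (Min UNIV)), 0), (real_of_int (a (Max UNIV)), 0)})"

definition upper_edge :: "(real \<times> real) set \<Rightarrow> (real \<times> real) set \<Rightarrow> bool" where
  "upper_edge N E \<longleftrightarrow> E edge_of N \<and>
     (\<exists>s b. (\<forall>(x, y)\<in>N. s * x + y \<le> b) \<and> E = {(x, y)\<in>N. s * x + y = b})"

definition W_set :: "('n::{finite,linorder} \<Rightarrow> int) \<Rightarrow> (real, 'n) vec \<Rightarrow> 'n set" where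
  "W_set a \<gamma> =
     {i. \<exists>E v. upper_edge (N_gamma a \<gamma>) E \<and> v extreme_point_of E \<and> fst v = real_of_int (a i)}"

definition w_vertex :: "('n::{finite,linorder} \<Rightarrow> int) \<Rightarrow> (real, 'n) vec \<Rightarrow> nat \<Rightarrow> 'n" where
  "w_vertex a \<gamma> j = sorted_list_of_set (W_set a \<gamma>) ! j"

definition num_roots :: "('n::{finite,linorder} \<Rightarrow> int) \<Rightarrow> (real, 'n) vec \<Rightarrow> nat" where
  "num_roots a \<gamma> = card (W_set a \<gamma>) - 1"

definition slope :: "('n::finite \<Rightarrow> int) \<Rightarrow> real ^ 'n \<Rightarrow> 'n \<Rightarrow> 'n \<Rightarrow> real" where
  "slope a \<gamma> i j = (\<gamma> $ i - \<gamma> $ j) / real_of_int (a j - a i)"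

definition trop_root :: "('n::{finite,linorder} \<Rightarrow> int) \<Rightarrow> (real, 'n) vec \<Rightarrow> nat \<Rightarrow> real" where
  "trop_root a \<gamma> j = slope a \<gamma> (w_vertex a \<gamma> j) (w_vertex a \<gamma> (Suc j))"

definition trop_poly :: "('n::finite \<Rightarrow> int) \<Rightarrow> real ^ 'n \<Rightarrow> real \<Rightarrow> real" where
  "trop_poly a \<gamma> X = Max (range (\<lambda>i. real_of_int (a i) * X + \<gamma> $ i))"

definition cond_A1 :: "('n::{finite,linorder} \<Rightarrow> int) \<Rightarrow> (real, 'n) vec \<Rightarrow> bool" where
  "cond_A1 a \<gamma> \<longleftrightarrow>
     (\<forall>p q r s. p < q \<and> r < s \<and> (p, q) \<noteq> (r, s) \<longrightarrow> slope a \<gamma> p q \<noteq> slope a \<gamma> r s)"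

definition cond_A2 :: "('n::{finite,linorder} \<Rightarrow> int) \<Rightarrow> (real, 'n) vec \<Rightarrow> bool" where
  "cond_A2 a \<gamma> \<longleftrightarrow>
     (let v = (\<lambda>j. let p = w_vertex a \<gamma> j; q = w_vertex a \<gamma> (Suc j) in
                 (real_of_int (a q) * \<gamma> $ p - real_of_int (a p) * \<gamma> $ q) / real_of_int (a q - a p))
      in \<forall>j m. j < m \<and> m < num_roots a \<gamma> \<longrightarrow> v j \<noteq> v m)"

definition Z_seq :: "('n::{finite,linorder} \<Rightarrow> int) \<Rightarrow> (real, 'n) vec \<Rightarrow> nat list" where
  "Z_seq a \<gamma> = sort_key (\<lambda>j. trop_poly a \<gamma> (trop_root a \<gamma> j)) [0..<num_roots a \<gamma>]"

definition M_seq :: "('n::{finite,linorder} \<Rightarrow> int) \<Rightarrow> (real, 'n) vec \<Rightarrow> nat \<Rightarrow> 'n list" where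
  "M_seq a \<gamma> j =
     sort_key (\<lambda>i. - (real_of_int (a i) * trop_root a \<gamma> j + \<gamma> $ i))
       (sorted_list_of_set (UNIV - {w_vertex a \<gamma> j, w_vertex a \<gamma> (Suc j)}))"

type_synonym 'n comb_data = "'n set \<times> nat list \<times> 'n list list"

definition comb_data :: "('n::{finite,linorder} \<Rightarrow> int) \<Rightarrow> (real, 'n) vec \<Rightarrow> 'n comb_data" where
  "comb_data a \<gamma> = (W_set a \<gamma>, Z_seq a \<gamma>, map (M_seq a \<gamma>) [0..<num_roots a \<gamma>])"

definition tropical_morse :: "('n::{finite,linorder} \<Rightarrow> int) \<Rightarrow> (real, 'n) vec set" where
  "tropical_morse a = {\<gamma>. (\<forall>i. 0 \<le> \<gamma> $ i) \<and> cond_A1 a \<gamma> \<and> cond_A2 a \<gamma>}"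

definition comb_types :: "('n::{finite,linorder} \<Rightarrow> int) \<Rightarrow> 'n comb_data set" where
  "comb_types a = comb_data a ` tropical_morse a"

definition type_cone :: "('n::{finite,linorder} \<Rightarrow> int) \<Rightarrow> 'n comb_data \<Rightarrow> (real, 'n) vec set" where
  "type_cone a T = convex_cone hull {\<gamma> \<in> tropical_morse a. comb_data a \<gamma> = T}"

definition type_cones :: "('n::{finite,linorder} \<Rightarrow> int) \<Rightarrow> (real, 'n) vec set set" where
  "type_cones a = type_cone a ` comb_types a"

definition linear_coeffs :: "('a::euclidean_space \<Rightarrow> real) \<Rightarrow> 'a set \<Rightarrow> 'a" where
  "linear_coeffs f C = (THE v. \<forall>\<gamma>\<in>C. f \<gamma> = \<gamma> \<bullet> v)"

end

theory Submission
  imports Defs "HOL-Computational_Algebra.Fundamental_Theorem_Algebra"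
begin

unbundle no Formal_Power_Series.fps_syntax

text \<open>
  The key point is that for a tropical Morse covector \<open>\<gamma>\<close> the Laurent polynomials with coefficients
  \<open>t powr \<gamma>\<^sub>i * c\<^sub>i\<close> are Morse once \<open>t\<close> is large, uniformly for \<open>c\<close> in a compact part of the torus.
  Indeed each critical point has the form \<open>t powr r * y\<close> with \<open>r\<close> a tropical root and \<open>y\<close> close to a
  critical point of a binomial \<open>c\<^sub>p y\<^sup>p + c\<^sub>q y\<^sup>q\<close>; these are nondegenerate, critical values at different
  tropical roots have different orders in \<open>t\<close>, and those at the same root are separated by the largest
  remaining monomial that distinguishes the two points.  Consequently the equation of the Morse
  discriminant does not vanish there, so by Hurwitz's theorem its initial form at \<open>\<gamma>\<close> is a single
  monomial, that is, \<open>\<gamma>\<close> attains its maximum on the Newton polytope at one vertex only.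

  Two covectors with the same combinatorial data are joined by a segment of covectors satisfying the
  conditions that the argument needs, and along a connected set the selected vertex cannot change;
  hence the support function is linear on each cone.  Every vertex occurs because the generic
  covectors are dense and adding a constant to a covector preserves its combinatorial data.
\<close>


text \<open>The obstacle is that the leading binomial at a tropical root need not be Morse itself:
  if its two exponents have a common divisor \<open>d > 1\<close>, multiplication by
  \<open>d\<close>-th roots of unity permutes its critical points and preserves the critical values.
  Only lower monomials can break this symmetry. Since the exponents generate the integers, some
  monomial does; since the remaining levels at a root are distinct, exactly one of those that do
  dominates. This is the role of the sequences \<open>M^j\<close>.

  Uniformity in \<open>c\<close> is needed for two reasons. The equations vanish on the closures of
  the strata, so a point has to be compared with nearby non-Morse ones; and Hurwitz's theorem yields
  zeros whose coefficients vary with \<open>t\<close>. Uniformity is expressed by sequences: a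
  failure along a sequence of parameters is refuted on a convergent subsequence.

  The selected vertex is constant along connected sets because exposing a given exponent is an open
  condition.\<close>

subsection \<open>Asymptotics of Laurent polynomials\<close>

text \<open>The Euler operator \<open>x d/dx\<close>, which unlike \<open>deriv\<close> preserves the support.\<close>

definition theta :: "('n::finite \<Rightarrow> int) \<Rightarrow> complex ^ 'n \<Rightarrow> complex ^ 'n" where
  "theta a c = (\<chi> i. of_int (a i) * c $ i)"

lemma theta_nth [simp]: "theta a c $ i = of_int (a i) * c $ i"
  by (simp add: theta_def)

lemma has_field_derivative_laurent:
  assumes "x \<noteq> 0"
  shows "(laurent a c has_field_derivative laurent a (theta a c) x / x) (at x)"
proof -
  have "((\<lambda>x. \<Sum>i\<in>UNIV. c $ i * x powi a i) has_field_derivative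
         (\<Sum>i\<in>UNIV. c $ i * (of_int (a i) * x powi (a i - 1)))) (at x)"
    using assms by (auto intro!: derivative_eq_intros sum.cong)
  moreover have "(\<Sum>i\<in>UNIV. c $ i * (of_int (a i) * x powi (a i - 1))) = laurent a (theta a c) x / x"
    unfolding laurent_def sum_divide_distrib
    using assms by (intro sum.cong) (auto simp: power_int_diff)
  ultimately show ?thesis by (simp add: laurent_def[abs_def])
qed

lemma critical_point_iff:
  "critical_point a c x \<longleftrightarrow> x \<noteq> 0 \<and> laurent a (theta a c) x = 0"
  using DERIV_imp_deriv[OF has_field_derivative_laurent, of x a c]
  by (auto simp: critical_point_def)

lemma degenerate_critical_point_iff:
  "degenerate_critical_point a c x \<longleftrightarrow>
     x \<noteq> 0 \<and> laurent a (theta a c) x = 0 \<and> laurent a (theta a (theta a c)) x = 0"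
proof (cases "x = 0")
  case False
  have ev: "\<forall>\<^sub>F z in nhds x. deriv (laurent a c) z = laurent a (theta a c) z / z"
    using eventually_nhds_in_open[of "-{0}" x] False
    by (auto simp: open_Compl elim!: eventually_mono intro!: DERIV_imp_deriv has_field_derivative_laurent)
  have "((\<lambda>z. laurent a (theta a c) z / z) has_field_derivative
      (laurent a (theta a (theta a c)) x / x * x - laurent a (theta a c) x * 1) / (x * x)) (at x)"
    using False by (intro DERIV_divide has_field_derivative_laurent DERIV_ident)
  then have "deriv (deriv (laurent a c)) x
      = (laurent a (theta a (theta a c)) x / x * x - laurent a (theta a c) x * 1) / (x * x)"
    using deriv_cong_ev[OF ev refl] DERIV_imp_deriv by metis
  then show ?thesis using False
    by (auto simp: degenerate_critical_point_def critical_point_iff)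
qed (simp add: degenerate_critical_point_def critical_point_iff)

lemma tendsto_laurent:
  assumes "b \<longlonglongrightarrow> B" "u \<longlonglongrightarrow> y" "y \<noteq> 0"
  shows "(\<lambda>n. laurent a (b n) (u n)) \<longlonglongrightarrow> laurent a B y"
  unfolding laurent_def using assms by (auto intro!: tendsto_intros)

lemma tendsto_theta:
  assumes "b \<longlonglongrightarrow> B" shows "(\<lambda>n. theta a (b n)) \<longlonglongrightarrow> theta a B"
  unfolding theta_def using assms by (auto intro!: tendsto_intros)

text \<open>A secant slope with two moving end points: the geometric sum is a polynomial in both
  points, so it is defined where they coincide and tends to the derivative by continuity.\<close>

lemma tendsto_power_difference_quotient:
  fixes u v :: "nat \<Rightarrow> complex"
  assumes u: "u \<longlonglongrightarrow> y" and v: "v \<longlonglongrightarrow> y"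
  obtains d where "d \<longlonglongrightarrow> of_nat m * y ^ (m - 1)"
    "\<And>n. u n ^ m - v n ^ m = (u n - v n) * d n"
proof
  show "(\<lambda>n. \<Sum>i<m. v n ^ (m - Suc i) * u n ^ i) \<longlonglongrightarrow> of_nat m * y ^ (m - 1)"
  proof -
    have "(\<lambda>n. \<Sum>i<m. v n ^ (m - Suc i) * u n ^ i) \<longlonglongrightarrow> (\<Sum>i<m. y ^ (m - Suc i) * y ^ i)"
      using assms by (intro tendsto_intros)
    also have "(\<Sum>i<m. y ^ (m - Suc i) * y ^ i) = (\<Sum>i<m. y ^ (m - 1))"
      by (intro sum.cong) (auto simp flip: power_add)
    finally show ?thesis by simp
  qed
  show "u n ^ m - v n ^ m = (u n - v n) * (\<Sum>i<m. v n ^ (m - Suc i) * u n ^ i)" for n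
    by (rule power_diff_sumr2)
qed

lemma tendsto_power_int_difference_quotient:
  fixes u v :: "nat \<Rightarrow> complex"
  assumes u: "u \<longlonglongrightarrow> y" and v: "v \<longlonglongrightarrow> y" and y: "y \<noteq> 0"
    and nz: "\<And>n. u n \<noteq> 0" "\<And>n. v n \<noteq> 0"
  shows "\<exists>d. d \<longlonglongrightarrow> of_int m * y powi m / y \<and> (\<forall>n. u n powi m - v n powi m = (u n - v n) * d n)"
proof (cases "m \<ge> 0")
  case True
  then obtain k where k: "m = int k" by (metis nonneg_int_cases)
  obtain d where "d \<longlonglongrightarrow> of_nat k * y ^ (k - 1)" "\<And>n. u n ^ k - v n ^ k = (u n - v n) * d n"
    using tendsto_power_difference_quotient[OF u v, of k] by blast
  moreover have "of_nat k * y ^ (k - 1) = of_int m * y powi m / y"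
    using y by (cases k) (auto simp: k power_int_add)
  ultimately show ?thesis using k by (intro exI[of _ d]) auto
next
  case False
  then obtain k where k: "m = - int k" by (metis linear nonneg_int_cases neg_0_le_iff_le minus_minus)
  obtain d where d: "d \<longlonglongrightarrow> of_nat k * y ^ (k - 1)" "\<And>n. u n ^ k - v n ^ k = (u n - v n) * d n"
    using tendsto_power_difference_quotient[OF u v, of k] by blast
  have "(\<lambda>n. - d n / (u n ^ k * v n ^ k)) \<longlonglongrightarrow> - (of_nat k * y ^ (k - 1)) / (y ^ k * y ^ k)"
    using d u v y by (intro tendsto_intros) auto
  also have "- (of_nat k * y ^ (k - 1)) / (y ^ k * y ^ k) = of_int m * y powi m / y"
  proof -
    have "y powi m = inverse (y ^ k)" by (simp add: k power_int_minus)
    moreover have "of_int m = - (of_nat k :: complex)" by (simp add: k)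
    ultimately show ?thesis using y by (cases k) (auto simp: field_simps simp del: of_nat_Suc)
  qed
  finally have "(\<lambda>n. - d n / (u n ^ k * v n ^ k)) \<longlonglongrightarrow> of_int m * y powi m / y" .
  moreover have "u n powi m - v n powi m = (u n - v n) * (- d n / (u n ^ k * v n ^ k))" for n
  proof -
    have "u n powi m - v n powi m = - (u n ^ k - v n ^ k) / (u n ^ k * v n ^ k)"
      using nz[of n] by (simp add: k power_int_minus field_simps)
    then show ?thesis unfolding d(2) by simp
  qed
  ultimately show ?thesis by blast
qed

text \<open>Serves to cancel \<open>u n - v n\<close> from equations at two points that approach
  each other. Applied to \<open>theta a (b n)\<close>, the limiting slope is nonzero at a
  nondegenerate critical point; applied to \<open>b n\<close>, it is zero at a critical
  point.\<close>

lemma tendsto_laurent_difference_quotient: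
  assumes b: "b \<longlonglongrightarrow> B" and u: "u \<longlonglongrightarrow> y" and v: "v \<longlonglongrightarrow> y" and y: "y \<noteq> 0"
    and nz: "\<And>n. u n \<noteq> 0" "\<And>n. v n \<noteq> 0"
  obtains d where "d \<longlonglongrightarrow> laurent a (theta a B) y / y"
    "\<And>n. laurent a (b n) (u n) - laurent a (b n) (v n) = (u n - v n) * d n"
proof -
  obtain d where d: "\<And>m. d m \<longlonglongrightarrow> of_int m * y powi m / y"
      "\<And>m n. u n powi m - v n powi m = (u n - v n) * d m n"
    using tendsto_power_int_difference_quotient[OF u v y nz] by metis
  show ?thesis
  proof
    have "(\<lambda>n. \<Sum>i\<in>UNIV. b n $ i * d (a i) n) \<longlonglongrightarrow> (\<Sum>i\<in>UNIV. B $ i * (of_int (a i) * y powi a i / y))"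
      by (intro tendsto_intros b d)
    then show "(\<lambda>n. \<Sum>i\<in>UNIV. b n $ i * d (a i) n) \<longlonglongrightarrow> laurent a (theta a B) y / y"
      by (simp add: laurent_def sum_divide_distrib algebra_simps)
    show "laurent a (b n) (u n) - laurent a (b n) (v n) = (u n - v n) * (\<Sum>i\<in>UNIV. b n $ i * d (a i) n)" for n
      unfolding laurent_def sum_subtractf[symmetric] sum_distrib_left
      by (intro sum.cong refl) (metis d(2) mult.left_commute right_diff_distrib)
  qed
qed

section \<open>One-parameter families of coefficients and their rescaled limits\<close>

definition rescale :: "real \<Rightarrow> real ^ 'n \<Rightarrow> complex ^ 'n \<Rightarrow> complex ^ 'n" where
  "rescale t g c = (\<chi> i. of_real (t powr (g $ i)) * c $ i)"

lemma rescale_nth [simp]: "rescale t g c $ i = of_real (t powr (g $ i)) * c $ i"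
  by (simp add: rescale_def)

lemma theta_rescale: "theta a (rescale t g c) = rescale t g (theta a c)"
  by (simp add: vec_eq_iff)

text \<open>The exponents of \<open>t\<close> left after substituting
  \<open>x = t powr s * y\<close> and dividing by \<open>t powr e\<close>. With \<open>s\<close> a
  tropical root and \<open>e\<close> its level they are nonpositive and vanish exactly at the
  dominant monomials.\<close>

definition tilt :: "('n::finite \<Rightarrow> int) \<Rightarrow> real ^ 'n \<Rightarrow> real \<Rightarrow> real \<Rightarrow> real ^ 'n" where
  "tilt a g s e = (\<chi> i. real_of_int (a i) * s + g $ i - e)"

lemma tilt_nth [simp]: "tilt a g s e $ i = real_of_int (a i) * s + g $ i - e"
  by (simp add: tilt_def)

lemma powr_powi: "t > 0 \<Longrightarrow> (t powr s) powi m = t powr (real_of_int m * s)" for t :: real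
  by (simp add: powr_powr mult.commute flip: powr_real_of_int')

lemma laurent_rescale:
  assumes "t > 0"
  shows "laurent a (rescale t g c) (of_real (t powr s) * y) = of_real (t powr e) * laurent a (rescale t (tilt a g s e) c) y"
proof -
  have "rescale t g c $ i * (of_real (t powr s) * y) powi a i
      = of_real (t powr e) * (rescale t (tilt a g s e) c $ i * y powi a i)" for i
  proof -
    have "(of_real (t powr s) * y) powi a i = of_real (t powr (real_of_int (a i) * s)) * y powi a i"
      using assms by (simp add: power_int_mult_distrib powr_powi flip: of_real_power_int)
    moreover have "t powr (g $ i) * t powr (real_of_int (a i) * s) = t powr e * t powr (tilt a g s e $ i)"
      by (simp add: add.commute flip: powr_add)
    ultimately show ?thesis
      by (simp flip: of_real_mult mult.assoc)
  qed
  then show ?thesis by (simp only: laurent_def sum_distrib_left)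
qed

lemma tendsto_powr_at_top_neg:
  assumes "filterlim t at_top sequentially" "e < 0"
  shows "(\<lambda>n. (t n :: real) powr e) \<longlonglongrightarrow> 0"
  using tendsto_neg_powr[OF assms(2,1)] .

lemma tendsto_rescale:
  assumes t: "filterlim t at_top sequentially" and c: "c \<longlonglongrightarrow> C" and g: "\<And>i. g $ i \<le> 0"
  shows "(\<lambda>n. rescale (t n) g (c n)) \<longlonglongrightarrow> (\<chi> i. if g $ i = 0 then C $ i else 0)"
proof (rule vec_tendstoI)
  fix i
  have tp: "\<forall>\<^sub>F n in sequentially. t n > 0"
    using t by (simp add: filterlim_at_top_dense)
  have ci: "(\<lambda>n. c n $ i) \<longlonglongrightarrow> C $ i" using c by (rule tendsto_vec_nth)
  show "(\<lambda>n. rescale (t n) g (c n) $ i) \<longlonglongrightarrow> (\<chi> i. if g $ i = 0 then C $ i else 0) $ i"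
  proof (cases "g $ i = 0")
    case True
    then show ?thesis using ci tp
      by (auto elim!: Lim_transform_eventually eventually_mono)
  next
    case False
    with g have "g $ i < 0" by (simp add: less_le)
    then have "(\<lambda>n. of_real (t n powr (g $ i)) * c n $ i) \<longlonglongrightarrow> of_real 0 * C $ i"
      using t ci by (intro tendsto_mult tendsto_of_real tendsto_powr_at_top_neg)
    then show ?thesis using False by simp
  qed
qed


subsection \<open>Critical points of families degenerating along a tropical Morse polynomial\<close>

definition line_value :: "('n::finite \<Rightarrow> int) \<Rightarrow> real ^ 'n \<Rightarrow> real \<Rightarrow> 'n \<Rightarrow> real" where
  "line_value a g s i = real_of_int (a i) * s + g $ i"

definition maximizers :: "('n::finite \<Rightarrow> int) \<Rightarrow> real ^ 'n \<Rightarrow> real \<Rightarrow> 'n set" where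
  "maximizers a g s = {i. \<forall>k. line_value a g s k \<le> line_value a g s i}"

text \<open>
  The consequences of (A1) and (A2) on which the asymptotics depend.  They are stable under convex
  combinations of covectors with the same combinatorial data, which (A1) itself is not.
\<close>

definition generic :: "('n::finite \<Rightarrow> int) \<Rightarrow> real ^ 'n \<Rightarrow> bool" where
  "generic a g \<longleftrightarrow>
     (\<forall>s p q i k. p \<noteq> q \<and> p \<in> maximizers a g s \<and> q \<in> maximizers a g s \<and> i \<noteq> k \<and> line_value a g s i = line_value a g s k
        \<longrightarrow> {i, k} = {p, q}) \<and>
     (\<forall>s s' p q p' q'. s \<noteq> s' \<and> p \<noteq> q \<and> p \<in> maximizers a g s \<and> q \<in> maximizers a g s \<and>
        p' \<noteq> q' \<and> p' \<in> maximizers a g s' \<and> q' \<in> maximizers a g s' \<longrightarrow> line_value a g s p \<noteq> line_value a g s' p')"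

lemma maximizers_line_value_eq: "p \<in> maximizers a g s \<Longrightarrow> q \<in> maximizers a g s \<Longrightarrow> line_value a g s p = line_value a g s q"
  by (auto simp: maximizers_def intro: antisym)

text \<open>Were all other terms smaller than the largest one divided by \<open>CARD('n)\<close>,
  their sum could not cancel it. This is the analytic source of the condition that two lines attain
  the maximum at a tropical root.\<close>

lemma dominant_pair:
  fixes T :: "'n::finite \<Rightarrow> complex"
  assumes "sum T UNIV = 0" "\<And>i. T i \<noteq> 0"
  shows "\<exists>p q. p \<noteq> q \<and> (\<forall>i. norm (T i) \<le> norm (T p)) \<and> norm (T p) \<le> real CARD('n) * norm (T q)"
proof -
  have "Max (range (\<lambda>i. norm (T i))) \<in> range (\<lambda>i. norm (T i))" by (intro Max_in) auto
  then obtain p where "norm (T p) = Max (range (\<lambda>i. norm (T i)))" by (metis imageE)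
  then have p: "norm (T i) \<le> norm (T p)" for i by simp
  have "\<exists>q. q \<noteq> p \<and> norm (T p) \<le> real CARD('n) * norm (T q)"
  proof (rule ccontr)
    assume "\<not> ?thesis"
    then have neg: "real CARD('n) * norm (T q) < norm (T p)" if "q \<noteq> p" for q using that by force
    have "T p = - (\<Sum>i\<in>UNIV-{p}. T i)"
      using assms(1) sum.remove[of UNIV p T] by (simp add: eq_neg_iff_add_eq_0)
    then have "norm (T p) \<le> (\<Sum>i\<in>UNIV-{p}. norm (T i))" by (simp add: norm_sum)
    then have "real CARD('n) * norm (T p) \<le> (\<Sum>i\<in>UNIV-{p}. real CARD('n) * norm (T i))"
      by (simp flip: sum_distrib_left)
    also have "\<dots> \<le> (\<Sum>i\<in>UNIV-{p}. norm (T p))"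
      by (intro sum_mono less_imp_le neg) auto
    also have "\<dots> = (real CARD('n) - 1) * norm (T p)"
      by (simp add: card_Diff_singleton of_nat_diff Suc_leI)
    finally have "norm (T p) \<le> 0" by (simp add: algebra_simps)
    with assms(2) show False by simp
  qed
  with p show ?thesis by metis
qed

lemma infinite_pigeonhole:
  fixes f :: "nat \<Rightarrow> 'b::finite"
  obtains v r where "strict_mono (r :: nat \<Rightarrow> nat)" "\<And>n. f (r n) = v"
proof -
  obtain v where "infinite {n. f n = v}"
    using pigeonhole_infinite[of UNIV f] by (auto simp: infinite_UNIV_nat)
  then obtain r :: "nat \<Rightarrow> nat" where "strict_mono r" "\<And>n. r n \<in> {n. f n = v}"
    using infinite_enumerate by blast
  then show ?thesis using that by blast
qed

lemma bounded_of_tendsto_nonzero: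
  fixes f :: "nat \<Rightarrow> 'a::real_normed_vector"
  assumes "f \<longlonglongrightarrow> l" "l \<noteq> 0" "\<And>n. f n \<noteq> 0"
  obtains K where "K > 0" "\<And>n. \<bar>ln (norm (f n))\<bar> \<le> K"
proof -
  have "(\<lambda>n. ln (norm (f n))) \<longlonglongrightarrow> ln (norm l)"
    using assms by (intro tendsto_intros) auto
  then have "Bseq (\<lambda>n. ln (norm (f n)))" using convergentI convergent_imp_Bseq by blast
  then show ?thesis using that unfolding Bseq_def by (metis real_norm_def)
qed

text \<open>At a zero of the \<open>theta\<close> polynomial two monomials are comparable and
  dominate the others. Comparability forces \<open>norm (x n)\<close> to be
  \<open>t n powr s\<close> up to bounded factors, with \<open>s\<close> the crossing point of two
  lines; dominance makes these lines maximal, as a higher line would win by a factor growing with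
  \<open>t\<close>.\<close>

lemma critical_points_rescaled:
  fixes a :: "'n::finite \<Rightarrow> int"
  assumes inj: "inj a" and az: "\<And>i. a i \<noteq> 0"
    and t: "filterlim t at_top sequentially" "\<And>n. t n > 1"
    and c: "c \<longlonglongrightarrow> C" "\<And>i. C $ i \<noteq> 0" "\<And>n i. c n $ i \<noteq> 0"
    and x: "\<And>n. critical_point a (rescale (t n) g (c n)) (x n)"
  shows "\<exists>r s p q y Y. strict_mono (r::nat \<Rightarrow> nat) \<and> p \<noteq> q \<and> p \<in> maximizers a g s \<and> q \<in> maximizers a g s \<and>
    (\<forall>n. x (r n) = of_real (t (r n) powr s) * y n) \<and> (\<forall>n. y n \<noteq> 0) \<and> y \<longlonglongrightarrow> Y \<and> Y \<noteq> 0"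
proof -
  have xnz: "x n \<noteq> 0" and xcrit: "laurent a (theta a (rescale (t n) g (c n))) (x n) = 0" for n
    using x[of n] by (auto simp: critical_point_iff)
  have tp: "t n > 0" for n using t(2)[of n] by simp
  define T where "T n i = theta a (rescale (t n) g (c n)) $ i * x n powi a i" for n i
  \<comment> \<open>The exponents are nonzero, so \<open>theta\<close> loses no monomial and every
    term has a logarithm.\<close>
  have Tnz: "T n i \<noteq> 0" for n i
    using xnz c(3) tp[of n] az by (simp add: T_def)
  have "\<exists>p q. p \<noteq> q \<and> (\<forall>i. norm (T n i) \<le> norm (T n p)) \<and> norm (T n p) \<le> real CARD('n) * norm (T n q)" for n
    using xcrit[of n] by (intro dominant_pair Tnz) (simp add: T_def laurent_def)
  then obtain P Q where PQ: "\<And>n. P n \<noteq> Q n" "\<And>n i. norm (T n i) \<le> norm (T n (P n))"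
      "\<And>n. norm (T n (P n)) \<le> real CARD('n) * norm (T n (Q n))" by metis
  obtain v r1 where r1: "strict_mono (r1 :: nat \<Rightarrow> nat)" "\<And>n. (\<lambda>n. (P n, Q n)) (r1 n) = v"
    by (rule infinite_pigeonhole[of "\<lambda>n. (P n, Q n)"]) auto
  obtain p q where v: "v = (p, q)" by (cases v)
  have Pp: "P (r1 n) = p" "Q (r1 n) = q" for n using r1(2)[of n] v by auto
  have pq: "p \<noteq> q" using PQ(1)[of "r1 0"] Pp by simp
  have apq: "real_of_int (a q) \<noteq> real_of_int (a p)" using pq inj by (auto dest: injD)
  define s where "s = (g $ p - g $ q) / real_of_int (a q - a p)"
  have spq: "line_value a g s p = line_value a g s q"
  proof -
    have "(real_of_int (a q) - real_of_int (a p)) * s = g $ p - g $ q" using apq by (simp add: s_def)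
    then show ?thesis by (simp add: line_value_def left_diff_distrib)
  qed
  define y where "y n = x n / of_real (t n powr s)" for n
  have xy: "x n = of_real (t n powr s) * y n" for n using tp[of n] by (simp add: y_def)
  have ynz: "y n \<noteq> 0" for n using xnz tp[of n] by (simp add: y_def)
  \<comment> \<open>The logarithm of the norm of term \<open>i\<close>, split into a bounded part, a
    part in \<open>y n\<close> and the order in \<open>t\<close>.\<close>
  define L where "L n i = ln (norm (of_int (a i) * c n $ i)) + real_of_int (a i) * ln (norm (y n)) + ln (t n) * line_value a g s i" for n i
  have lnT: "ln (norm (T n i)) = L n i" for n i
  proof -
    have "norm (T n i) = norm (of_int (a i) * c n $ i) * (t n powr g $ i) * ((t n powr s) powi a i * norm (y n) powi a i)"
      using tp[of n] by (simp add: T_def xy norm_mult norm_power_int power_int_mult_distrib)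
    also have "\<dots> = norm (of_int (a i) * c n $ i) * norm (y n) powi a i * t n powr line_value a g s i"
      using tp[of n] by (simp add: powr_powi line_value_def powr_add)
    also have "norm (y n) powi a i = norm (y n) powr real_of_int (a i)"
      using ynz[of n] by (simp add: powr_real_of_int')
    finally have eq: "norm (T n i) = norm (of_int (a i) * c n $ i) * norm (y n) powr real_of_int (a i) * t n powr line_value a g s i" .
    have "norm (of_int (a i) * c n $ i) > 0" using c(3) az by simp
    moreover have "ln (u * v * w) = ln u + ln v + ln w" if "u > 0" "v > 0" "w > 0" for u v w :: real
      using that by (simp add: ln_mult)
    ultimately show ?thesis unfolding eq L_def using tp[of n] ynz[of n] by simp
  qed
  have lc: "\<exists>K>0. \<forall>n. \<bar>ln (norm (of_int (a i) * c n $ i))\<bar> \<le> K" for i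
  proof -
    have "(\<lambda>n. of_int (a i) * c n $ i) \<longlonglongrightarrow> of_int (a i) * C $ i" using c(1) by (intro tendsto_intros)
    from bounded_of_tendsto_nonzero[OF this] show ?thesis
      using c(2,3) az by (metis mult_eq_0_iff of_int_eq_0_iff)
  qed
  then obtain K where K: "\<And>i n. \<bar>ln (norm (of_int (a i) * c n $ i))\<bar> \<le> K i" by metis
  define y1 where "y1 n = y (r1 n)" for n
  have dom: "L (r1 n) i \<le> L (r1 n) p" for n i
    using PQ(2)[of "r1 n" i] Tnz by (simp add: Pp flip: lnT)
  have dom2: "L (r1 n) p \<le> ln (real CARD('n)) + L (r1 n) q" for n
  proof -
    have "ln (norm (T (r1 n) p)) \<le> ln (real CARD('n) * norm (T (r1 n) q))"
      using PQ(3)[of "r1 n"] Tnz by (simp add: Pp)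
    then show ?thesis using Tnz by (simp add: ln_mult lnT)
  qed
  \<comment> \<open>Terms \<open>p\<close> and \<open>q\<close> have the same order in
    \<open>t\<close> and norms within a factor \<open>CARD('n)\<close>. Up to the bounded
    coefficients, their ratio is a nonzero power of \<open>norm (y n)\<close>, which is thereby
    bounded in both directions.\<close>
  define B where "B = (ln (real CARD('n)) + K p + K q) / \<bar>real_of_int (a q) - real_of_int (a p)\<bar>"
  have lny: "\<bar>ln (norm (y1 n))\<bar> \<le> B" for n
  proof -
    have "\<bar>(real_of_int (a q) - real_of_int (a p)) * ln (norm (y1 n))\<bar> \<le> ln (real CARD('n)) + K p + K q"
    proof -
      have "(real_of_int (a q) - real_of_int (a p)) * ln (norm (y1 n))
          = ln (norm (of_int (a p) * c (r1 n) $ p)) - ln (norm (of_int (a q) * c (r1 n) $ q)) - (L (r1 n) p - L (r1 n) q)"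
        unfolding L_def y1_def spq by (simp add: left_diff_distrib)
      then show ?thesis
        using dom[of n q] dom2[of n] K[of p "r1 n"] K[of q "r1 n"] ln_ge_zero[of "real CARD('n)"] by linarith
    qed
    then show ?thesis using apq by (simp add: B_def abs_mult pos_le_divide_eq mult.commute)
  qed
  have yB: "exp (- B) \<le> norm (y1 n)" "norm (y1 n) \<le> exp B" for n
  proof -
    have "norm (y1 n) = exp (ln (norm (y1 n)))" using ynz by (simp add: y1_def)
    moreover have "- B \<le> ln (norm (y1 n))" "ln (norm (y1 n)) \<le> B" using lny[of n] by auto
    ultimately show "exp (- B) \<le> norm (y1 n)" "norm (y1 n) \<le> exp B" by (metis exp_le_cancel_iff)+
  qed
  have "bounded (range y1)" using yB(2) by (auto simp: bounded_iff)
  then obtain Y r2 where r2: "strict_mono (r2 :: nat \<Rightarrow> nat)" "(y1 \<circ> r2) \<longlonglongrightarrow> Y"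
    using bounded_imp_convergent_subsequence by blast
  have "exp (- B) \<le> norm Y"
    using tendsto_norm[OF r2(2)] yB(1) by (intro tendsto_lowerbound) (auto simp: o_def)
  then have Y: "Y \<noteq> 0" using exp_gt_zero[of "-B"] by (auto simp del: exp_gt_zero)
  have pm: "p \<in> maximizers a g s"
  proof (unfold maximizers_def, intro CollectI allI, rule ccontr)
    fix i assume "\<not> line_value a g s i \<le> line_value a g s p"
    then have d: "line_value a g s i - line_value a g s p > 0" by simp
    \<comment> \<open>Everything but the order in \<open>t\<close> is bounded by \<open>E\<close>,
      whereas \<open>ln (t (r1 n))\<close> is unbounded.\<close>
    define E where "E = K i + K p + \<bar>real_of_int (a i) - real_of_int (a p)\<bar> * B"
    have "ln (t (r1 n)) * (line_value a g s i - line_value a g s p) \<le> E" for n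
    proof -
      have "\<bar>(real_of_int (a i) - real_of_int (a p)) * ln (norm (y1 n))\<bar> \<le> \<bar>real_of_int (a i) - real_of_int (a p)\<bar> * B"
        unfolding abs_mult by (intro mult_left_mono lny) auto
      moreover have "ln (t (r1 n)) * (line_value a g s i - line_value a g s p) = L (r1 n) i - L (r1 n) p
          + ln (norm (of_int (a p) * c (r1 n) $ p)) - ln (norm (of_int (a i) * c (r1 n) $ i))
          - (real_of_int (a i) - real_of_int (a p)) * ln (norm (y1 n))"
        unfolding L_def y1_def by (simp add: left_diff_distrib right_diff_distrib)
      ultimately show ?thesis
        using dom[of n i] K[of p "r1 n"] K[of i "r1 n"] unfolding E_def by linarith
    qed
    moreover have "filterlim (\<lambda>n. ln (t (r1 n)) * (line_value a g s i - line_value a g s p)) at_top sequentially"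
      by (intro filterlim_at_top_mult_tendsto_pos[OF tendsto_const d] filterlim_compose[OF ln_at_top]
          filterlim_compose[OF t(1)] filterlim_subseq r1)
    ultimately show False
      unfolding filterlim_at_top_dense eventually_sequentially by (meson linorder_not_less order_refl)
  qed
  moreover have "q \<in> maximizers a g s" using pm spq by (simp add: maximizers_def)
  moreover have "strict_mono (r1 \<circ> r2)" using r1(1) r2(1) by (rule strict_mono_o)
  ultimately show ?thesis using pq xy ynz r2(2) Y
    by (intro exI[of _ "r1 \<circ> r2"] exI[of _ s] exI[of _ p] exI[of _ q] exI[of _ "y \<circ> (r1 \<circ> r2)"] exI[of _ Y])
       (auto simp: y1_def o_def)
qed


lemma maximizers_eq_pair:
  assumes "generic a g" "p \<noteq> q" "p \<in> maximizers a g s" "q \<in> maximizers a g s"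
  shows "maximizers a g s = {p, q}"
proof -
  have "i \<in> {p, q}" if "i \<in> maximizers a g s" for i
  proof (rule ccontr)
    assume "i \<notin> {p, q}"
    moreover from this have "{i, p} = {p, q}"
      using assms maximizers_line_value_eq[OF that assms(3)] unfolding generic_def by blast
    ultimately show False by auto
  qed
  with assms show ?thesis by blast
qed

lemma laurent_pair:
  assumes "p \<noteq> q"
  shows "laurent a (\<chi> i. if i \<in> {p, q} then c $ i else 0) x = c $ p * x powi a p + c $ q * x powi a q"
proof -
  have "laurent a (\<chi> i. if i \<in> {p, q} then c $ i else 0) x = (\<Sum>i\<in>{p, q}. c $ i * x powi a i)"
    unfolding laurent_def by (intro sum.mono_neutral_cong_right) auto
  then show ?thesis using assms by simp
qed

lemma tendsto_rescale_tilt: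
  assumes t: "filterlim t at_top sequentially" and c: "c \<longlonglongrightarrow> C" and m: "maximizers a g s = {p, q}"
  shows "(\<lambda>n. rescale (t n) (tilt a g s (line_value a g s p)) (c n)) \<longlonglongrightarrow> (\<chi> i. if i \<in> {p, q} then C $ i else 0)"
proof -
  have eq: "tilt a g s (line_value a g s p) $ i = line_value a g s i - line_value a g s p" for i by (simp add: line_value_def)
  have p: "p \<in> maximizers a g s" using m by simp
  have "tilt a g s (line_value a g s p) $ i = 0 \<longleftrightarrow> i \<in> {p, q}" for i
    unfolding m[symmetric] eq using p by (auto simp: maximizers_def) (metis order_antisym)
  moreover have "tilt a g s (line_value a g s p) $ i \<le> 0" for i
    unfolding eq using p by (auto simp: maximizers_def)
  ultimately show ?thesis using tendsto_rescale[OF t c, of "tilt a g s (line_value a g s p)"] by simp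
qed

text \<open>Criticality and the definition of the value are two linear equations in the two
  monomials. Solving them recovers the monomials from the critical value, so that critical points
  with equal values agree on both monomials. The iterated \<open>theta\<close> is evaluated by the
  same relation, and nonzero exponents keep it from vanishing.\<close>

lemma two_term_critical:
  assumes "p \<noteq> q" "inj a" "\<And>i. a i \<noteq> 0" "\<And>i. C $ i \<noteq> 0" "Y \<noteq> 0"
    and B: "B = (\<chi> i. if i \<in> {p, q} then C $ i else 0)"
    and crit: "laurent a (theta a B) Y = 0"
  shows "laurent a (theta a (theta a B)) Y \<noteq> 0" "laurent a B Y \<noteq> 0"
    "of_int (a q) * laurent a B Y = of_int (a q - a p) * C $ p * Y powi a p"
    "of_int (a p) * laurent a B Y = of_int (a p - a q) * C $ q * Y powi a q"
proof -
  have th: "theta a B = (\<chi> i. if i \<in> {p, q} then theta a C $ i else 0)"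
       "theta a (theta a B) = (\<chi> i. if i \<in> {p, q} then theta a (theta a C) $ i else 0)"
    by (auto simp: B vec_eq_iff)
  have apq: "a q - a p \<noteq> 0" using assms(1,2) by (auto dest: injD)
  have c: "of_int (a p) * C $ p * Y powi a p + of_int (a q) * C $ q * Y powi a q = 0"
    using crit unfolding th laurent_pair[OF \<open>p \<noteq> q\<close>] by simp
  have F: "laurent a B Y = C $ p * Y powi a p + C $ q * Y powi a q"
    unfolding B laurent_pair[OF \<open>p \<noteq> q\<close>] by simp
  show 1: "of_int (a q) * laurent a B Y = of_int (a q - a p) * C $ p * Y powi a p"
       "of_int (a p) * laurent a B Y = of_int (a p - a q) * C $ q * Y powi a q"
    unfolding F of_int_diff using c by algebra+
  have "of_int (a q - a p) * C $ p * Y powi a p \<noteq> 0" using apq assms by (simp del: of_int_diff)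
  with 1 show "laurent a B Y \<noteq> 0" by auto
  have "laurent a (theta a (theta a B)) Y = of_int (a q - a p) * (of_int (a q) * C $ q * Y powi a q)"
    unfolding th(2) laurent_pair[OF \<open>p \<noteq> q\<close>, of a "theta a (theta a C)"] unfolding theta_nth of_int_diff
    using c by algebra
  also have "\<dots> \<noteq> 0" using apq assms by (simp del: of_int_diff)
  finally show "laurent a (theta a (theta a B)) Y \<noteq> 0" .
qed

lemma laurent_theta_rescale_eq_0:
  assumes "t > 0"
  shows "laurent a (theta a (rescale t g c)) (of_real (t powr s) * y) = 0 \<longleftrightarrow>
         laurent a (theta a (rescale t (tilt a g s e) c)) y = 0"
    "laurent a (theta a (theta a (rescale t g c))) (of_real (t powr s) * y) = 0 \<longleftrightarrow>
         laurent a (theta a (theta a (rescale t (tilt a g s e) c))) y = 0"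
  using assms by (simp_all add: theta_rescale laurent_rescale[where e = e])

text \<open>The equations for \<open>theta\<close> and its iterate are compatible with rescaling, so
  both pass to the limit and would give the binomial a degenerate critical point.\<close>

lemma caustic_avoided:
  fixes a :: "'n::finite \<Rightarrow> int"
  assumes inj: "inj a" and az: "\<And>i. a i \<noteq> 0" and generic: "generic a g"
    and t: "filterlim t at_top sequentially" "\<And>n. t n > 1"
    and c: "c \<longlonglongrightarrow> C" "\<And>i. C $ i \<noteq> 0" "\<And>n i. c n $ i \<noteq> 0"
    and x: "\<And>n. degenerate_critical_point a (rescale (t n) g (c n)) (x n)"
  shows False
proof -
  have "critical_point a (rescale (t n) g (c n)) (x n)" for n
    using x by (simp add: degenerate_critical_point_def)
  from critical_points_rescaled[OF inj az t c this]
  obtain r s p q y Y where r: "strict_mono (r::nat \<Rightarrow> nat)" and pq: "p \<noteq> q" "p \<in> maximizers a g s" "q \<in> maximizers a g s"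
    and xy: "\<And>n. x (r n) = of_real (t (r n) powr s) * y n" and y: "\<And>n. y n \<noteq> 0" "y \<longlonglongrightarrow> Y" "Y \<noteq> 0"
    by blast
  define B where "B = (\<chi> i. if i \<in> {p, q} then C $ i else 0)"
  define b where "b n = rescale (t (r n)) (tilt a g s (line_value a g s p)) (c (r n))" for n
  have b: "b \<longlonglongrightarrow> B" unfolding b_def B_def
    by (intro tendsto_rescale_tilt maximizers_eq_pair generic pq filterlim_compose[OF t(1)] filterlim_subseq r
        LIMSEQ_subseq_LIMSEQ[OF c(1), unfolded o_def])
  have tp: "t n > 0" for n using t(2)[of n] by simp
  have "laurent a (theta a (b n)) (y n) = 0" "laurent a (theta a (theta a (b n))) (y n) = 0" for n
    using x[of "r n"] tp unfolding degenerate_critical_point_iff xy b_def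
    by (simp_all add: laurent_theta_rescale_eq_0[where e = "line_value a g s p"])
  then have "laurent a (theta a B) Y = 0" "laurent a (theta a (theta a B)) Y = 0"
    using tendsto_laurent[OF tendsto_theta[OF b] y(2,3), of a a]
      tendsto_laurent[OF tendsto_theta[OF tendsto_theta[OF b]] y(2,3), of a a a]
    by (simp_all add: LIMSEQ_const_iff)
  then show False using two_term_critical(1)[OF pq(1) inj az c(2) y(3) B_def] by blast
qed

section \<open>Separation of critical values\<close>

lemma values_at_distinct_orders:
  fixes F G :: "nat \<Rightarrow> complex"
  assumes t: "filterlim t at_top sequentially" "\<And>n. t n > 0"
    and F: "F \<longlonglongrightarrow> f" and G: "G \<longlonglongrightarrow> g" "g \<noteq> 0"
    and eq: "\<And>n. of_real (t n powr d) * F n = of_real (t n powr e) * G n" and de: "d < e"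
  shows False
proof -
  have "G n = of_real (t n powr (d - e)) * F n" for n
    using eq[of n] t(2)[of n] by (simp add: powr_diff field_simps)
  moreover have "(\<lambda>n. of_real (t n powr (d - e)) * F n) \<longlonglongrightarrow> of_real 0 * f"
    using de by (intro tendsto_mult tendsto_of_real tendsto_powr_at_top_neg t F) auto
  ultimately have "G \<longlonglongrightarrow> 0" by (simp add: LIMSEQ_iff)
  then show False using G LIMSEQ_unique by blast
qed

text \<open>Writing \<open>1\<close> as an integer combination of the exponents turns
  \<open>z\<close> into a product of powers of the \<open>z powi a i\<close>.\<close>

lemma powi_generates:
  fixes z :: complex
  assumes "affinely_generates_int a" "z \<noteq> 0" "\<And>i. z powi a i = 1"
  shows "z = 1"
proof -
  obtain m where m: "(\<Sum>i\<in>UNIV. m i * a i) = 1"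
    using assms(1) unfolding affinely_generates_int_def by blast
  have "z powi (\<Sum>i\<in>A. m i * a i) = 1" if "finite A" for A
    using that
  proof (induction A)
    case (insert i A)
    have "z powi (m i * a i) = 1"
      by (metis assms(3) mult.commute power_int_1_left power_int_mult)
    with insert show ?case using assms(2) by (simp add: power_int_add)
  qed simp
  from this[of UNIV] m show ?thesis by simp
qed

text \<open>\<open>h\<close> stands for the orders of the monomials at the common root, normalized
  so that the leading pair has order \<open>0\<close>; the last condition on \<open>h\<close>
  excludes every other tie.\<close>

lemma maxwell_avoided_same_root:
  fixes a :: "'n::finite \<Rightarrow> int"
  assumes inj: "inj a" and az: "\<And>i. a i \<noteq> 0" and gen: "affinely_generates_int a"
    and pq: "p \<noteq> q"
    and h: "\<And>i. h $ i \<le> 0" "\<And>i. h $ i = 0 \<longleftrightarrow> i \<in> {p, q}"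
       "\<And>i k. i \<noteq> k \<Longrightarrow> h $ i = h $ k \<Longrightarrow> {i, k} = {p, q}"
    and t: "filterlim t at_top sequentially" "\<And>n. t n > 0"
    and c: "c \<longlonglongrightarrow> C" "\<And>i. C $ i \<noteq> 0"
    and y: "\<And>n. y n \<noteq> 0" "y \<longlonglongrightarrow> Y" "Y \<noteq> 0"
    and y': "\<And>n. y' n \<noteq> 0" "y' \<longlonglongrightarrow> Y'" "Y' \<noteq> 0"
    and ne: "\<And>n. y n \<noteq> y' n"
    and crit: "\<And>n. laurent a (theta a (rescale (t n) h (c n))) (y n) = 0"
      "\<And>n. laurent a (theta a (rescale (t n) h (c n))) (y' n) = 0"
    and val: "\<And>n. laurent a (rescale (t n) h (c n)) (y n) = laurent a (rescale (t n) h (c n)) (y' n)"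
  shows False
proof -
  define b where "b n = rescale (t n) h (c n)" for n
  define B where "B = (\<chi> i. if i \<in> {p, q} then C $ i else 0)"
  have b: "b \<longlonglongrightarrow> B"
    using tendsto_rescale[OF t(1) c(1), of h] h(1,2) by (simp add: b_def[abs_def] B_def)
  have critB: "laurent a (theta a B) Y = 0" "laurent a (theta a B) Y' = 0"
    using tendsto_laurent[OF tendsto_theta[OF b] y(2,3), of a a]
      tendsto_laurent[OF tendsto_theta[OF b] y'(2,3), of a a] crit
    by (simp_all add: LIMSEQ_const_iff b_def)
  have valB: "laurent a B Y = laurent a B Y'"
    using tendsto_laurent[OF b y(2,3), of a] tendsto_laurent[OF b y'(2,3), of a] val
    by (auto simp: b_def intro: LIMSEQ_unique)
  note Y = two_term_critical[OF pq inj az c(2) y(3) B_def critB(1)]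
  note Y' = two_term_critical[OF pq inj az c(2) y'(3) B_def critB(2)]
  have apq: "a q - a p \<noteq> 0" "a p - a q \<noteq> 0" using pq inj by (auto dest: injD)
  \<comment> \<open>The two limit points differ by a root of unity \<open>z\<close> fixing both monomials of the binomial.\<close>
  define z where "z = Y' / Y"
  have z0: "z \<noteq> 0" using y y' by (simp add: z_def)
  have zp: "z powi a p = 1" "z powi a q = 1"
    using Y(3,4) Y'(3,4) valB apq c(2) y(3)
    by (simp_all add: z_def power_int_divide_distrib del: of_int_diff)
  show False
  proof (cases "z = 1")
    case True
    then have "Y' = Y" using y by (simp add: z_def)
    with y' have "y' \<longlonglongrightarrow> Y" by simp
    from tendsto_laurent_difference_quotient[OF tendsto_theta[OF b] y(2) this y(3) y(1) y'(1), of a a]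
    obtain d where d: "d \<longlonglongrightarrow> laurent a (theta a (theta a B)) Y / Y"
      "\<And>n. laurent a (theta a (b n)) (y n) - laurent a (theta a (b n)) (y' n) = (y n - y' n) * d n"
      by blast
    \<comment> \<open>\<open>d n\<close> is the slope between two distinct zeros of
      \<open>theta a (b n)\<close>, hence zero, while its limit is nonzero.\<close>
    have "d = (\<lambda>n. 0)"
    proof
      show "d n = 0" for n using d(2)[of n] crit[of n] ne[of n] by (simp add: b_def)
    qed
    then have "(\<lambda>n. 0) \<longlonglongrightarrow> laurent a (theta a (theta a B)) Y / Y" using d(1) by simp
    then have "laurent a (theta a (theta a B)) Y / Y = 0" by (simp only: LIMSEQ_const_iff)
    then show False using Y(1) y(3) by simp
  next
    case False
    \<comment> \<open>Multiplication by \<open>z\<close> changes the polynomial only by terms of order \<open>t powr h\<^sub>j\<close> for the dominant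
      exponent \<open>j\<close> in \<open>S\<close>; this moves the critical point by \<open>O(t powr h\<^sub>j)\<close>, hence the critical value by
      \<open>o(t powr h\<^sub>j)\<close> only.\<close>
    define S where "S = {i. z powi a i \<noteq> 1}"
    have "S \<noteq> {}" using powi_generates[OF gen z0] False by (auto simp: S_def)
    then have "Max ((\<lambda>i. h $ i) ` S) \<in> (\<lambda>i. h $ i) ` S" by (intro Max_in) auto
    then obtain j where j: "j \<in> S" "h $ j = Max ((\<lambda>i. h $ i) ` S)" by auto
    have jmax: "h $ i \<le> h $ j" if "i \<in> S" for i using that unfolding j(2) by simp
    have pS: "p \<notin> S" "q \<notin> S" using zp by (auto simp: S_def)
    have juniq: "h $ i \<noteq> h $ j" if "i \<in> S" "i \<noteq> j" for i
      using h(3)[OF that(2)] pS j(1) that(1) by (auto simp: doubleton_eq_iff)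
    \<comment> \<open>The orders within \<open>S\<close> relative to that of \<open>j\<close>.
      Outside \<open>S\<close> the vector \<open>m c\<close> vanishes, and the value
      \<open>0\<close> there merely keeps all entries nonpositive.\<close>
    define k where "k = (\<chi> i. if i \<in> S then h $ i - h $ j else 0)"
    define m where "m c = (\<chi> i. (z powi a i - 1) * c $ i)" for c :: "complex ^ 'n"
    define v where "v n = y' n / z" for n
    have v: "v \<longlonglongrightarrow> Y" "\<And>n. v n \<noteq> 0"
    proof -
      have "v \<longlonglongrightarrow> Y' / z" unfolding v_def by (intro tendsto_intros y' z0)
      then show "v \<longlonglongrightarrow> Y" using y' by (simp add: z_def)
    qed (use y' z0 in \<open>simp add: v_def\<close>)
    have key: "laurent a (rescale u h c) (z * x) = laurent a (rescale u h c) x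
        + of_real (u powr (h $ j)) * laurent a (rescale u k (m c)) x" if "u > 0" for u c x
    proof -
      have "rescale u h c $ i * (z * x) powi a i = rescale u h c $ i * x powi a i
          + of_real (u powr (h $ j)) * (rescale u k (m c) $ i * x powi a i)" for i
      proof (cases "i \<in> S")
        case True
        have "u powr (h $ i) = u powr (h $ j) * u powr (h $ i - h $ j)"
          by (simp flip: powr_add)
        then have "complex_of_real (u powr (h $ i)) = of_real (u powr (h $ j)) * of_real (u powr (h $ i - h $ j))"
          by (metis of_real_mult)
        with True show ?thesis by (simp add: k_def m_def power_int_mult_distrib algebra_simps)
      next
        case False
        then show ?thesis by (simp add: k_def m_def S_def power_int_mult_distrib)
      qed
      then show ?thesis by (simp only: laurent_def sum_distrib_left sum.distrib)
    qed
    have m_theta: "m (theta a c) = theta a (m c)" for c by (simp add: m_def vec_eq_iff)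
    define H where "H n = rescale (t n) k (m (c n))" for n
    define H0 where "H0 = (\<chi> i. if k $ i = 0 then m C $ i else 0)"
    have H: "H \<longlonglongrightarrow> H0" unfolding H_def H0_def
    proof (intro tendsto_rescale t)
      show "(\<lambda>n. m (c n)) \<longlonglongrightarrow> m C" unfolding m_def by (intro tendsto_intros c)
      show "k $ i \<le> 0" for i using jmax by (simp add: k_def)
    qed
    have H0i: "H0 $ i = (if i = j then (z powi a j - 1) * C $ j else 0)" for i
      using juniq j(1) by (auto simp: H0_def k_def m_def S_def)
    have "laurent a H0 Y = (\<Sum>i\<in>UNIV. if i = j then (z powi a j - 1) * C $ j * Y powi a j else 0)"
      unfolding laurent_def by (intro sum.cong) (auto simp: H0i)
    then have "laurent a H0 Y = (z powi a j - 1) * C $ j * Y powi a j" by simp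
    then have H0: "laurent a H0 Y \<noteq> 0" using j(1) c(2) y(3) by (simp add: S_def)
    have zv: "y' n = z * v n" for n using z0 by (simp add: v_def)
    obtain d where d: "d \<longlonglongrightarrow> laurent a (theta a B) Y / Y"
      "\<And>n. laurent a (b n) (v n) - laurent a (b n) (y n) = (v n - y n) * d n"
      using tendsto_laurent_difference_quotient[OF b v(1) y(2) y(3) v(2) y(1), of a] by blast
    obtain e where e: "e \<longlonglongrightarrow> laurent a (theta a (theta a B)) Y / Y"
      "\<And>n. laurent a (theta a (b n)) (v n) - laurent a (theta a (b n)) (y n) = (v n - y n) * e n"
      using tendsto_laurent_difference_quotient[OF tendsto_theta[OF b] v(1) y(2) y(3) v(2) y(1), of a a] by blast
    \<comment> \<open>The value equation and the critical point equation are both linear in the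
      displacement \<open>v n - y n\<close>; eliminating it also cancels \<open>T\<close>. In the
      limit \<open>d\<close> tends to \<open>0\<close> and \<open>e\<close> does not, so monomial
      \<open>j\<close> would vanish at \<open>Y\<close>.\<close>
    have "laurent a (H n) (v n) * e n = d n * laurent a (theta a (H n)) (v n)" for n
    proof -
      define T where "T = complex_of_real (t n powr (h $ j))"
      have T: "T \<noteq> 0" using t(2)[of n] by (simp add: T_def)
      have 1: "laurent a (b n) (y n) = laurent a (b n) (v n) + T * laurent a (H n) (v n)"
        using key[OF t(2)[of n], of "c n" "v n"] val[of n] by (simp add: b_def H_def zv T_def)
      have 2: "0 = laurent a (theta a (b n)) (v n) + T * laurent a (theta a (H n)) (v n)"
        using key[OF t(2)[of n], of "theta a (c n)" "v n"] crit(2)[of n]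
        by (simp add: b_def H_def zv T_def theta_rescale m_theta)
      have 3: "(v n - y n) * d n = - T * laurent a (H n) (v n)" using d(2)[of n] 1 by simp
      have 4: "(v n - y n) * e n = - T * laurent a (theta a (H n)) (v n)"
        using e(2)[of n] 2 crit(1)[of n] by (simp add: b_def eq_neg_iff_add_eq_0)
      have "T * (laurent a (H n) (v n) * e n) = T * (d n * laurent a (theta a (H n)) (v n))"
        using 3 4 by algebra
      then show ?thesis using T by simp
    qed
    then have "(\<lambda>n. d n * laurent a (theta a (H n)) (v n)) \<longlonglongrightarrow> laurent a H0 Y * (laurent a (theta a (theta a B)) Y / Y)"
      using tendsto_mult[OF tendsto_laurent[OF H v(1) y(3), of a] e(1)] by simp
    moreover have "(\<lambda>n. d n * laurent a (theta a (H n)) (v n)) \<longlonglongrightarrow> laurent a (theta a B) Y / Y * laurent a (theta a H0) Y"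
      by (intro tendsto_mult d tendsto_laurent tendsto_theta H v y)
    ultimately have "laurent a H0 Y * (laurent a (theta a (theta a B)) Y / Y) = 0"
      using LIMSEQ_unique critB(1) by fastforce
    then show False using H0 Y(1) y(3) by simp
  qed
qed


text \<open>Equal roots share the leading pair and hence the tilt, which gives the situation of a
  common root. At distinct roots \<open>generic\<close> separates the orders of the two values, and
  these orders are attained because critical values of binomials are nonzero.\<close>

lemma maxwell_avoided:
  fixes a :: "'n::finite \<Rightarrow> int"
  assumes inj: "inj a" and az: "\<And>i. a i \<noteq> 0" and gen: "affinely_generates_int a" and generic: "generic a g"
    and t: "filterlim t at_top sequentially" "\<And>n. t n > 1"
    and c: "c \<longlonglongrightarrow> C" "\<And>i. C $ i \<noteq> 0" "\<And>n i. c n $ i \<noteq> 0"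
    and x: "\<And>n. critical_point a (rescale (t n) g (c n)) (x n)"
    and x': "\<And>n. critical_point a (rescale (t n) g (c n)) (x' n)"
    and ne: "\<And>n. x n \<noteq> x' n"
    and val: "\<And>n. laurent a (rescale (t n) g (c n)) (x n) = laurent a (rescale (t n) g (c n)) (x' n)"
  shows False
proof -
  from critical_points_rescaled[OF inj az t c x]
  obtain r1 s p q y1 Y where r1: "strict_mono (r1::nat \<Rightarrow> nat)"
    and pq: "p \<noteq> q" "p \<in> maximizers a g s" "q \<in> maximizers a g s"
    and xy1: "\<And>n. x (r1 n) = of_real (t (r1 n) powr s) * y1 n"
    and y1: "\<And>n. y1 n \<noteq> 0" "y1 \<longlonglongrightarrow> Y" "Y \<noteq> 0"
    by blast
  have "filterlim (\<lambda>n. t (r1 n)) at_top sequentially"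
    by (intro filterlim_compose[OF t(1)] filterlim_subseq r1)
  \<comment> \<open>The second extraction runs along the first, so that both points are normalized
    on one common subsequence.\<close>
  from critical_points_rescaled[OF inj az this t(2) LIMSEQ_subseq_LIMSEQ[OF c(1) r1, unfolded o_def] c(2,3) x']
  obtain r2 s' p' q' y2 Y' where r2: "strict_mono (r2::nat \<Rightarrow> nat)"
    and pq': "p' \<noteq> q'" "p' \<in> maximizers a g s'" "q' \<in> maximizers a g s'"
    and xy2: "\<And>n. x' (r1 (r2 n)) = of_real (t (r1 (r2 n)) powr s') * y2 n"
    and y2: "\<And>n. y2 n \<noteq> 0" "y2 \<longlonglongrightarrow> Y'" "Y' \<noteq> 0"
    by blast
  define r where "r n = r1 (r2 n)" for n
  have r: "strict_mono r" using strict_mono_o[OF r1 r2] by (simp add: r_def[abs_def] o_def)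
  define y where "y n = y1 (r2 n)" for n
  have y: "\<And>n. y n \<noteq> 0" "y \<longlonglongrightarrow> Y"
    using y1 LIMSEQ_subseq_LIMSEQ[OF y1(2) r2] by (simp_all add: y_def[abs_def] o_def)
  have xy: "x (r n) = of_real (t (r n) powr s) * y n" and xy': "x' (r n) = of_real (t (r n) powr s') * y2 n" for n
    using xy1 xy2 by (simp_all add: r_def y_def)
  have tp: "t n > 0" for n using t(2)[of n] by simp
  have tr: "filterlim (\<lambda>n. t (r n)) at_top sequentially"
    by (intro filterlim_compose[OF t(1)] filterlim_subseq r)
  have cr: "(\<lambda>n. c (r n)) \<longlonglongrightarrow> C" by (rule LIMSEQ_subseq_LIMSEQ[OF c(1) r, unfolded o_def])
  note mx = maximizers_eq_pair[OF generic pq] and mx' = maximizers_eq_pair[OF generic pq']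
  define e where "e = line_value a g s p"
  define e' where "e' = line_value a g s' p'"
  have crit: "laurent a (theta a (rescale (t (r n)) (tilt a g s e) (c (r n)))) (y n) = 0"
      "laurent a (theta a (rescale (t (r n)) (tilt a g s' e') (c (r n)))) (y2 n) = 0" for n
    using x[of "r n"] x'[of "r n"] laurent_theta_rescale_eq_0(1)[OF tp] unfolding critical_point_iff xy xy'
    by blast+
  have vals: "of_real (t (r n) powr e) * laurent a (rescale (t (r n)) (tilt a g s e) (c (r n))) (y n)
      = of_real (t (r n) powr e') * laurent a (rescale (t (r n)) (tilt a g s' e') (c (r n))) (y2 n)" for n
    using val[of "r n"] unfolding xy xy' laurent_rescale[OF tp, of a _ g _ s _ e] laurent_rescale[OF tp, of a _ g _ s' _ e'] .
  show False
  proof (cases "s = s'")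
    case True
    have mm: "{p', q'} = {p, q}" using mx mx' True by simp
    then have ee: "e' = e"
      unfolding e_def e'_def True using maximizers_line_value_eq[OF pq'(2), of p] mx' by auto
    have eq: "tilt a g s e $ i = line_value a g s i - line_value a g s p" for i by (simp add: line_value_def e_def)
    show False
    proof (rule maxwell_avoided_same_root[OF inj az gen pq(1), where h = "tilt a g s e" and y = y and y' = y2 and Y = Y and Y' = Y' and C = C])
      show "tilt a g s e $ i \<le> 0" for i unfolding eq using pq(2) by (simp add: maximizers_def)
      show "tilt a g s e $ i = 0 \<longleftrightarrow> i \<in> {p, q}" for i
        unfolding eq mx[symmetric] using pq(2) by (auto simp: maximizers_def) (metis order_antisym)
      show "{i, k} = {p, q}" if "i \<noteq> k" "tilt a g s e $ i = tilt a g s e $ k" for i k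
        using generic pq that unfolding eq generic_def by (metis diff_add_cancel)
      show "y n \<noteq> y2 n" for n using ne[of "r n"] True unfolding xy xy' by auto
      show "laurent a (rescale (t (r n)) (tilt a g s e) (c (r n))) (y n) = laurent a (rescale (t (r n)) (tilt a g s e) (c (r n))) (y2 n)" for n
        using vals[of n] tp[of "r n"] unfolding ee True by simp
    qed (use crit True ee tr tp cr c y y1(3) y2 in auto)
  next
    case False
    then have ee: "e \<noteq> e'" using generic pq pq' unfolding e_def e'_def generic_def by blast
    define B where "B = (\<chi> i. if i \<in> {p, q} then C $ i else 0)"
    define B' where "B' = (\<chi> i. if i \<in> {p', q'} then C $ i else 0)"
    have b: "(\<lambda>n. rescale (t (r n)) (tilt a g s e) (c (r n))) \<longlonglongrightarrow> B"
      unfolding B_def e_def by (rule tendsto_rescale_tilt[OF tr cr mx])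
    have b': "(\<lambda>n. rescale (t (r n)) (tilt a g s' e') (c (r n))) \<longlonglongrightarrow> B'"
      unfolding B'_def e'_def by (rule tendsto_rescale_tilt[OF tr cr mx'])
    have "laurent a (theta a B) Y = 0" "laurent a (theta a B') Y' = 0"
      using tendsto_laurent[OF tendsto_theta[OF b] y(2) y1(3), of a a]
        tendsto_laurent[OF tendsto_theta[OF b'] y2(2,3), of a a] crit
      by (simp_all add: LIMSEQ_const_iff)
    then have "laurent a B Y \<noteq> 0" "laurent a B' Y' \<noteq> 0"
      using two_term_critical(2)[OF pq(1) inj az c(2) y1(3) B_def]
        two_term_critical(2)[OF pq'(1) inj az c(2) y2(3) B'_def] by blast+
    then show False
      using values_at_distinct_orders[OF tr tp tendsto_laurent[OF b y(2) y1(3)] tendsto_laurent[OF b' y2(2,3)] _ vals]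
        values_at_distinct_orders[OF tr tp tendsto_laurent[OF b' y2(2,3)] tendsto_laurent[OF b y(2) y1(3)] _ vals[symmetric]]
        ee by fastforce
  qed
qed

text \<open>Coefficients with norms between \<open>K1\<close> and \<open>K2\<close> have a
  subsequence converging inside the torus, and along a further one all failures are of the same
  kind, caustic or Maxwell.\<close>

lemma morse_asymptotically:
  fixes a :: "'n::finite \<Rightarrow> int"
  assumes inj: "inj a" and az: "\<And>i. a i \<noteq> 0" and gen: "affinely_generates_int a" and generic: "generic a g"
    and t: "filterlim t at_top sequentially" "\<And>n. t n > 1"
    and K: "K1 > 0" "\<And>n i. K1 \<le> norm (c n $ i)" "\<And>n i. norm (c n $ i) \<le> K2"
  shows "\<exists>n. is_morse a (rescale (t n) g (c n))"
proof (rule ccontr)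
  assume "\<not> ?thesis"
  then have nm: "\<not> is_morse a (rescale (t n) g (c n))" for n by blast
  have "bounded (range c)"
  proof -
    have "norm (c n) \<le> (\<Sum>i\<in>UNIV. norm (c n $ i))" for n
      unfolding norm_vec_def by (rule L2_set_le_sum) simp
    also have "(\<Sum>i\<in>UNIV. norm (c n $ i)) \<le> (\<Sum>i\<in>(UNIV::'n set). K2)" for n
      by (intro sum_mono K)
    finally have "norm (c n) \<le> (\<Sum>i\<in>(UNIV::'n set). K2)" for n .
    then show ?thesis by (auto simp: bounded_iff)
  qed
  then obtain C r1 where r1: "strict_mono (r1 :: nat \<Rightarrow> nat)" "(c \<circ> r1) \<longlonglongrightarrow> C"
    using bounded_imp_convergent_subsequence by blast
  have Cnz: "C $ i \<noteq> 0" for i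
  proof -
    have "(\<lambda>n. norm ((c \<circ> r1) n $ i)) \<longlonglongrightarrow> norm (C $ i)" by (intro tendsto_norm tendsto_vec_nth r1)
    then have "K1 \<le> norm (C $ i)" by (rule tendsto_lowerbound) (auto simp: K)
    then show ?thesis using K(1) by auto
  qed
  define P where "P n \<longleftrightarrow> (\<exists>x. degenerate_critical_point a (rescale (t (r1 n)) g (c (r1 n))) x)" for n
  obtain v r2 where r2: "strict_mono (r2 :: nat \<Rightarrow> nat)" "\<And>n. P (r2 n) = v"
    by (rule infinite_pigeonhole[of P]) auto
  define r where "r n = r1 (r2 n)" for n
  have r: "strict_mono r" using strict_mono_o[OF r1(1) r2(1)] by (simp add: r_def[abs_def] o_def)
  have tr: "filterlim (\<lambda>n. t (r n)) at_top sequentially" "\<And>n. t (r n) > 1"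
    by (intro filterlim_compose[OF t(1)] filterlim_subseq r t)+
  have cr: "(\<lambda>n. c (r n)) \<longlonglongrightarrow> C"
    using LIMSEQ_subseq_LIMSEQ[OF r1(2) r2(1)] by (simp add: o_def r_def)
  have cnz: "c (r n) $ i \<noteq> 0" for n i using K(1) K(2)[where n = "r n" and i = i] by auto
  show False
  proof (cases v)
    case True
    then obtain x where "\<And>n. degenerate_critical_point a (rescale (t (r n)) g (c (r n))) (x n)"
      using r2(2) unfolding P_def r_def by metis
    then show False using caustic_avoided[OF inj az generic tr cr Cnz cnz] by blast
  next
    case False
    then have "\<exists>x x'. x \<noteq> x' \<and> critical_point a (rescale (t (r n)) g (c (r n))) x \<and> critical_point a (rescale (t (r n)) g (c (r n))) x'
        \<and> laurent a (rescale (t (r n)) g (c (r n))) x = laurent a (rescale (t (r n)) g (c (r n))) x'" for n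
      using nm[of "r n"] r2(2)[of n]
      unfolding is_morse_def caustic_def maxwell_stratum_def coinciding_pairs_def P_def r_def by auto
    then obtain x x' where "\<And>n. x n \<noteq> x' n" "\<And>n. critical_point a (rescale (t (r n)) g (c (r n))) (x n)"
      "\<And>n. critical_point a (rescale (t (r n)) g (c (r n))) (x' n)"
      "\<And>n. laurent a (rescale (t (r n)) g (c (r n))) (x n) = laurent a (rescale (t (r n)) g (c (r n))) (x' n)"
      by metis
    then show False using maxwell_avoided[OF inj az gen generic tr cr Cnz cnz] by blast
  qed
qed

text \<open>A point of the closure is approximated by a non-Morse one to within a multiple of the
  smallest scale factor. Undoing the scaling turns this into a change of each coefficient by at most
  \<open>K1 / 2\<close>, which stays in a compact part of the torus.\<close>

lemma closure_strata_asymptotically: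
  fixes a :: "'n::finite \<Rightarrow> int"
  assumes inj: "inj a" and az: "\<And>i. a i \<noteq> 0" and gen: "affinely_generates_int a" and generic: "generic a g"
    and t: "filterlim t at_top sequentially" "\<And>n. t n > 1"
    and K: "K1 > 0" "\<And>n i. K1 \<le> norm (c n $ i)" "\<And>n i. norm (c n $ i) \<le> K2"
    and V: "V \<subseteq> {c. \<not> is_morse a c}"
  shows "\<exists>n. rescale (t n) g (c n) \<notin> closure V"
proof (rule ccontr)
  assume "\<not> ?thesis"
  then have cl: "rescale (t n) g (c n) \<in> closure V" for n by blast
  have tp: "t n > 0" for n using t(2)[of n] by simp
  define m where "m n = Min (range (\<lambda>i. t n powr (g $ i)))" for n
  have m: "m n > 0" "\<And>i. m n \<le> t n powr (g $ i)" for n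
    using tp[of n] by (simp_all add: m_def Min_gr_iff)
  have "\<exists>w. w \<in> V \<and> dist w (rescale (t n) g (c n)) < m n * (K1 / 2)" for n
    using cl[of n, unfolded closure_approachable, rule_format, of "m n * (K1 / 2)"] m(1)[of n] K(1) by auto
  then obtain w where w: "\<And>n. w n \<in> V" "\<And>n. dist (w n) (rescale (t n) g (c n)) < m n * (K1 / 2)" by metis
  define c' where "c' n = rescale (t n) (- g) (w n)" for n
  have wc: "rescale (t n) g (c' n) = w n" for n
    using tp[of n] by (simp add: vec_eq_iff c'_def powr_minus flip: mult.assoc of_real_mult)
  have d: "norm (c' n $ i - c n $ i) \<le> K1 / 2" for n i
  proof -
    have "norm (of_real (t n powr (g $ i)) * (c' n $ i - c n $ i)) = norm ((w n - rescale (t n) g (c n)) $ i)"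
      by (simp add: algebra_simps flip: wc)
    also have "\<dots> \<le> dist (w n) (rescale (t n) g (c n))"
      unfolding dist_norm by (rule Finite_Cartesian_Product.norm_nth_le)
    also have "\<dots> \<le> t n powr (g $ i) * (K1 / 2)"
      using w(2)[of n] m[of n] K(1) mult_right_mono[OF m(2)[of n i], of "K1/2"] by linarith
    finally show ?thesis using tp[of n] by (simp add: norm_mult)
  qed
  have b: "K1 / 2 \<le> norm (c' n $ i)" "norm (c' n $ i) \<le> K2 + K1 / 2" for n i
    using d[of n i] K(2,3)[of n i] norm_triangle_ineq2[of "c n $ i" "c' n $ i"]
      norm_triangle_ineq2[of "c' n $ i" "c n $ i"] norm_minus_commute[of "c n $ i" "c' n $ i"] by linarith+
  have "\<exists>n. is_morse a (rescale (t n) g (c' n))"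
    by (rule morse_asymptotically[OF inj az gen generic t, of "K1 / 2" _ "K2 + K1 / 2"]) (use K(1) b in auto)
  then show False using w(1) V by (auto simp: wc)
qed


subsection \<open>Polynomials in the coefficients and their leading monomials\<close>

abbreviation "lookup \<equiv> Poly_Mapping.lookup"
abbreviation "keys \<equiv> Poly_Mapping.keys"

definition monomial_value :: "complex ^ 'n::finite \<Rightarrow> ('n \<Rightarrow>\<^sub>0 nat) \<Rightarrow> complex" where
  "monomial_value c u = (\<Prod>i\<in>UNIV. (c $ i) ^ lookup u i)"

lemma monomial_value_add: "monomial_value c (u + v) = monomial_value c u * monomial_value c v"
  by (simp add: monomial_value_def lookup_add power_add prod.distrib)

lemma eval_cpoly_superset:
  assumes "finite U" "keys h \<subseteq> U"
  shows "eval_cpoly h c = (\<Sum>u\<in>U. lookup h u * monomial_value c u)"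
  unfolding eval_cpoly_def monomial_value_def using assms
  by (intro sum.mono_neutral_left) (auto simp: in_keys_iff)

lemma eval_cpoly_eq: "eval_cpoly h c = (\<Sum>u\<in>keys h. lookup h u * monomial_value c u)"
  by (rule eval_cpoly_superset) auto

lemma eval_cpoly_add: "eval_cpoly (f + g) c = eval_cpoly f c + eval_cpoly g c"
proof -
  have "eval_cpoly h c = (\<Sum>u\<in>keys f \<union> keys g. lookup h u * monomial_value c u)"
    if "h \<in> {f, g, f + g}" for h
    using that keys_add[of f g] by (intro eval_cpoly_superset) auto
  then show ?thesis by (simp add: lookup_add ring_distribs sum.distrib)
qed

lemma eval_cpoly_0 [simp]: "eval_cpoly 0 c = 0"
  by (simp add: eval_cpoly_eq)

lemma eval_cpoly_sum: "eval_cpoly (\<Sum>x\<in>X. f x) c = (\<Sum>x\<in>X. eval_cpoly (f x) c)"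
  by (induction X rule: infinite_finite_induct) (auto simp: eval_cpoly_add)

lemma eval_cpoly_single: "eval_cpoly (Poly_Mapping.single u x) c = x * monomial_value c u"
  by (subst eval_cpoly_superset[of "{u}"]) auto

lemma poly_mapping_eq_sum_single: "h = (\<Sum>u\<in>keys h. Poly_Mapping.single u (lookup h u))"
  by (rule poly_mapping_eqI) (auto simp: lookup_sum lookup_single when_def in_keys_iff)

lemma times_eq_sum_single:
  fixes f g :: "'a::comm_monoid_add \<Rightarrow>\<^sub>0 'b::comm_semiring_1"
  shows "f * g = (\<Sum>u\<in>keys f. \<Sum>v\<in>keys g. Poly_Mapping.single (u + v) (lookup f u * lookup g v))"
proof -
  have "f * g = (\<Sum>u\<in>keys f. Poly_Mapping.single u (lookup f u)) * (\<Sum>v\<in>keys g. Poly_Mapping.single v (lookup g v))"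
    by (simp flip: poly_mapping_eq_sum_single)
  then show ?thesis by (simp add: sum_product mult_single)
qed

lemma eval_cpoly_mult: "eval_cpoly (f * g) c = eval_cpoly f c * eval_cpoly g c"
  unfolding times_eq_sum_single[of f g] eval_cpoly_sum eval_cpoly_single
  by (simp add: eval_cpoly_eq sum_product monomial_value_add mult.assoc mult.left_commute)

lemma zero_set_mult: "zero_set (f * g) = zero_set f \<union> zero_set g"
  by (auto simp: zero_set_def eval_cpoly_mult)

lemma lookup_mult_unique:
  fixes f g :: "'a::comm_monoid_add \<Rightarrow>\<^sub>0 'b::comm_semiring_1"
  assumes "u \<in> keys f" "v \<in> keys g"
    and uniq: "\<And>u' v'. u' \<in> keys f \<Longrightarrow> v' \<in> keys g \<Longrightarrow> u' + v' = u + v \<Longrightarrow> u' = u \<and> v' = v"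
  shows "lookup (f * g) (u + v) = lookup f u * lookup g v"
proof -
  have "lookup (f * g) (u + v) = (\<Sum>u'\<in>keys f. \<Sum>v'\<in>keys g. if u' = u \<and> v' = v then lookup f u * lookup g v else 0)"
    unfolding times_eq_sum_single[of f g] lookup_sum lookup_single when_def
    by (intro sum.cong refl) (use uniq in auto)
  also have "\<dots> = (\<Sum>u'\<in>keys f. if u' = u then lookup f u * lookup g v else 0)"
    using assms by (intro sum.cong refl) auto
  also have "\<dots> = lookup f u * lookup g v" using assms by simp
  finally show ?thesis .
qed

text \<open>
  The size of the lexicographic leading monomial: it is additive on products and vanishes on
  constants only, so an equation of a hypersurface minimizing it is squarefree.
\<close>

definition lead_deg :: "('n::{finite,linorder}) cpoly \<Rightarrow> nat" where
  "lead_deg h = (\<Sum>i\<in>UNIV. lookup (Max (keys h)) i)"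

text \<open>The order on exponents is linear and strictly monotone under addition, so only one pair
  of exponents adds up to the sum of the leading ones, and no cancellation can occur there.\<close>

lemma Max_keys_mult:
  fixes f g :: "('n::{finite,linorder}) cpoly"
  assumes "f \<noteq> 0" "g \<noteq> 0"
  shows "Max (keys (f * g)) = Max (keys f) + Max (keys g)"
proof -
  have ne: "keys f \<noteq> {}" "keys g \<noteq> {}" using assms by (auto simp flip: keys_eq_empty)
  let ?u = "Max (keys f)" and ?v = "Max (keys g)"
  have mem: "?u \<in> keys f" "?v \<in> keys g" using ne by auto
  have "lookup (f * g) (?u + ?v) = lookup f ?u * lookup g ?v"
  proof (rule lookup_mult_unique[OF mem])
    fix u v assume "u \<in> keys f" "v \<in> keys g" and eq: "u + v = ?u + ?v"
    then have "u \<le> ?u" "v \<le> ?v" by auto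
    with eq show "u = ?u \<and> v = ?v"
      by (metis add_less_le_mono add_le_less_mono order_less_irrefl order_le_less)
  qed
  then have in_keys: "?u + ?v \<in> keys (f * g)" using mem by (simp add: in_keys_iff)
  show ?thesis
  proof (rule Max_eqI)
    fix w assume "w \<in> keys (f * g)"
    then obtain u v where "w = u + v" "u \<in> keys f" "v \<in> keys g" using keys_mult[of f g] by auto
    then show "w \<le> ?u + ?v" by (simp add: add_mono)
  qed (use in_keys in auto)
qed

lemma lead_deg_mult:
  fixes f g :: "('n::{finite,linorder}) cpoly"
  shows "f \<noteq> 0 \<Longrightarrow> g \<noteq> 0 \<Longrightarrow> lead_deg (f * g) = lead_deg f + lead_deg g"
  by (simp add: lead_deg_def Max_keys_mult lookup_add sum.distrib)

lemma not_less_zero_exponent: "\<not> u < (0 :: 'n::linorder \<Rightarrow>\<^sub>0 nat)"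
  by (simp add: less_poly_mapping.rep_eq less_fun_def)

text \<open>The zero exponent is minimal, so the leading exponent \<open>0\<close> leaves only a
  constant term.\<close>

lemma lead_deg_0_imp_unit:
  fixes p :: "('n::{finite,linorder}) cpoly"
  assumes "p \<noteq> 0" "lead_deg p = 0"
  shows "p dvd 1"
proof -
  have ne: "keys p \<noteq> {}" using assms by (auto simp flip: keys_eq_empty)
  have "Max (keys p) = 0"
    using assms(2) by (intro poly_mapping_eqI) (simp add: lead_deg_def)
  then have "u \<le> 0" if "u \<in> keys p" for u using that by (metis Max_ge finite_keys)
  then have "keys p \<subseteq> {0}" using not_less_zero_exponent by (auto simp: order_le_less)
  with ne have k: "keys p = {0}" by (metis subset_singletonD)
  then have "p = Poly_Mapping.single 0 (lookup p 0)" using poly_mapping_eq_sum_single[of p] by simp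
  moreover have "lookup p 0 \<noteq> 0" using k by (simp flip: in_keys_iff)
  ultimately have "p * Poly_Mapping.single 0 (inverse (lookup p 0)) = 1"
    by (metis add_0 mult_single right_inverse single_one)
  then show ?thesis by (metis dvdI)
qed

text \<open>Supplies a witness for the choice in \<open>reduced_equation\<close>. Dropping one copy
  of a repeated factor preserves the zero set but lowers \<open>lead_deg\<close>.\<close>

lemma hypersurface_squarefree_equation:
  fixes V :: "(complex ^ 'n::{finite,linorder}) set"
  assumes "is_hypersurface V"
  shows "\<exists>h. h \<noteq> 0 \<and> \<not> h dvd 1 \<and> squarefree h \<and> zero_set h = V"
proof -
  define E where "E h \<longleftrightarrow> h \<noteq> 0 \<and> \<not> h dvd 1 \<and> zero_set h = V" for h
  obtain h where h: "E h" and least: "\<And>k. E k \<Longrightarrow> lead_deg h \<le> lead_deg k"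
    using assms ex_has_least_nat[of E _ lead_deg] unfolding is_hypersurface_def E_def by metis
  have "squarefree h"
    unfolding squarefree_def
  proof (intro allI impI, rule ccontr)
    fix x assume "x\<^sup>2 dvd h" and nu: "\<not> x dvd 1"
    then obtain q where q: "h = x\<^sup>2 * q" by (elim dvdE)
    have nz: "x \<noteq> 0" "q \<noteq> 0" using h unfolding q E_def by auto
    have "E (x * q)" using h nu nz dvd_mult_left[of x q 1]
      unfolding E_def q by (auto simp: zero_set_mult power2_eq_square)
    then have "lead_deg h \<le> lead_deg (x * q)" by (rule least)
    moreover have "lead_deg h = lead_deg x + lead_deg (x * q)"
      unfolding q power2_eq_square mult.assoc using nz by (simp add: lead_deg_mult)
    ultimately show False using lead_deg_0_imp_unit nz nu by auto
  qed
  with h show ?thesis unfolding E_def by blast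
qed

lemma reduced_equation_cases:
  fixes V :: "(complex ^ 'n::{finite,linorder}) set"
  shows "reduced_equation V \<noteq> 0 \<and> (reduced_equation V = 1 \<or> zero_set (reduced_equation V) = V)"
proof (cases "is_hypersurface V")
  case True
  from someI_ex[OF hypersurface_squarefree_equation[OF True]] True
  show ?thesis unfolding reduced_equation_def by auto
qed (simp add: reduced_equation_def)

subsection \<open>Covectors selecting a single monomial\<close>

definition expvec :: "('n::finite \<Rightarrow>\<^sub>0 nat) \<Rightarrow> real ^ 'n" where
  "expvec u = (\<chi> i. real (lookup u i))"

lemma expvec_add: "expvec (u + v) = expvec u + expvec v"
  by (simp add: expvec_def vec_eq_iff lookup_add)

text \<open>The initial form of \<open>h\<close> at \<open>g\<close> is a single monomial;
  equivalently, the face of the Newton polytope on which \<open>g\<close> is maximal is a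
  vertex.\<close>

definition unique_max :: "('n::finite) cpoly \<Rightarrow> real ^ 'n \<Rightarrow> bool" where
  "unique_max h g \<longleftrightarrow> (\<exists>u\<in>keys h. \<forall>u'\<in>keys h. u' \<noteq> u \<longrightarrow> g \<bullet> expvec u' < g \<bullet> expvec u)"

text \<open>Initial forms multiply: the sum of two strict maximizers is reached by no other pair, so
  its coefficient cannot cancel. This allows \<open>h_m^2 h_c\<close> to be treated factor by
  factor.\<close>

lemma unique_max_mult:
  assumes "unique_max f g" "unique_max h g"
  shows "unique_max (f * h) g"
proof -
  obtain u where u: "u \<in> keys f" "\<And>u'. u' \<in> keys f \<Longrightarrow> u' \<noteq> u \<Longrightarrow> g \<bullet> expvec u' < g \<bullet> expvec u"
    using assms(1) unfolding unique_max_def by blast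
  obtain v where v: "v \<in> keys h" "\<And>v'. v' \<in> keys h \<Longrightarrow> v' \<noteq> v \<Longrightarrow> g \<bullet> expvec v' < g \<bullet> expvec v"
    using assms(2) unfolding unique_max_def by blast
  have lt: "g \<bullet> expvec (u' + v') < g \<bullet> expvec (u + v)"
    if "u' \<in> keys f" "v' \<in> keys h" "u' \<noteq> u \<or> v' \<noteq> v" for u' v'
    using that u(2)[of u'] v(2)[of v'] unfolding expvec_add inner_add_right
    by (cases "u' = u"; cases "v' = v") auto
  have "lookup (f * h) (u + v) = lookup f u * lookup h v"
    using lt by (intro lookup_mult_unique u v) fastforce
  then have "u + v \<in> keys (f * h)" using u(1) v(1) by (simp add: in_keys_iff)
  moreover have "g \<bullet> expvec w < g \<bullet> expvec (u + v)" if "w \<in> keys (f * h)" "w \<noteq> u + v" for w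
    using that keys_mult[of f h] lt by blast
  ultimately show ?thesis unfolding unique_max_def by blast
qed

lemma unique_max_1: "unique_max 1 g"
  by (simp add: unique_max_def)

lemma monomial_value_rescale:
  assumes "t > 0"
  shows "monomial_value (rescale t g c) u = of_real (t powr (g \<bullet> expvec u)) * monomial_value c u"
proof -
  have "(\<Prod>i\<in>UNIV. (complex_of_real (t powr (g $ i))) ^ lookup u i) = of_real (\<Prod>i\<in>UNIV. t powr (g $ i * real (lookup u i)))"
    using assms by (simp add: powr_powr powr_realpow flip: powr_realpow of_real_power)
  also have "(\<Prod>i\<in>UNIV. t powr (g $ i * real (lookup u i))) = t powr (g \<bullet> expvec u)"
    using assms by (simp add: inner_vec_def expvec_def powr_sum)
  finally show ?thesis
    by (simp add: monomial_value_def power_mult_distrib prod.distrib)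
qed

text \<open>The weights are the powers of \<open>B\<close>, and exponents are read off as digits in base \<open>B\<close>.\<close>

lemma separating_weights:
  assumes "finite I"
  shows "\<exists>b :: 'n \<Rightarrow> nat. \<forall>u v. (\<forall>i. u i < B) \<longrightarrow> (\<forall>i. v i < B) \<longrightarrow>
      (\<Sum>i\<in>I. b i * u i) = (\<Sum>i\<in>I. b i * v i) \<longrightarrow> (\<forall>i\<in>I. u i = v i)"
  using assms
proof (induction I)
  case (insert j I)
  from insert.IH obtain b :: "'n \<Rightarrow> nat" where b: "\<forall>u v. (\<forall>i. u i < B) \<longrightarrow> (\<forall>i. v i < B) \<longrightarrow>
      (\<Sum>i\<in>I. b i * u i) = (\<Sum>i\<in>I. b i * v i) \<longrightarrow> (\<forall>i\<in>I. u i = v i)" ..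
  define b' where "b' = (\<lambda>i. if i = j then 1 else B * b i)"
  have eq: "(\<Sum>i\<in>insert j I. b' i * u i) = u j + B * (\<Sum>i\<in>I. b i * u i)" for u
    using insert.hyps by (auto simp: b'_def sum_distrib_left mult.assoc intro!: sum.cong)
  show ?case
  proof (intro exI[of _ b'] allI impI)
    fix u v :: "'n \<Rightarrow> nat"
    assume lt: "\<forall>i. u i < B" "\<forall>i. v i < B" and s: "(\<Sum>i\<in>insert j I. b' i * u i) = (\<Sum>i\<in>insert j I. b' i * v i)"
    have uv: "u j = v j" using arg_cong[OF s, of "\<lambda>x. x mod B"] lt by (simp add: eq)
    then have "(\<Sum>i\<in>I. b i * u i) = (\<Sum>i\<in>I. b i * v i)"
      using s lt(1)[rule_format, of j] by (simp add: eq)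
    with b lt have "\<forall>i\<in>I. u i = v i" by meson
    with uv show "\<forall>i\<in>insert j I. u i = v i" by simp
  qed
qed auto

section \<open>Zeros forced by an initial form with several monomials\<close>

lemma uniform_limit_scaled:
  fixes f :: "complex \<Rightarrow> complex"
  assumes "c \<longlonglongrightarrow> C" "bounded (f ` K)"
  shows "uniform_limit K (\<lambda>n z. c n * f z) (\<lambda>z. C * f z) sequentially"
proof (rule uniform_lim_mult)
  show "uniform_limit K (\<lambda>n z. c n) (\<lambda>z. C) sequentially"
    using assms(1) by (auto simp: uniform_limit_iff tendsto_iff elim: eventually_mono)
qed (use assms in \<open>auto intro: uniform_limit_const simp: image_constant_conv\<close>)

lemma uniform_limit_sum_of_limits:
  fixes f :: "'i \<Rightarrow> 'x \<Rightarrow> 'y \<Rightarrow> 'b::real_normed_vector"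
  assumes "\<And>i. i \<in> I \<Longrightarrow> uniform_limit K (f i) (l i) F"
  shows "uniform_limit K (\<lambda>n z. \<Sum>i\<in>I. f i n z) (\<lambda>z. \<Sum>i\<in>I. l i z) F"
  using assms
  by (induction I rule: infinite_finite_induct) (auto intro: uniform_limit_const uniform_limit_add)

text \<open>After division by the lowest power of \<open>z\<close>, a polynomial with nonzero
  constant term remains, and a second exponent makes its degree positive; so it has a root, and no
  root is \<open>0\<close>.\<close>

lemma sparse_sum_root:
  fixes c :: "'u \<Rightarrow> complex" and d :: "'u \<Rightarrow> nat"
  assumes "finite M" "inj_on d M" "\<And>u. u \<in> M \<Longrightarrow> c u \<noteq> 0" "u1 \<in> M" "u2 \<in> M" "u1 \<noteq> u2"
  obtains z where "z \<noteq> 0" "(\<Sum>u\<in>M. c u * z ^ d u) = 0" "finite {z. z \<noteq> 0 \<and> (\<Sum>u\<in>M. c u * z ^ d u) = 0}"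
proof -
  define k where "k = Min (d ` M)"
  define R where "R = (\<Sum>u\<in>M. monom (c u) (d u - k))"
  have k: "k \<le> d u" if "u \<in> M" for u using that assms(1) by (simp add: k_def)
  have "k \<in> d ` M" using assms unfolding k_def by (intro Min_in) auto
  then obtain u0 where u0: "u0 \<in> M" "d u0 = k" by auto
  have cf: "coeff R (d u - k) = c u" if "u \<in> M" for u
  proof -
    have "coeff R (d u - k) = (\<Sum>u'\<in>M. if u' = u then c u else 0)"
      unfolding R_def coeff_sum coeff_monom
    proof (intro sum.cong refl)
      fix u' assume "u' \<in> M"
      then show "(if d u' - k = d u - k then c u' else 0) = (if u' = u then c u else 0)"
        using k that inj_onD[OF assms(2), of u' u] by (auto simp: eq_diff_iff)
    qed
    then show ?thesis using that assms(1) by simp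
  qed
  have R0: "poly R 0 \<noteq> 0" using cf[OF u0(1)] assms(3)[OF u0(1)] by (simp add: u0 poly_0_coeff_0)
  obtain u3 where u3: "u3 \<in> M" "u3 \<noteq> u0" using assms(4-6) by metis
  have "d u3 - k > 0" using k[OF u3(1)] u0 u3 inj_onD[OF assms(2), of u3 u0] by force
  moreover have "d u3 - k \<le> degree R" using cf[OF u3(1)] assms(3)[OF u3(1)] by (intro le_degree) simp
  ultimately have "\<not> (\<exists>a l. a \<noteq> 0 \<and> l = 0 \<and> R = pCons a l)" by auto
  then obtain z where z: "poly R z = 0" using fundamental_theorem_of_algebra_alt by blast
  have eq: "(\<Sum>u\<in>M. c u * w ^ d u) = w ^ k * poly R w" for w
    unfolding R_def poly_sum poly_monom sum_distrib_left
    by (intro sum.cong refl) (use k in \<open>simp add: mult.left_commute flip: power_add\<close>)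
  have "finite {z. poly R z = 0}" using R0 by (intro poly_roots_finite) auto
  then show ?thesis
    using that[of z] z R0 by (auto simp: eq elim: finite_subset[rotated])
qed

text \<open>Along the curve \<open>c_i = z ^ b i\<close> the initial form becomes a univariate
  polynomial with one term for each maximizing exponent. With two or more terms it has a nonzero
  root \<open>z0\<close>, and Hurwitz's theorem gives zeros of the full polynomial near
  \<open>z0\<close> at large \<open>t\<close>, which \<open>avoid\<close> forbids.\<close>

lemma unique_max_if_asymptotically_nonzero:
  fixes h :: "('n::finite) cpoly"
  assumes "h \<noteq> 0"
    and avoid: "\<And>t c K1 K2. filterlim t at_top sequentially \<Longrightarrow> (\<And>n::nat. t n > 1) \<Longrightarrow> K1 > 0 \<Longrightarrow>
       (\<And>n i. K1 \<le> norm (c n $ i)) \<Longrightarrow> (\<And>n i. norm (c n $ i) \<le> K2) \<Longrightarrow>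
       \<exists>n. eval_cpoly h (rescale (t n) g (c n)) \<noteq> 0"
  shows "unique_max h g"
proof (rule ccontr)
  assume nu: "\<not> unique_max h g"
  have ne: "keys h \<noteq> {}" using \<open>h \<noteq> 0\<close> by simp
  define w where "w u = g \<bullet> expvec u" for u
  define m where "m = Max (w ` keys h)"
  have wm: "w u \<le> m" if "u \<in> keys h" for u using that by (simp add: m_def)
  define M where "M = {u \<in> keys h. w u = m}"
  have finM: "finite M" by (simp add: M_def)
  have "m \<in> w ` keys h" unfolding m_def using ne by (intro Max_in) auto
  then obtain u1 where u1: "u1 \<in> M" by (auto simp: M_def)
  obtain u2 where u2: "u2 \<in> M" "u2 \<noteq> u1"
    using nu u1 wm unfolding unique_max_def M_def w_def[symmetric] by (auto simp: not_less) (metis order_antisym)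
  \<comment> \<open>A bound above all entries of the exponents in \<open>keys h\<close>, so that
    these entries are digits in base \<open>B\<close>.\<close>
  define B where "B = Suc (\<Sum>u\<in>keys h. \<Sum>i\<in>UNIV. lookup u i)"
  have B: "lookup u i < B" if "u \<in> keys h" for u i
  proof -
    have "lookup u i \<le> (\<Sum>i\<in>UNIV. lookup u i)" by (rule member_le_sum) auto
    also have "\<dots> \<le> (\<Sum>u\<in>keys h. \<Sum>i\<in>UNIV. lookup u i)" using that by (intro member_le_sum) auto
    finally show ?thesis by (simp add: B_def)
  qed
  obtain b :: "'n \<Rightarrow> nat" where b: "\<forall>u v. (\<forall>i. u i < B) \<longrightarrow> (\<forall>i. v i < B) \<longrightarrow>
      (\<Sum>i\<in>UNIV. b i * u i) = (\<Sum>i\<in>UNIV. b i * v i) \<longrightarrow> (\<forall>i\<in>UNIV. u i = v i)"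
    using separating_weights[OF finite[of "UNIV :: 'n set"], of B] ..
  define d where "d u = (\<Sum>i\<in>UNIV. b i * lookup u i)" for u
  have inj: "inj_on d (keys h)"
  proof (rule inj_onI)
    fix u v assume uv: "u \<in> keys h" "v \<in> keys h" "d u = d v"
    have "\<forall>i. lookup u i < B" "\<forall>i. lookup v i < B" using B uv by auto
    from b[THEN spec, THEN spec, THEN mp, THEN mp, OF this] uv(3)
    have "\<forall>i\<in>UNIV. lookup u i = lookup v i" by (simp add: d_def)
    then show "u = v" by (auto intro: poly_mapping_eqI)
  qed
  have injM: "inj_on d M" by (rule inj_on_subset[OF inj]) (auto simp: M_def)
  have Mnz: "lookup h u \<noteq> 0" if "u \<in> M" for u using that by (simp add: M_def in_keys_iff)
  obtain z0 where z0: "z0 \<noteq> 0" "(\<Sum>u\<in>M. lookup h u * z0 ^ d u) = 0"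
    "finite {z. z \<noteq> 0 \<and> (\<Sum>u\<in>M. lookup h u * z ^ d u) = 0}"
    by (rule sparse_sum_root[OF finM injM Mnz u1 u2(1) u2(2)[symmetric]])
  \<comment> \<open>The radius keeps the disc away from \<open>0\<close>, so that the coefficients
    along the curve stay in a compact part of the torus.\<close>
  define S where "S = ball z0 (norm z0 / 2)"
  have S: "norm z0 / 2 \<le> norm z" "norm z \<le> 2 * norm z0" if "z \<in> S" for z
    using that norm_triangle_ineq2[of z0 z] norm_triangle_ineq2[of z z0] norm_minus_commute[of z z0]
    unfolding S_def mem_ball dist_norm by linarith+
  have S0: "z \<noteq> 0" if "z \<in> S" for z using S(1)[OF that] z0 by auto
  have z0S: "z0 \<in> S" using z0 by (simp add: S_def)
  define t where "t n = real n + 2" for n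
  have t: "filterlim t at_top sequentially" "t n > 1" for n unfolding t_def
    by (auto intro!: filterlim_tendsto_add_at_top filterlim_real_sequentially simp: add.commute[of _ 2])
  \<comment> \<open>\<open>F n\<close> is the polynomial on the curve divided by its leading power
    \<open>t n powr m\<close>; its limit \<open>G\<close> is the initial form.\<close>
  define F where "F n z = (\<Sum>u\<in>keys h. lookup h u * of_real (t n powr (w u - m)) * z ^ d u)" for n z
  define G where "G z = (\<Sum>u\<in>keys h. (if u \<in> M then lookup h u else 0) * z ^ d u)" for z
  have G: "G z = (\<Sum>u\<in>M. lookup h u * z ^ d u)" for z
    unfolding G_def by (intro sum.mono_neutral_cong_right) (auto simp: M_def)
  define zc where "zc z = (\<chi> i. z ^ b i)" for z :: complex
  have ev: "eval_cpoly h (rescale (t n) g (zc z)) = of_real (t n powr m) * F n z" for n z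
  proof -
    have "monomial_value (zc z) u = z ^ d u" for u
      by (simp add: monomial_value_def zc_def d_def power_sum power_mult)
    moreover have "complex_of_real (t n powr w u) = of_real (t n powr m) * of_real (t n powr (w u - m))" for u
      by (simp flip: of_real_mult powr_add)
    ultimately show ?thesis
      using t(2)[of n] by (simp add: eval_cpoly_eq monomial_value_rescale F_def sum_distrib_left mult_ac flip: w_def)
  qed
  have lim: "uniform_limit K F G sequentially" if "compact K" for K
    unfolding F_def G_def
  proof (intro uniform_limit_sum_of_limits uniform_limit_scaled)
    fix u assume u: "u \<in> keys h"
    have "(\<lambda>n. of_real (t n powr (w u - m))) \<longlonglongrightarrow> (if u \<in> M then 1 else (0::complex))"
    proof (cases "u \<in> M")
      case True
      then have "t n powr (w u - m) = 1" for n using t(2)[of n] by (simp add: M_def)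
      then show ?thesis using True by simp
    next
      case False
      then have "w u - m < 0" using wm[OF u] u by (auto simp: M_def order_le_less)
      then show ?thesis using False tendsto_of_real[OF tendsto_powr_at_top_neg[OF t(1)], where 'a = complex] by simp
    qed
    from tendsto_mult_left[OF this, of "lookup h u"]
    show "(\<lambda>n. lookup h u * of_real (t n powr (w u - m))) \<longlonglongrightarrow> (if u \<in> M then lookup h u else 0)"
      by (simp split: if_splits)
    show "bounded ((\<lambda>z. z ^ d u) ` K)"
      by (intro compact_imp_bounded compact_continuous_image continuous_intros that)
  qed
  have "\<exists>n z. n \<ge> N \<and> z \<in> S \<and> F n z = 0" for N
  proof (rule ccontr)
    assume no: "\<not> ?thesis"
    \<comment> \<open>The sequence is shifted by \<open>N\<close> so that every one of its members
      is free of zeros on \<open>S\<close>.\<close>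
    have "G z0 \<noteq> 0"
    proof (rule Hurwitz_no_zeros[of S "\<lambda>n. F (n + N)" G])
      show "F (n + N) holomorphic_on S" "G holomorphic_on S" for n
        unfolding F_def G_def by (intro holomorphic_intros)+
      show "uniform_limit K (\<lambda>n. F (n + N)) G sequentially" if "compact K" for K
        using filterlim_compose[OF lim[OF that] filterlim_add_const_nat_at_top[of N]] .
      show "\<not> G constant_on S"
      proof
        assume "G constant_on S"
        then have "G z = G z0" if "z \<in> S" for z using that z0S unfolding constant_on_def by metis
        then have "S \<subseteq> {z. z \<noteq> 0 \<and> (\<Sum>u\<in>M. lookup h u * z ^ d u) = 0}"
          using S0 z0 by (auto simp flip: G)
        then have "finite S" using z0(3) finite_subset by blast
        then show False using finite_imp_not_open[of S] z0S by (auto simp: S_def)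
      qed
    qed (use no z0S in \<open>auto simp: S_def\<close>)
    then show False using z0(2) by (simp add: G)
  qed
  \<comment> \<open>Since \<open>r N\<close> is at least \<open>N\<close>, the parameters
    \<open>t (r N)\<close> tend to infinity even if \<open>r\<close> is not increasing.\<close>
  then obtain r z where rz: "\<And>N. r N \<ge> N" "\<And>N. z N \<in> S" "\<And>N. F (r N) (z N) = 0" by metis
  have "\<exists>N. eval_cpoly h (rescale (t (r N)) g (zc (z N))) \<noteq> 0"
  proof (rule avoid)
    show "filterlim (\<lambda>N. t (r N)) at_top sequentially"
      by (intro filterlim_compose[OF t(1)] filterlim_at_top_mono[OF filterlim_ident]) (use rz in auto)
    show "t (r n) > 1" for n by (rule t)
    show "Min (range (\<lambda>i. (norm z0 / 2) ^ b i)) > 0" using z0(1) by (simp add: Min_gr_iff)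
    show "Min (range (\<lambda>i. (norm z0 / 2) ^ b i)) \<le> norm (zc (z n) $ i)" for n i
    proof -
      have "Min (range (\<lambda>i. (norm z0 / 2) ^ b i)) \<le> (norm z0 / 2) ^ b i" by simp
      also have "\<dots> \<le> norm (z n) ^ b i" using S(1)[OF rz(2)] by (intro power_mono) auto
      finally show ?thesis by (simp add: zc_def norm_power)
    qed
    show "norm (zc (z n) $ i) \<le> Max (range (\<lambda>i. (2 * norm z0) ^ b i))" for n i
    proof -
      have "norm (z n) ^ b i \<le> (2 * norm z0) ^ b i" using S(2)[OF rz(2)] by (intro power_mono) auto
      also have "\<dots> \<le> Max (range (\<lambda>i. (2 * norm z0) ^ b i))" by (rule Max_ge) auto
      finally show ?thesis by (simp add: zc_def norm_power)
    qed
  qed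
  then show False using rz(3) by (simp add: ev)
qed

lemma generic_imp_unique_max_morse_poly:
  fixes a :: "'n::{finite,linorder} \<Rightarrow> int"
  assumes "inj a" "\<And>i. a i \<noteq> 0" "affinely_generates_int a" "generic a g"
  shows "unique_max (morse_poly a) g"
proof -
  have "unique_max (reduced_equation (closure V)) g" if V: "V \<subseteq> {c. \<not> is_morse a c}" for V
  proof -
    let ?h = "reduced_equation (closure V)"
    consider "?h = 1" | "?h \<noteq> 0" "zero_set ?h = closure V" using reduced_equation_cases[of "closure V"] by blast
    then show ?thesis
    proof cases
      case 2
      show ?thesis
      proof (rule unique_max_if_asymptotically_nonzero[OF 2(1)])
        fix t K1 K2 and c :: "nat \<Rightarrow> (complex, 'n) vec"
        assume "filterlim t at_top sequentially" "\<And>n::nat. (t n::real) > 1" "(K1::real) > 0"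
          "\<And>n i. K1 \<le> norm (c n $ i)" "\<And>n i. norm (c n $ i) \<le> K2"
        from closure_strata_asymptotically[OF assms this V]
        obtain n where "rescale (t n) g (c n) \<notin> zero_set ?h" unfolding 2(2) ..
        then show "\<exists>n. eval_cpoly ?h (rescale (t n) g (c n)) \<noteq> 0" by (auto simp: zero_set_def)
      qed
    qed (simp add: unique_max_1)
  qed
  moreover have "maxwell_stratum a \<subseteq> {c. \<not> is_morse a c}" "caustic a \<subseteq> {c. \<not> is_morse a c}"
    by (auto simp: is_morse_def)
  ultimately show ?thesis unfolding morse_poly_def power2_eq_square by (intro unique_max_mult) auto
qed

lemma morse_poly_nonzero: "morse_poly (a :: 'n::{finite,linorder} \<Rightarrow> int) \<noteq> 0"
  using reduced_equation_cases[of "closure (maxwell_stratum a)"] reduced_equation_cases[of "closure (caustic a)"]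
  by (simp add: morse_poly_def)


subsection \<open>The combinatorics of tropical polynomials\<close>

text \<open>Turns equality of the lists \<open>Z\<close> and \<open>M^j\<close> into strict
  inequalities between keys. One implication is enough: with injective keys any two distinct entries
  are strictly ordered by \<open>f\<close>, so the order by \<open>g\<close> is determined.\<close>

lemma sort_key_eq_iff_order:
  fixes f g :: "'a \<Rightarrow> 'b::linorder"
  assumes "distinct xs" "inj_on f (set xs)" "inj_on g (set xs)"
  shows "sort_key f xs = sort_key g xs \<longleftrightarrow> (\<forall>x\<in>set xs. \<forall>y\<in>set xs. f x < f y \<longrightarrow> g x < g y)"
proof
  assume eq: "sort_key f xs = sort_key g xs"
  define ys where "ys = sort_key f xs"
  have ys: "set ys = set xs" "sorted (map f ys)" "sorted (map g ys)"
    by (simp add: ys_def, simp add: ys_def, simp add: ys_def eq)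
  show "\<forall>x\<in>set xs. \<forall>y\<in>set xs. f x < f y \<longrightarrow> g x < g y"
  proof (intro ballI impI)
    fix x y assume xy: "x \<in> set xs" "y \<in> set xs" "f x < f y"
    then obtain i j where ij: "i < length ys" "ys ! i = x" "j < length ys" "ys ! j = y"
      using ys(1) by (metis in_set_conv_nth)
    have "i < j"
    proof (rule ccontr)
      assume "\<not> i < j"
      then have "f y \<le> f x" using sorted_nth_mono[OF ys(2), of j i] ij by simp
      with xy show False by simp
    qed
    then have "g x \<le> g y" using sorted_nth_mono[OF ys(3), of i j] ij by simp
    moreover have "g x \<noteq> g y" using xy assms(3) by (auto dest: inj_onD)
    ultimately show "g x < g y" by simp
  qed
next
  assume ord: "\<forall>x\<in>set xs. \<forall>y\<in>set xs. f x < f y \<longrightarrow> g x < g y"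
  define ys where "ys = sort_key f xs"
  define zs where "zs = sort_key g xs"
  have ys: "set ys = set xs" "distinct ys" "sorted (map f ys)" using assms(1) by (auto simp: ys_def)
  have zs: "set zs = set xs" "distinct zs" "sorted (map g zs)" using assms(1) by (auto simp: zs_def)
  have "sorted (map g ys)"
    unfolding sorted_iff_nth_mono_less
  proof (intro allI impI)
    fix i j assume ij: "i < j" "j < length (map g ys)"
    then have "f (ys ! i) \<le> f (ys ! j)" using sorted_nth_mono[OF ys(3), of i j] by simp
    moreover have "ys ! i \<noteq> ys ! j" using ys(2) ij by (simp add: nth_eq_iff_index_eq)
    moreover have "ys ! i \<in> set xs" "ys ! j \<in> set xs" using ij ys(1) by (auto simp flip: ys(1))
    ultimately have "f (ys ! i) < f (ys ! j)" using assms(2) by (auto dest: inj_onD simp: order_le_less)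
    then show "map g ys ! i \<le> map g ys ! j"
      using ord \<open>ys ! i \<in> set xs\<close> \<open>ys ! j \<in> set xs\<close> ij by (simp add: less_imp_le)
  qed
  then have "map g ys = map g zs"
    using ys zs assms(3) by (intro sorted_distinct_set_unique) (auto simp: distinct_map)
  then show "sort_key f xs = sort_key g xs"
    using ys zs assms(3) by (auto simp: ys_def zs_def inj_on_map_eq_map)
qed

text \<open>Adjacent vertices of the subdivision, described by the lines maximal at a root instead
  of the polygon; this also makes sense for covectors with negative entries.\<close>

definition edges :: "('n::{finite,linorder} \<Rightarrow> int) \<Rightarrow> (real, 'n) vec \<Rightarrow> ('n \<times> 'n) set" where
  "edges a g = {(p, q). p < q \<and> (\<exists>s. maximizers a g s = {p, q})}"

text \<open>A consequence of (A1) alone, hence available before (A2) is translated; for nonnegative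
  covectors it suffices to identify \<open>edges\<close> with the upper edges of the
  polygon.\<close>

definition simple_hull :: "('n::{finite,linorder} \<Rightarrow> int) \<Rightarrow> (real, 'n) vec \<Rightarrow> bool" where
  "simple_hull a g \<longleftrightarrow> (\<forall>s p q. p \<noteq> q \<longrightarrow> p \<in> maximizers a g s \<longrightarrow> q \<in> maximizers a g s \<longrightarrow> maximizers a g s = {p, q})"

lemma generic_imp_simple_hull: "generic a g \<Longrightarrow> simple_hull a g"
  using maximizers_eq_pair unfolding simple_hull_def by blast

locale increasing_exponents =
  fixes a :: "'n::{finite,linorder} \<Rightarrow> int"
  assumes mono: "strict_mono a"
begin

lemma a_less_iff [simp]: "a p < a q \<longleftrightarrow> p < q" and a_le_iff [simp]: "a p \<le> a q \<longleftrightarrow> p \<le> q"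
  and a_eq_iff [simp]: "a p = a q \<longleftrightarrow> p = q"
  using mono by (auto simp: strict_mono_less strict_mono_less_eq strict_mono_eq)

lemma slope_unique:
  assumes "p < q"
  shows "line_value a g s p = line_value a g s q \<longleftrightarrow> s = slope a g p q"
proof -
  have "real_of_int (a q - a p) \<noteq> 0" using assms by simp
  then have "s = slope a g p q \<longleftrightarrow> s * real_of_int (a q - a p) = g $ p - g $ q"
    unfolding slope_def by (simp add: eq_divide_eq)
  then show ?thesis by (auto simp: line_value_def algebra_simps)
qed

lemma slope_le:
  assumes "p < q"
  shows "line_value a g s q \<le> line_value a g s p \<longleftrightarrow> s \<le> slope a g p q"
proof -
  have "real_of_int (a q - a p) > 0" using assms by simp
  then have "s \<le> slope a g p q \<longleftrightarrow> s * real_of_int (a q - a p) \<le> g $ p - g $ q"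
    unfolding slope_def by (simp add: pos_le_divide_eq)
  then show ?thesis by (auto simp: line_value_def algebra_simps)
qed

lemma line_value_slope_eq: "p < q \<Longrightarrow> line_value a g (slope a g p q) q = line_value a g (slope a g p q) p"
  using slope_unique[of p q g "slope a g p q"] by simp

lemma line_value_slope_value:
  assumes "p < q"
  shows "line_value a g (slope a g p q) p
       = (real_of_int (a q) * g $ p - real_of_int (a p) * g $ q) / real_of_int (a q - a p)"
proof -
  have "real_of_int (a q) - real_of_int (a p) \<noteq> 0" using assms by simp
  then show ?thesis by (simp add: line_value_def slope_def field_simps)
qed

lemma maximizers_mono:
  assumes "s < s'" "i \<in> maximizers a g s" "k \<in> maximizers a g s'"
  shows "i \<le> k"
proof (rule ccontr)
  assume "\<not> i \<le> k"
  then have "real_of_int (a k) < real_of_int (a i)" by simp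
  then have "(real_of_int (a i) - real_of_int (a k)) * (s' - s) > 0" using assms(1) by simp
  moreover have "line_value a g s k \<le> line_value a g s i" "line_value a g s' i \<le> line_value a g s' k" using assms by (auto simp: maximizers_def)
  ultimately show False by (simp add: line_value_def algebra_simps)
qed

lemma no_maximizers_between:
  assumes "maximizers a g s = {p, q}" "x \<in> maximizers a g s'"
  shows "x \<le> p \<or> x \<ge> q"
  using maximizers_mono[of s s' q g x] maximizers_mono[of s' s x g p] assms by (cases s s' rule: linorder_cases) auto

text \<open>
  The crossing point of the upper envelopes of the lines with index at most \<open>p\<close> and of those
  with index above \<open>p\<close>.
\<close>

lemma hull_covers:
  assumes "p < Max UNIV"
  obtains s i k where "i \<le> p" "p < k" "i \<in> maximizers a g s" "k \<in> maximizers a g s"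
proof -
  \<comment> \<open>\<open>f i\<close> is where line \<open>i\<close> is first overtaken by a line
    with index above \<open>p\<close>; the maximum over \<open>i\<close> is where the last of the
    lower lines is overtaken.\<close>
  define f where "f i = Min ((\<lambda>k. slope a g i k) ` {p<..})" for i
  have ne: "{p<..} \<noteq> {}" using assms by blast
  define s where "s = Max (f ` {..p})"
  have "s \<in> f ` {..p}" unfolding s_def by (intro Max_in) auto
  then obtain i where i: "i \<le> p" "s = f i" by auto
  have "f i \<in> (\<lambda>k. slope a g i k) ` {p<..}" unfolding f_def using ne by (intro Min_in) auto
  then obtain k where k: "k > p" "s = slope a g i k" using i by auto
  have ik: "line_value a g s i = line_value a g s k" using i k slope_unique[of i k g s] by auto
  have gt: "line_value a g s x \<le> line_value a g s i" if "x > p" for x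
  proof -
    have "s \<le> slope a g i x" unfolding i(2) f_def using that by simp
    then show ?thesis using slope_le[of i x g s] i that by auto
  qed
  have le: "line_value a g s x \<le> line_value a g s i" if "x \<le> p" for x
  proof -
    have "f x \<in> (\<lambda>k. slope a g x k) ` {p<..}" unfolding f_def using ne by (intro Min_in) auto
    then obtain y where y: "y > p" "f x = slope a g x y" by auto
    have "f x \<le> s" unfolding s_def using that by simp
    then have "line_value a g s x \<le> line_value a g s y"
      using y slope_le[of x y g s] slope_unique[of x y g s] that by force
    also have "\<dots> \<le> line_value a g s i" by (rule gt[OF y(1)])
    finally show ?thesis .
  qed
  have "line_value a g s x \<le> line_value a g s i" for x using gt[of x] le[of x] by (cases "x \<le> p") auto
  then have "i \<in> maximizers a g s" by (simp add: maximizers_def)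
  moreover from this have "k \<in> maximizers a g s" using ik by (simp add: maximizers_def)
  ultimately show ?thesis using that i k by blast
qed

lemma edges_iff:
  "(p, q) \<in> edges a g \<longleftrightarrow> p < q \<and> maximizers a g (slope a g p q) = {p, q}"
proof -
  have "s = slope a g p q" if "p < q" "maximizers a g s = {p, q}" for s
    using slope_unique[OF that(1), of g s] maximizers_line_value_eq[of p a g s q] that(2) by simp
  then show ?thesis by (auto simp: edges_def)
qed

lemma edges_cover:
  assumes "simple_hull a g" "p < Max UNIV"
  obtains w w' where "(w, w') \<in> edges a g" "w \<le> p" "p < w'"
proof -
  obtain s i k where "i \<le> p" "p < k" "i \<in> maximizers a g s" "k \<in> maximizers a g s"
    using hull_covers[OF assms(2)] by blast
  moreover from this have "maximizers a g s = {i, k}" "i < k" using assms(1) unfolding simple_hull_def by auto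
  ultimately show ?thesis using that unfolding edges_def by blast
qed

lemma edgesI:
  assumes "simple_hull a g" "p < q" "p \<in> maximizers a g s" "q \<in> maximizers a g s"
  shows "(p, q) \<in> edges a g" "s = slope a g p q"
proof -
  have "p \<noteq> q" using assms(2) by simp
  then have "maximizers a g s = {p, q}" using assms(1,3,4) unfolding simple_hull_def by meson
  then show "(p, q) \<in> edges a g" using assms(2) unfolding edges_def by blast
  show "s = slope a g p q" using slope_unique[OF assms(2)] maximizers_line_value_eq[OF assms(3,4)] by blast
qed

lemma trop_poly_eq: "p \<in> maximizers a g s \<Longrightarrow> trop_poly a g s = line_value a g s p"
  unfolding trop_poly_def maximizers_def line_value_def by (intro Max_eqI) auto

text \<open>Extreme points of the supporting face are generators of \<open>N_gamma\<close>. The two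
  extra generators at height \<open>0\<close> lie weakly below lifted points because
  \<open>g\<close> is nonnegative, so on an upper face they coincide with lifted points.\<close>

lemma upper_face:
  assumes nonneg: "\<And>i. 0 \<le> g $ i"
    and bnd: "\<forall>(x, y)\<in>N_gamma a g. s * x + y \<le> b"
    and E: "E = {(x, y)\<in>N_gamma a g. s * x + y = b}" and ne: "E \<noteq> {}"
  shows "E face_of N_gamma a g" "E = convex hull ((\<lambda>i. (real_of_int (a i), g $ i)) ` maximizers a g s)"
proof -
  let ?P = "\<lambda>i. (real_of_int (a i), g $ i)"
  define S where "S = range ?P \<union> {(real_of_int (a (Min UNIV)), 0), (real_of_int (a (Max UNIV)), 0)}"
  have N: "N_gamma a g = convex hull S" by (simp add: N_gamma_def S_def)
  have finS: "finite S" by (simp add: S_def)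
  have E': "E = N_gamma a g \<inter> {x. (s, 1) \<bullet> x = b}" by (auto simp: E inner_prod_def)
  show face: "E face_of N_gamma a g"
    unfolding E' using bnd by (intro face_of_Int_supporting_hyperplane_le) (auto simp: N inner_prod_def)
  have cE: "compact E" "convex E"
    unfolding E' N
    by (intro compact_Int_closed finite_imp_compact_convex_hull finS closed_hyperplane)
       (intro convex_Int convex_convex_hull convex_hyperplane)
  have lvb: "line_value a g s i \<le> b" for i
  proof -
    have "?P i \<in> N_gamma a g" unfolding N by (rule hull_inc) (simp add: S_def)
    then show ?thesis using bnd by (auto simp: line_value_def algebra_simps)
  qed
  have ext: "v \<in> ?P ` {i. line_value a g s i = b}" if "v extreme_point_of E" for v
  proof -
    have v: "v \<in> S" "s * fst v + snd v = b"
      using that extreme_point_of_face[OF face, of v] extreme_point_of_convex_hull[of v S]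
      by (auto simp: N E extreme_point_of_def)
    then obtain i where i: "v = ?P i \<or> v = (real_of_int (a i), 0)" by (auto simp: S_def)
    then have "line_value a g s i = b" "v = ?P i"
      using v(2) lvb[of i] nonneg[of i] by (auto simp: line_value_def algebra_simps)
    then show ?thesis by blast
  qed
  have Eext: "E = convex hull {v. v extreme_point_of E}" by (rule Krein_Milman_Minkowski[OF cE])
  with ne have "{v. v extreme_point_of E} \<noteq> {}" by (metis convex_hull_empty)
  then obtain i0 where "line_value a g s i0 = b" using ext by blast
  with lvb have mx: "maximizers a g s = {i. line_value a g s i = b}"
    by (auto simp: maximizers_def intro: order_antisym) 
  show "E = convex hull (?P ` maximizers a g s)"
  proof
    show "E \<subseteq> convex hull (?P ` maximizers a g s)"
      using ext unfolding mx by (subst Eext, intro hull_mono) auto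
    show "convex hull (?P ` maximizers a g s) \<subseteq> E"
    proof (rule hull_minimal)
      have "?P i \<in> N_gamma a g" for i unfolding N by (rule hull_inc) (simp add: S_def)
      then show "?P ` maximizers a g s \<subseteq> E" by (auto simp: E mx line_value_def algebra_simps)
    qed (rule cE(2))
  qed
qed

text \<open>An upper face is spanned by the points lifted from the maximizers at its parameter
  \<open>s\<close>; under \<open>simple_hull\<close> it is one-dimensional exactly when there are
  two of them.\<close>

lemma W_set_eq:
  assumes nonneg: "\<And>i. 0 \<le> g $ i" and simple: "simple_hull a g"
  shows "W_set a g = fst ` edges a g \<union> snd ` edges a g"
proof (intro equalityI subsetI)
  let ?P = "\<lambda>i. (real_of_int (a i), g $ i)"
  fix i assume "i \<in> W_set a g"
  then obtain E v s b where E: "E edge_of N_gamma a g" "v extreme_point_of E" "fst v = real_of_int (a i)"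
    "\<forall>(x, y)\<in>N_gamma a g. s * x + y \<le> b" "E = {(x, y)\<in>N_gamma a g. s * x + y = b}"
    by (auto simp: W_set_def upper_edge_def)
  have "E \<noteq> {}" using E(2) by (auto simp: extreme_point_of_def)
  note Eeq = upper_face(2)[OF nonneg E(4,5) this]
  have "v \<in> ?P ` maximizers a g s"
    using E(2) unfolding Eeq by (rule extreme_point_of_convex_hull)
  then have i: "i \<in> maximizers a g s" using E(3) by auto
  have "\<exists>k\<in>maximizers a g s. k \<noteq> i"
  proof (rule ccontr)
    assume "\<not> ?thesis"
    with i have "maximizers a g s = {i}" by blast
    then have "aff_dim E = 0" unfolding Eeq by simp
    then show False using E(1) by (simp add: edge_of_def)
  qed
  then obtain k where k: "k \<in> maximizers a g s" "k \<noteq> i" by blast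
  then consider "(i, k) \<in> edges a g" | "(k, i) \<in> edges a g"
    using edgesI(1)[OF simple] i by (metis linorder_neqE)
  then show "i \<in> fst ` edges a g \<union> snd ` edges a g" by cases force+
next
  let ?P = "\<lambda>i. (real_of_int (a i), g $ i)"
  fix i assume "i \<in> fst ` edges a g \<union> snd ` edges a g"
  then obtain p q s where pq: "p < q" "maximizers a g s = {p, q}" "i \<in> {p, q}" by (auto simp: edges_def)
  define b where "b = line_value a g s p"
  have le: "line_value a g s k \<le> b" for k using pq(2) unfolding b_def maximizers_def by blast
  have N: "N_gamma a g \<subseteq> {x. (s, 1) \<bullet> x \<le> b}"
    unfolding N_gamma_def
  proof (rule hull_minimal)
    have "(s, 1) \<bullet> (real_of_int (a k), 0) \<le> b" for k
      using le[of k] nonneg[of k] by (simp add: line_value_def algebra_simps inner_prod_def)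
    moreover have "(s, 1) \<bullet> ?P k \<le> b" for k
      using le[of k] by (simp add: line_value_def algebra_simps inner_prod_def)
    ultimately show "range ?P \<union> {(real_of_int (a (Min UNIV)), 0), (real_of_int (a (Max UNIV)), 0)} \<subseteq> {x. (s, 1) \<bullet> x \<le> b}"
      by blast
  qed (rule convex_halfspace_le)
  then have bnd: "\<forall>(x, y)\<in>N_gamma a g. s * x + y \<le> b" by (auto simp: inner_prod_def)
  define E where "E = {(x, y)\<in>N_gamma a g. s * x + y = b}"
  have "?P p \<in> N_gamma a g" unfolding N_gamma_def by (rule hull_inc) simp
  then have "?P p \<in> E" by (simp add: E_def b_def line_value_def algebra_simps)
  then have "E \<noteq> {}" by blast
  note F = upper_face[OF nonneg bnd E_def this]
  have Eseg: "E = closed_segment (?P p) (?P q)" unfolding F(2) pq(2) by (simp add: segment_convex_hull)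
  have "aff_dim E = 1" unfolding F(2) pq(2) using pq(1) by (simp add: aff_dim_convex_hull aff_dim_2)
  then have "upper_edge (N_gamma a g) E"
    unfolding upper_edge_def edge_of_def using F(1) bnd E_def by blast
  moreover have "?P i extreme_point_of E" unfolding Eseg using pq(3) by (auto simp: extreme_point_of_segment)
  ultimately show "i \<in> W_set a g" unfolding W_set_def by force
qed

end


section \<open>Enumeration of the edges by consecutive vertices\<close>

context increasing_exponents
begin

lemma w_vertex_less:
  assumes "i < j" "j < card (W_set a g)"
  shows "w_vertex a g i < w_vertex a g j"
  using assms sorted_wrt_nth_less[OF strict_sorted_list_of_set[of "W_set a g"], of i j]
  by (simp add: w_vertex_def)

lemma w_vertex_image: "w_vertex a g ` {..<card (W_set a g)} = W_set a g"
proof -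
  have "set (sorted_list_of_set (W_set a g)) = W_set a g" by simp
  then show ?thesis
    unfolding w_vertex_def set_conv_nth by (auto simp: image_def)
qed

text \<open>Every vertex is a maximizer somewhere, and maximizers move monotonically with
  \<open>s\<close>, so no vertex lies strictly between the ends of an edge. Conversely, the edge
  covering the gap after a vertex must start there and end at the next one.\<close>

lemma edges_enumeration:
  assumes nonneg: "\<And>i. 0 \<le> g $ i" and simple: "simple_hull a g"
  shows "edges a g = (\<lambda>j. (w_vertex a g j, w_vertex a g (Suc j))) ` {..<num_roots a g}"
proof -
  note W = W_set_eq[OF nonneg simple]
  have nb: "x \<le> p \<or> x \<ge> q" if x: "x \<in> W_set a g" and pq: "(p, q) \<in> edges a g" for x p q
  proof -
    obtain e where e: "e \<in> edges a g" "x = fst e \<or> x = snd e" using x unfolding W by (elim UnE imageE) auto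
    then obtain s where "maximizers a g s = {fst e, snd e}" by (auto simp: edges_def)
    with e have s: "x \<in> maximizers a g s" by auto
    obtain s' where "maximizers a g s' = {p, q}" using pq by (auto simp: edges_def)
    from no_maximizers_between[OF this s] show ?thesis .
  qed
  show ?thesis
  proof (intro equalityI subsetI)
    fix e assume "e \<in> edges a g"
    then obtain p q where e: "e = (p, q)" "(p, q) \<in> edges a g" by (cases e) auto
    have pq: "p \<in> W_set a g" "q \<in> W_set a g" "p < q"
      using e(2) image_eqI[of p fst "(p, q)" "edges a g"] image_eqI[of q snd "(p, q)" "edges a g"]
      unfolding W by (simp_all add: edges_def)
    then have "p \<in> w_vertex a g ` {..<card (W_set a g)}" "q \<in> w_vertex a g ` {..<card (W_set a g)}"
      by (simp_all only: w_vertex_image)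
    then obtain i j where ij: "p = w_vertex a g i" "q = w_vertex a g j" "i < card (W_set a g)" "j < card (W_set a g)"
      by (elim imageE) simp
    have "i < j" using pq(3) ij w_vertex_less[of j i g] by (metis less_asym' linorder_neqE_nat)
    have "Suc i = j"
    proof (rule ccontr)
      assume "Suc i \<noteq> j"
      with \<open>i < j\<close> have "p < w_vertex a g (Suc i)" "w_vertex a g (Suc i) < q"
        using w_vertex_less[of i "Suc i" g] w_vertex_less[of "Suc i" j g] ij by auto
      moreover have "w_vertex a g (Suc i) \<in> W_set a g"
        using w_vertex_image[of g] \<open>i < j\<close> ij(4) by (metis Suc_lessI imageI lessThan_iff less_trans)
      ultimately show False using nb[OF _ e(2)] by fastforce
    qed
    then show "e \<in> (\<lambda>j. (w_vertex a g j, w_vertex a g (Suc j))) ` {..<num_roots a g}"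
      using ij e(1) by (auto simp: num_roots_def)
  next
    fix e assume "e \<in> (\<lambda>j. (w_vertex a g j, w_vertex a g (Suc j))) ` {..<num_roots a g}"
    then obtain j where j: "e = (w_vertex a g j, w_vertex a g (Suc j))" "Suc j < card (W_set a g)"
      by (auto simp: num_roots_def)
    let ?p = "w_vertex a g j" and ?q = "w_vertex a g (Suc j)"
    have pq: "?p \<in> W_set a g" "?q \<in> W_set a g" "?p < ?q"
      using w_vertex_image[of g] j(2) w_vertex_less[of j "Suc j" g] by (auto intro: imageI)
    then have "?p < Max UNIV" using Max_ge[of UNIV ?q] by (simp add: less_le_trans)
    then obtain w w' where w: "(w, w') \<in> edges a g" "w \<le> ?p" "?p < w'" using edges_cover[OF simple] by blast
    have 1: "w = ?p" using nb[OF pq(1) w(1)] w by auto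
    have "w' \<in> W_set a g" unfolding W using w(1) by force
    then have "w' \<in> w_vertex a g ` {..<card (W_set a g)}" by (simp only: w_vertex_image)
    then obtain m where m: "w' = w_vertex a g m" "m < card (W_set a g)" by (elim imageE) simp
    have "j < m" using w(3) m j(2) w_vertex_less[of m j g]
      by (metis Suc_lessD less_asym' linorder_neqE_nat)
    then have "?q \<le> w'" using w_vertex_less[of "Suc j" m g] m by (cases "Suc j = m") auto
    moreover have "w' \<le> ?q" using nb[OF pq(2) w(1)] pq(3) 1 by auto
    ultimately show "e \<in> edges a g" using w(1) 1 j(1) by simp
  qed
qed

section \<open>Linear inequalities encoding the combinatorial data\<close>

lemma trop_root_eq: "trop_root a g j = slope a g (w_vertex a g j) (w_vertex a g (Suc j))"
  by (simp add: trop_root_def)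

text \<open>The height of line \<open>i\<close> where lines \<open>p\<close> and \<open>q\<close>
  cross. With \<open>p\<close> and \<open>q\<close> fixed it is linear in \<open>g\<close>, and both
  \<open>Z\<close> (with \<open>i = p\<close>) and \<open>M^j\<close> compare such heights.\<close>

definition root_level :: "(real, 'n) vec \<Rightarrow> 'n \<Rightarrow> 'n \<Rightarrow> 'n \<Rightarrow> real" where
  "root_level g p q i = line_value a g (slope a g p q) i"

lemma root_level_add: "root_level (g + h) p q i = root_level g p q i + root_level h p q i"
  by (simp add: root_level_def line_value_def slope_def add_divide_distrib diff_divide_distrib algebra_simps)

lemma root_level_scaleR: "root_level (r *\<^sub>R g) p q i = r * root_level g p q i"
  by (simp add: root_level_def line_value_def slope_def algebra_simps diff_divide_distrib)

lemma root_level_pair: "p < q \<Longrightarrow> root_level g p q q = root_level g p q p"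
  unfolding root_level_def by (rule line_value_slope_eq)

lemma root_level_edge_less:
  assumes "(p, q) \<in> edges a g" "i \<notin> {p, q}"
  shows "root_level g p q i < root_level g p q p"
proof -
  have m: "maximizers a g (slope a g p q) = {p, q}" using assms(1) by (simp add: edges_iff)
  then have "line_value a g (slope a g p q) i \<le> line_value a g (slope a g p q) p" "p \<in> maximizers a g (slope a g p q)"
    by (auto simp: maximizers_def)
  moreover have "line_value a g (slope a g p q) i \<noteq> line_value a g (slope a g p q) p"
    using assms(2) m \<open>p \<in> maximizers a g (slope a g p q)\<close> unfolding m[symmetric] by (auto simp: maximizers_def)
  ultimately show ?thesis by (simp add: root_level_def)
qed

text \<open>
  The data of \<open>g\<close> expressed by strict linear inequalities: unlike equality of \<open>comb_data\<close>, this is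
  manifestly convex.
\<close>

definition region :: "(real, 'n) vec \<Rightarrow> (real, 'n) vec set" where
  "region g = {h. \<forall>(p, q)\<in>edges a g.
     (\<forall>i k. root_level g p q i < root_level g p q k \<longrightarrow> root_level h p q i < root_level h p q k) \<and>
     (\<forall>(p', q')\<in>edges a g. root_level g p q p < root_level g p' q' p' \<longrightarrow> root_level h p q p < root_level h p' q' p')}"

lemma regionI:
  assumes "\<And>p q i k. (p, q) \<in> edges a g \<Longrightarrow> root_level g p q i < root_level g p q k \<Longrightarrow> root_level h p q i < root_level h p q k"
    and "\<And>p q p' q'. (p, q) \<in> edges a g \<Longrightarrow> (p', q') \<in> edges a g \<Longrightarrow> root_level g p q p < root_level g p' q' p' \<Longrightarrow> root_level h p q p < root_level h p' q' p'"
  shows "h \<in> region g"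
  using assms unfolding region_def by blast

lemma regionD:
  assumes "h \<in> region g" "(p, q) \<in> edges a g"
  shows "root_level g p q i < root_level g p q k \<Longrightarrow> root_level h p q i < root_level h p q k"
    and "(p', q') \<in> edges a g \<Longrightarrow> root_level g p q p < root_level g p' q' p' \<Longrightarrow> root_level h p q p < root_level h p' q' p'"
  using assms unfolding region_def by blast+

lemma self_in_region: "g \<in> region g"
  by (rule regionI)

lemma region_add:
  assumes "h \<in> region g" "h' \<in> region g"
  shows "h + h' \<in> region g"
  by (rule regionI) (unfold root_level_add, intro add_strict_mono regionD[OF assms(1)] regionD[OF assms(2)]; assumption)+

lemma region_scaleR:
  assumes "h \<in> region g" "r > 0"
  shows "r *\<^sub>R h \<in> region g"
  by (rule regionI) (unfold root_level_scaleR, intro mult_strict_left_mono regionD[OF assms(1)] assms(2); assumption)+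

lemma convex_region: "convex (region g)"
proof (rule convexI)
  fix u v :: real and h h' :: "(real, 'n) vec" assume "h \<in> region g" "h' \<in> region g" "0 \<le> u" "0 \<le> v" "u + v = (1::real)"
  then show "u *\<^sub>R h + v *\<^sub>R h' \<in> region g"
    by (cases "u = 0"; cases "v = 0") (auto intro!: region_add region_scaleR)
qed

lemma root_level_const: "p < q \<Longrightarrow> root_level (\<chi> i. e) p q i = e"
  by (simp add: root_level_def line_value_def slope_def)

lemma region_shift:
  assumes "h \<in> region g"
  shows "h + (\<chi> i. e) \<in> region g"
proof (rule regionI)
  fix p q i k assume "(p, q) \<in> edges a g" "root_level g p q i < root_level g p q k"
  then show "root_level (h + (\<chi> i. e)) p q i < root_level (h + (\<chi> i. e)) p q k"
    using regionD(1)[OF assms] by (auto simp: root_level_add root_level_const edges_def)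
next
  fix p q p' q' assume "(p, q) \<in> edges a g" "(p', q') \<in> edges a g" "root_level g p q p < root_level g p' q' p'"
  then show "root_level (h + (\<chi> i. e)) p q p < root_level (h + (\<chi> i. e)) p' q' p'"
    using regionD(2)[OF assms, of p q p' q'] by (auto simp: root_level_add root_level_const edges_def)
qed

lemma edges_slope_inj:
  assumes "(p, q) \<in> edges a g" "(p', q') \<in> edges a g" "slope a g p q = slope a g p' q'"
  shows "p = p' \<and> q = q'"
  using assms by (auto simp: edges_iff doubleton_eq_iff)

lemma generic_values:
  assumes "generic a g" "(p, q) \<in> edges a g" "(p', q') \<in> edges a g" "(p, q) \<noteq> (p', q')"
  shows "root_level g p q p \<noteq> root_level g p' q' p'"
proof -
  have "slope a g p q \<noteq> slope a g p' q'" using edges_slope_inj[OF assms(2,3)] assms(4) by auto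
  moreover have "p \<noteq> q" "p' \<noteq> q'" "p \<in> maximizers a g (slope a g p q)" "q \<in> maximizers a g (slope a g p q)"
    "p' \<in> maximizers a g (slope a g p' q')" "q' \<in> maximizers a g (slope a g p' q')"
    using assms(2,3) by (auto simp: edges_iff)
  ultimately show ?thesis using assms(1) unfolding generic_def root_level_def by blast
qed

lemma generic_levels:
  assumes "generic a g" "(p, q) \<in> edges a g" "i \<noteq> k" "{i, k} \<noteq> {p, q}"
  shows "root_level g p q i \<noteq> root_level g p q k"
proof -
  have "p \<noteq> q" "p \<in> maximizers a g (slope a g p q)" "q \<in> maximizers a g (slope a g p q)"
    using assms(2) by (auto simp: edges_iff)
  then show ?thesis using assms unfolding generic_def root_level_def by blast
qed

text \<open>Strict inequalities keep each edge of \<open>g\<close> an edge of \<open>h\<close>.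
  These edges already cover the whole index range, and maximizers are monotone in the parameter, so
  there is no room for another root of \<open>h\<close>.\<close>

lemma region_maximizers:
  assumes generic: "generic a g" and h: "h \<in> region g"
  shows "edges a g \<subseteq> edges a h"
    and "p < q \<Longrightarrow> p \<in> maximizers a h s \<Longrightarrow> q \<in> maximizers a h s \<Longrightarrow> (p, q) \<in> edges a g \<and> s = slope a h p q"
proof -
  show sub: "edges a g \<subseteq> edges a h"
  proof
    fix e assume "e \<in> edges a g"
    then obtain p q where e: "e = (p, q)" "(p, q) \<in> edges a g" by (cases e) auto
    have pq: "p < q" using e(2) by (simp add: edges_def)
    have less: "root_level h p q i < root_level h p q p" if "i \<notin> {p, q}" for i
      using root_level_edge_less[OF e(2) that] h e(2) unfolding region_def by blast
    have "root_level h p q i \<le> root_level h p q p" for i using less[of i] root_level_pair[OF pq, of h] by (cases "i \<in> {p, q}") auto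
    then have "maximizers a h (slope a h p q) = {p, q}"
      using less root_level_pair[OF pq, of h] unfolding maximizers_def root_level_def[symmetric]
      by (auto simp: not_less[symmetric])
    with pq show "e \<in> edges a h" by (simp add: e(1) edges_iff)
  qed
  assume pq: "p < q" "p \<in> maximizers a h s" "q \<in> maximizers a h s"
  then have "p < Max UNIV" using Max_ge[of UNIV q] by (simp add: less_le_trans)
  then obtain w w' where w: "(w, w') \<in> edges a g" "w \<le> p" "p < w'"
    using edges_cover[OF generic_imp_simple_hull[OF generic]] by blast
  define s0 where "s0 = slope a h w w'"
  have "(w, w') \<in> edges a h" using w(1) sub by blast
  then have m: "maximizers a h s0 = {w, w'}" "w < w'" unfolding s0_def edges_iff by auto
  have "\<not> s < s0" using maximizers_mono[of s s0 q h w] m pq w by auto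
  moreover have "\<not> s0 < s" using maximizers_mono[of s0 s w' h p] m pq w by auto
  ultimately have "s = s0" by simp
  moreover from this have "p = w" "q = w'" using pq m by auto
  ultimately show "(p, q) \<in> edges a g \<and> s = slope a h p q" using w(1) by (simp add: s0_def)
qed

lemma region_maximizers_pair:
  assumes generic: "generic a g" and h: "h \<in> region g" and pq: "p \<noteq> q" "p \<in> maximizers a h s" "q \<in> maximizers a h s"
  obtains x y where "(x, y) \<in> edges a g" "{p, q} = {x, y}" "s = slope a h x y"
  using region_maximizers(2)[OF generic h, of p q s] region_maximizers(2)[OF generic h, of q p s] pq
  by (metis insert_commute linorder_neqE)

text \<open>Each equality that \<open>generic\<close> excludes at \<open>g\<close> is a strict
  inequality there, one way or the other, and \<open>region\<close> preserves it.\<close>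

lemma region_generic:
  assumes generic: "generic a g" and h: "h \<in> region g"
  shows "edges a h = edges a g" "generic a h"
proof -
  show "edges a h = edges a g"
  proof
    show "edges a h \<subseteq> edges a g"
    proof
      fix e assume "e \<in> edges a h"
      then obtain p q s where e: "e = (p, q)" "p < q" "maximizers a h s = {p, q}" by (auto simp: edges_def)
      with region_maximizers(2)[OF generic h, of p q s] show "e \<in> edges a g" by simp
    qed
  qed (rule region_maximizers(1)[OF generic h])
  have 1: "root_level h x y i \<noteq> root_level h x y k" if "(x, y) \<in> edges a g" "i \<noteq> k" "{i, k} \<noteq> {x, y}" for x y i k
    using generic_levels[OF generic that] regionD(1)[OF h that(1), of i k] regionD(1)[OF h that(1), of k i] by linarith
  have 2: "root_level h x y x \<noteq> root_level h x' y' x'" if "(x, y) \<in> edges a g" "(x', y') \<in> edges a g" "(x, y) \<noteq> (x', y')" for x y x' y'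
    using generic_values[OF generic that] regionD(2)[OF h that(1,2)] regionD(2)[OF h that(2,1)] by linarith
  have 3: "line_value a h (slope a h x y) p = root_level h x y x" if "(x, y) \<in> edges a g" "p \<in> {x, y}" for x y p
    using that root_level_pair[of x y h] by (auto simp: root_level_def edges_def)
  show "generic a h"
    unfolding generic_def
  proof (intro conjI allI impI; elim conjE)
    fix s p q i k
    assume A: "p \<noteq> q" "p \<in> maximizers a h s" "q \<in> maximizers a h s" "i \<noteq> k" "line_value a h s i = line_value a h s k"
    obtain x y where "(x, y) \<in> edges a g" "{p, q} = {x, y}" "s = slope a h x y"
      by (rule region_maximizers_pair[OF generic h A(1-3)])
    then show "{i, k} = {p, q}" using 1[of x y i k] A(4,5) by (auto simp: root_level_def)
  next
    fix s s' p q p' q'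
    assume A: "s \<noteq> s'" "p \<noteq> q" "p \<in> maximizers a h s" "q \<in> maximizers a h s" "p' \<noteq> q'" "p' \<in> maximizers a h s'" "q' \<in> maximizers a h s'"
    obtain x y where x: "(x, y) \<in> edges a g" "{p, q} = {x, y}" "s = slope a h x y"
      by (rule region_maximizers_pair[OF generic h A(2-4)])
    obtain x' y' where x': "(x', y') \<in> edges a g" "{p', q'} = {x', y'}" "s' = slope a h x' y'"
      by (rule region_maximizers_pair[OF generic h A(5-7)])
    have "(x, y) \<noteq> (x', y')" using A(1) x x' by auto
    moreover have "p \<in> {x, y}" "p' \<in> {x', y'}" using x(2) x'(2) by (metis insertI1)+
    ultimately show "line_value a h s p \<noteq> line_value a h s' p'"
      using 2[OF x(1) x'(1)] 3[OF x(1), of p] 3[OF x'(1), of p'] x(3) x'(3) by simp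
  qed
qed

lemma Z_key:
  assumes "\<And>i. 0 \<le> g $ i" "simple_hull a g" "j < num_roots a g"
  shows "trop_poly a g (trop_root a g j) = root_level g (w_vertex a g j) (w_vertex a g (Suc j)) (w_vertex a g j)"
proof -
  have "(w_vertex a g j, w_vertex a g (Suc j)) \<in> edges a g" using edges_enumeration[OF assms(1,2)] assms(3) by auto
  then have "w_vertex a g j \<in> maximizers a g (trop_root a g j)" by (simp add: edges_iff trop_root_eq)
  then show ?thesis by (simp add: trop_poly_eq root_level_def trop_root_eq)
qed

lemma w_vertex_pair_inj:
  assumes "j < num_roots a g" "m < num_roots a g" "w_vertex a g j = w_vertex a g m"
  shows "j = m"
proof -
  have "j < card (W_set a g)" "m < card (W_set a g)" using assms(1,2) by (simp_all add: num_roots_def)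
  then show ?thesis using w_vertex_less[of j m g] w_vertex_less[of m j g] assms(3)
    by (cases j m rule: linorder_cases) auto
qed

lemma Z_inj:
  assumes nonneg: "\<And>i. 0 \<le> g $ i" and generic: "generic a g"
  shows "inj_on (\<lambda>j. trop_poly a g (trop_root a g j)) {..<num_roots a g}"
proof (rule inj_onI)
  note simple = generic_imp_simple_hull[OF generic]
  fix j m assume jm: "j \<in> {..<num_roots a g}" "m \<in> {..<num_roots a g}"
    and eq: "trop_poly a g (trop_root a g j) = trop_poly a g (trop_root a g m)"
  have "(w_vertex a g j, w_vertex a g (Suc j)) \<in> edges a g" "(w_vertex a g m, w_vertex a g (Suc m)) \<in> edges a g"
    using edges_enumeration[OF nonneg simple] jm by auto
  from generic_values[OF generic this] have "w_vertex a g j = w_vertex a g m"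
    using eq jm by (auto simp: Z_key[OF nonneg simple])
  then show "j = m" using w_vertex_pair_inj jm by auto
qed

lemma M_key: "real_of_int (a i) * trop_root a g j + g $ i = root_level g (w_vertex a g j) (w_vertex a g (Suc j)) i"
  by (simp add: root_level_def line_value_def trop_root_eq)

lemma M_inj:
  assumes nonneg: "\<And>i. 0 \<le> g $ i" and generic: "generic a g" and j: "j < num_roots a g"
  shows "inj_on (\<lambda>i. - (real_of_int (a i) * trop_root a g j + g $ i)) (UNIV - {w_vertex a g j, w_vertex a g (Suc j)})"
proof (rule inj_onI)
  fix i k assume ik: "i \<in> UNIV - {w_vertex a g j, w_vertex a g (Suc j)}" "k \<in> UNIV - {w_vertex a g j, w_vertex a g (Suc j)}"
    "- (real_of_int (a i) * trop_root a g j + g $ i) = - (real_of_int (a k) * trop_root a g j + g $ k)"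
  have "(w_vertex a g j, w_vertex a g (Suc j)) \<in> edges a g"
    using edges_enumeration[OF nonneg generic_imp_simple_hull[OF generic]] j by auto
  from generic_levels[OF generic this, of i k] show "i = k" using ik by (auto simp: M_key)
qed

text \<open>For equal vertex sets the sorted lists translate into the inequalities. The inequalities
  in turn determine \<open>edges\<close> and therefore the vertex set, which settles the remaining
  case.\<close>

lemma comb_data_eq_iff:
  assumes g: "\<And>i. 0 \<le> g $ i" "generic a g" and h: "\<And>i. 0 \<le> h $ i" "generic a h"
  shows "comb_data a g = comb_data a h \<longleftrightarrow> h \<in> region g"
proof -
  note sg = generic_imp_simple_hull[OF g(2)] and sh = generic_imp_simple_hull[OF h(2)]
  note eg = edges_enumeration[OF g(1) sg]
  let ?e = "\<lambda>j. (w_vertex a g j, w_vertex a g (Suc j))"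
  have iff: "comb_data a g = comb_data a h \<longleftrightarrow> h \<in> region g" if W: "W_set a g = W_set a h"
  proof -
    have same: "num_roots a h = num_roots a g" "\<And>j. w_vertex a h j = w_vertex a g j"
      using W by (simp_all add: num_roots_def w_vertex_def)
    have "Z_seq a g = Z_seq a h \<longleftrightarrow> (\<forall>j<num_roots a g. \<forall>m<num_roots a g.
        root_level g (w_vertex a g j) (w_vertex a g (Suc j)) (w_vertex a g j) < root_level g (w_vertex a g m) (w_vertex a g (Suc m)) (w_vertex a g m)
      \<longrightarrow> root_level h (w_vertex a g j) (w_vertex a g (Suc j)) (w_vertex a g j) < root_level h (w_vertex a g m) (w_vertex a g (Suc m)) (w_vertex a g m))"
      unfolding Z_seq_def same
      using Z_inj[OF g] Z_inj[OF h] Z_key[OF g(1) sg] Z_key[OF h(1) sh]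
      by (subst sort_key_eq_iff_order) (auto simp: same lessThan_atLeast0)
    moreover have "M_seq a g j = M_seq a h j \<longleftrightarrow> (\<forall>i k.
        root_level g (w_vertex a g j) (w_vertex a g (Suc j)) i < root_level g (w_vertex a g j) (w_vertex a g (Suc j)) k
      \<longrightarrow> root_level h (w_vertex a g j) (w_vertex a g (Suc j)) i < root_level h (w_vertex a g j) (w_vertex a g (Suc j)) k)"
      if j: "j < num_roots a g" for j
    proof -
      let ?p = "w_vertex a g j" and ?q = "w_vertex a g (Suc j)"
      have e: "(?p, ?q) \<in> edges a g" "(?p, ?q) \<in> edges a h"
        using eg j edges_enumeration[OF h(1) sh] same by auto
      have pq: "?p < ?q" using e(1) by (simp add: edges_def)
      have "M_seq a g j = M_seq a h j \<longleftrightarrow> (\<forall>i\<in>UNIV - {?p, ?q}. \<forall>k\<in>UNIV - {?p, ?q}.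
         - root_level g ?p ?q i < - root_level g ?p ?q k \<longrightarrow> - root_level h ?p ?q i < - root_level h ?p ?q k)"
        unfolding M_seq_def same
        using M_inj[OF g j] M_inj[OF h, of j] j same
        by (subst sort_key_eq_iff_order) (auto simp: M_key same)
      \<comment> \<open>The lists leave out the two ends of the edge, while \<open>region\<close>
        compares all indices. The extra comparisons hold automatically, as both ends are strictly on
        top for \<open>g\<close> and for \<open>h\<close>.\<close>
      also have "\<dots> \<longleftrightarrow> (\<forall>i k. root_level g ?p ?q i < root_level g ?p ?q k \<longrightarrow> root_level h ?p ?q i < root_level h ?p ?q k)"
      proof (intro iffI allI impI)
        fix i k assume H: "\<forall>i\<in>UNIV - {?p, ?q}. \<forall>k\<in>UNIV - {?p, ?q}.
           - root_level g ?p ?q i < - root_level g ?p ?q k \<longrightarrow> - root_level h ?p ?q i < - root_level h ?p ?q k"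
          and lt: "root_level g ?p ?q i < root_level g ?p ?q k"
        have max: "root_level g ?p ?q k \<le> root_level g ?p ?q ?p"
          using root_level_edge_less[OF e(1), of k] root_level_pair[OF pq, of g] by (cases "k \<in> {?p, ?q}") auto
        then have i: "i \<notin> {?p, ?q}" using lt root_level_pair[OF pq, of g] by auto
        show "root_level h ?p ?q i < root_level h ?p ?q k"
        proof (cases "k \<in> {?p, ?q}")
          case True
          then show ?thesis using root_level_edge_less[OF e(2) i] root_level_pair[OF pq, of h] by auto
        next
          case False
          then show ?thesis using H i lt by auto
        qed
      qed auto
      finally show ?thesis .
    qed
    ultimately show ?thesis
      unfolding comb_data_def region_def eg using W by (auto simp: same)
  qed
  show ?thesis
  proof (cases "W_set a g = W_set a h")
    case False
    moreover have "h \<notin> region g"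
      using False region_generic(1)[OF g(2)] W_set_eq[OF g(1) sg] W_set_eq[OF h(1) sh] by auto
    ultimately show ?thesis by (simp add: comb_data_def)
  qed (rule iff)
qed

end


subsection \<open>Support functions of polytopes\<close>

lemma support_function_convex_hull:
  fixes U :: "'a::euclidean_space set"
  assumes "finite U" "v \<in> U" "\<And>u. u \<in> U \<Longrightarrow> g \<bullet> u \<le> g \<bullet> v"
  shows "support_function (convex hull U) g = g \<bullet> v"
  unfolding support_function_def
proof (rule cSup_eq_maximum)
  show "g \<bullet> v \<in> (\<bullet>) g ` (convex hull U)" using assms(2) by (intro imageI hull_inc)
  have "convex hull U \<subseteq> {x. g \<bullet> x \<le> g \<bullet> v}"
    using assms(3) by (intro hull_minimal convex_halfspace_le) auto
  then show "x \<le> g \<bullet> v" if "x \<in> (\<bullet>) g ` (convex hull U)" for x using that by auto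
qed

lemma exists_maximal_generator:
  fixes U :: "'a::euclidean_space set"
  assumes "finite U" "U \<noteq> {}"
  obtains v where "v \<in> U" "\<And>u. u \<in> U \<Longrightarrow> g \<bullet> u \<le> g \<bullet> v"
proof -
  have "Max ((\<bullet>) g ` U) \<in> (\<bullet>) g ` U" using assms by (intro Max_in) auto
  then obtain v where v: "v \<in> U" "g \<bullet> v = Max ((\<bullet>) g ` U)" by auto
  have "g \<bullet> u \<le> g \<bullet> v" if "u \<in> U" for u unfolding v(2) using that assms by simp
  with v(1) show ?thesis using that by blast
qed

text \<open>The linear pieces are the normal cones of the generators, each cut out by finitely many
  half-spaces.\<close>

lemma piecewise_linear_support_function:
  fixes U :: "'a::euclidean_space set"
  assumes "finite U" "U \<noteq> {}"
  shows "piecewise_linear (support_function (convex hull U))"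
  unfolding piecewise_linear_def
proof (intro exI[of _ "(\<lambda>v. \<Inter>u\<in>U. {g. (u - v) \<bullet> g \<le> 0}) ` U"] conjI ballI)
  let ?P = "\<lambda>v. \<Inter>u\<in>U. {g. (u - v) \<bullet> g \<le> 0}"
  have P: "g \<in> ?P v \<longleftrightarrow> (\<forall>u\<in>U. g \<bullet> u \<le> g \<bullet> v)" for g v
    by (simp add: inner_diff_left inner_diff_right inner_commute)
  show "finite (?P ` U)" using assms by simp
  show "\<Union> (?P ` U) = UNIV"
  proof (intro equalityI subsetI UNIV_I)
    fix g :: 'a
    obtain v where "v \<in> U" "\<And>u. u \<in> U \<Longrightarrow> g \<bullet> u \<le> g \<bullet> v" using exists_maximal_generator[OF assms] by blast
    then show "g \<in> \<Union> (?P ` U)" by (intro UN_I[of v]) (unfold P, blast+)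
  qed
  fix Q assume "Q \<in> ?P ` U"
  then obtain v where v: "v \<in> U" "Q = ?P v" by auto
  show "polyhedron Q"
    unfolding v(2) using assms(1) by (intro polyhedron_Inter) (auto intro: polyhedron_halfspace_le)
  show "\<exists>f. linear f \<and> (\<forall>x\<in>Q. support_function (convex hull U) x = f x)"
  proof (intro exI[of _ "\<lambda>g. g \<bullet> v"] conjI ballI)
    show "linear (\<lambda>g. g \<bullet> v)" by (rule bounded_linear.linear[OF bounded_linear_inner_left])
    show "support_function (convex hull U) g = g \<bullet> v" if "g \<in> Q" for g
      using that unfolding v(2) P by (intro support_function_convex_hull assms v) auto
  qed
qed

lemma convex_on_support_function:
  fixes U :: "'a::euclidean_space set"
  assumes "finite U" "U \<noteq> {}"
  shows "convex_on UNIV (support_function (convex hull U))"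
proof (rule convex_onI)
  fix t :: real and x y :: 'a assume t: "0 < t" "t < 1"
  define z where "z = (1 - t) *\<^sub>R x + t *\<^sub>R y"
  have le: "g \<bullet> u \<le> support_function (convex hull U) g" if u: "u \<in> U" for g u
  proof -
    obtain v where v: "v \<in> U" "\<And>u. u \<in> U \<Longrightarrow> g \<bullet> u \<le> g \<bullet> v" using exists_maximal_generator[OF assms] by blast
    show ?thesis using v(2)[OF u] support_function_convex_hull[OF assms(1) v] by simp
  qed
  obtain v where v: "v \<in> U" "\<And>u. u \<in> U \<Longrightarrow> z \<bullet> u \<le> z \<bullet> v" using exists_maximal_generator[OF assms] by blast
  have "support_function (convex hull U) z = z \<bullet> v" by (rule support_function_convex_hull[OF assms(1) v])
  also have "\<dots> = (1 - t) * (x \<bullet> v) + t * (y \<bullet> v)" by (simp add: z_def inner_add_left)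
  also have "\<dots> \<le> (1 - t) * support_function (convex hull U) x + t * support_function (convex hull U) y"
    using t by (intro add_mono mult_left_mono le v(1)) auto
  finally show "support_function (convex hull U) ((1 - t) *\<^sub>R x + t *\<^sub>R y)
      \<le> (1 - t) * support_function (convex hull U) x + t * support_function (convex hull U) y"
    by (simp add: z_def)
qed simp

section \<open>Covectors exposing a vertex\<close>

definition exposes :: "'a::euclidean_space set \<Rightarrow> 'a \<Rightarrow> 'a \<Rightarrow> bool" where
  "exposes U g v \<longleftrightarrow> v \<in> U \<and> (\<forall>u\<in>U. u \<noteq> v \<longrightarrow> g \<bullet> u < g \<bullet> v)"

lemma support_function_exposes:
  assumes "finite U" "exposes U g v"
  shows "support_function (convex hull U) g = g \<bullet> v"
  using assms by (intro support_function_convex_hull) (auto simp: exposes_def intro: less_imp_le)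

lemma open_exposes:
  assumes "finite U"
  shows "open {g. exposes U g v}"
proof -
  have "{g. exposes U g v} = (if v \<in> U then \<Inter>u\<in>U - {v}. {g. g \<bullet> u < g \<bullet> v} else {})"
    by (auto simp: exposes_def)
  moreover have "open {g. g \<bullet> u < g \<bullet> v}" for u by (intro open_Collect_less continuous_intros)
  ultimately show ?thesis using assms by (auto intro!: open_INT)
qed

lemma exposes_unique: "exposes U g v \<Longrightarrow> exposes U g w \<Longrightarrow> v = w"
  unfolding exposes_def by (metis less_asym')

text \<open>The sets of covectors exposing different generators are open and pairwise disjoint, so a
  connected set covered by them lies in one of them.\<close>

lemma exposes_connected:
  assumes "finite U" "connected R" "\<And>g. g \<in> R \<Longrightarrow> \<exists>v. exposes U g v"
    and g: "g \<in> R" "exposes U g v" and h: "h \<in> R"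
  shows "exposes U h v"
proof (rule ccontr)
  assume nh: "\<not> exposes U h v"
  let ?A = "{g. exposes U g v}" and ?B = "\<Union>w\<in>U - {v}. {g. exposes U g w}"
  have "?A \<inter> ?B \<inter> R = {}" by (auto dest: exposes_unique)
  moreover have "R \<subseteq> ?A \<union> ?B"
  proof
    fix x assume "x \<in> R"
    then obtain w where "exposes U x w" using assms(3) by blast
    then show "x \<in> ?A \<union> ?B" by (cases "w = v") (auto simp: exposes_def)
  qed
  moreover have "open ?A" "open ?B" using open_exposes[OF assms(1)] by auto
  ultimately have "?A \<inter> R = {} \<or> ?B \<inter> R = {}" by (intro connectedD[OF assms(2)]) auto
  moreover have "h \<in> ?B"
  proof -
    obtain w where "exposes U h w" using assms(3)[OF h] by blast
    moreover from this have "w \<in> U" "w \<noteq> v" using nh by (auto simp: exposes_def)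
    ultimately show ?thesis by blast
  qed
  ultimately show False using g h by blast
qed

lemma exposes_imp_extreme_point:
  assumes "finite U" "exposes U g v"
  shows "v extreme_point_of (convex hull U)"
proof -
  have "convex hull (U - {v}) \<subseteq> {x. g \<bullet> x < g \<bullet> v}"
    using assms(2) by (intro hull_minimal convex_halfspace_lt) (auto simp: exposes_def)
  then have "v \<notin> convex hull (U - {v})" by auto
  from extreme_point_of_convex_hull_insert[OF _ this] assms show ?thesis
    by (simp add: exposes_def insert_absorb)
qed

text \<open>Strict separation of \<open>v\<close> from the hull of the other generators; the sign of
  the separating vector is reversed because \<open>exposes\<close> maximizes.\<close>

lemma extreme_point_imp_exposes:
  assumes "finite U" "v extreme_point_of (convex hull U)"
  shows "\<exists>g. exposes U g v"
proof -
  have v: "v \<in> U" using extreme_point_of_convex_hull[OF assms(2)] .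
  have "convex (convex hull U - {v})"
    using assms(2) extreme_point_of_stillconvex[OF convex_convex_hull] by blast
  then have "convex hull (U - {v}) \<subseteq> convex hull U - {v}"
    by (intro hull_minimal) (auto intro: hull_inc)
  then have "v \<notin> convex hull (U - {v})" by blast
  moreover have "closed (convex hull (U - {v}))"
    using assms(1) by (intro compact_imp_closed finite_imp_compact_convex_hull) auto
  ultimately obtain a b where ab: "a \<bullet> v < b" "\<And>x. x \<in> convex hull (U - {v}) \<Longrightarrow> b < a \<bullet> x"
    using separating_hyperplane_closed_point[OF convex_convex_hull] by meson
  have "exposes U (- a) v"
    unfolding exposes_def
  proof (intro conjI ballI impI v)
    fix u assume "u \<in> U" "u \<noteq> v"
    then have "b < a \<bullet> u" by (intro ab(2) hull_inc) auto
    then show "- a \<bullet> u < - a \<bullet> v" using ab(1) by simp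
  qed
  then show ?thesis ..
qed

text \<open>Finitely many hyperplanes form a null set, and a nonempty open set is not one.\<close>

lemma open_avoids_hyperplanes:
  fixes A :: "'a::euclidean_space set"
  assumes "open A" "A \<noteq> {}" "finite W" "0 \<notin> W"
  shows "\<exists>g\<in>A. \<forall>w\<in>W. w \<bullet> g \<noteq> 0"
proof (rule ccontr)
  assume "\<not> ?thesis"
  then have "A \<subseteq> (\<Union>w\<in>W. {g. w \<bullet> g = 0})" by blast
  moreover have "negligible (\<Union>w\<in>W. {g. w \<bullet> g = 0})"
    using assms(3,4) by (intro negligible_Union) (auto intro!: negligible_hyperplane)
  ultimately have "negligible A" using negligible_subset by blast
  then show False using open_not_negligible assms(1,2) by blast
qed

lemma distinct_values_ordered:
  fixes n :: nat
  shows "(\<forall>j m. j < m \<and> m < n \<longrightarrow> f j \<noteq> f m) \<longleftrightarrow> (\<forall>j<n. \<forall>m<n. j \<noteq> m \<longrightarrow> f j \<noteq> f m)"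
proof (intro iffI allI impI)
  fix j m assume H: "\<forall>j m. j < m \<and> m < n \<longrightarrow> f j \<noteq> f m" and "j < n" "m < n" "j \<noteq> m"
  then consider "j < m" | "m < j" by linarith
  then show "f j \<noteq> f m" using H \<open>j < n\<close> \<open>m < n\<close> by cases metis+
qed auto

subsection \<open>The cones of the combinatorial types\<close>

context increasing_exponents
begin

text \<open>Together with \<open>value_form\<close> this writes the quantities compared in (A1) and
  (A2) as inner products, so that each equality to be avoided defines a hyperplane.\<close>

definition slope_form :: "'n \<Rightarrow> 'n \<Rightarrow> (real, 'n) vec" where
  "slope_form p q = (1 / real_of_int (a q - a p)) *\<^sub>R (axis p 1 - axis q 1)"

definition value_form :: "'n \<Rightarrow> 'n \<Rightarrow> (real, 'n) vec" where
  "value_form p q = (1 / real_of_int (a q - a p)) *\<^sub>R (real_of_int (a q) *\<^sub>R axis p 1 - real_of_int (a p) *\<^sub>R axis q 1)"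

lemma slope_form_inner: "slope_form p q \<bullet> g = slope a g p q"
  by (simp add: slope_form_def slope_def inner_diff_left inner_axis' )

lemma value_form_inner: "p < q \<Longrightarrow> value_form p q \<bullet> g = line_value a g (slope a g p q) p"
  by (simp add: value_form_def line_value_slope_value inner_diff_left inner_axis')

lemma slope_form_support: "p < q \<Longrightarrow> slope_form p q $ i \<noteq> 0 \<longleftrightarrow> i \<in> {p, q}"
  by (auto simp: slope_form_def axis_def)

text \<open>Both coefficients are nonzero because \<open>0\<close> is not an exponent; forms of
  different pairs then have different supports and cannot coincide.\<close>

lemma value_form_support: "(\<And>i. a i \<noteq> 0) \<Longrightarrow> p < q \<Longrightarrow> value_form p q $ i \<noteq> 0 \<longleftrightarrow> i \<in> {p, q}"
  by (auto simp: value_form_def axis_def)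

lemma A1_slope_pair:
  assumes A1: "cond_A1 a g" and "p \<noteq> q" "p \<in> maximizers a g s" "q \<in> maximizers a g s" "i \<noteq> k" "line_value a g s i = line_value a g s k"
  shows "{i, k} = {p, q}"
proof -
  have 1: "s = slope a g (min x y) (max x y)" if "x \<noteq> y" "line_value a g s x = line_value a g s y" for x y
    using that slope_unique[of x y g s] slope_unique[of y x g s] by (cases x y rule: linorder_cases) auto
  have "slope a g (min p q) (max p q) = slope a g (min i k) (max i k)"
    using 1[OF assms(2) maximizers_line_value_eq[OF assms(3,4)]] 1[OF assms(5,6)] by simp
  then have "(min p q, max p q) = (min i k, max i k)"
    using A1 assms(2,5) unfolding cond_A1_def by (metis linorder_neqE max_def min_def not_le order_less_imp_le)
  then show ?thesis by (auto simp: min_def max_def split: if_splits)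
qed

lemma A1_imp_simple_hull:
  assumes "cond_A1 a g" shows "simple_hull a g"
  unfolding simple_hull_def
proof (intro allI impI)
  fix s p q assume pq: "p \<noteq> q" "p \<in> maximizers a g s" "q \<in> maximizers a g s"
  have "x \<in> {p, q}" if "x \<in> maximizers a g s" for x
    using A1_slope_pair[OF assms pq, of x p] maximizers_line_value_eq[OF that pq(2)] by blast
  then show "maximizers a g s = {p, q}" using pq by blast
qed

lemma A1_generic_iff:
  assumes A1: "cond_A1 a g"
  shows "generic a g \<longleftrightarrow> (\<forall>(p, q)\<in>edges a g. \<forall>(p', q')\<in>edges a g. (p, q) \<noteq> (p', q') \<longrightarrow> root_level g p q p \<noteq> root_level g p' q' p')"
    (is "_ \<longleftrightarrow> ?R")
proof
  assume "generic a g" then show ?R using generic_values by blast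
next
  assume R: ?R
  note simple = A1_imp_simple_hull[OF A1]
  have edge: "\<exists>x y. (x, y) \<in> edges a g \<and> {p, q} = {x, y} \<and> s = slope a g x y \<and> line_value a g s p = root_level g x y x"
    if "p \<noteq> q" "p \<in> maximizers a g s" "q \<in> maximizers a g s" for p q s
  proof (cases "p < q")
    case True
    with edgesI[OF simple True that(2,3)] show ?thesis by (auto simp: root_level_def)
  next
    case False
    then have "q < p" using that by simp
    from edgesI[OF simple this that(3,2)] show ?thesis
      using maximizers_line_value_eq[OF that(2,3)] by (intro exI[of _ q] exI[of _ p]) (auto simp: root_level_def)
  qed
  show "generic a g"
    unfolding generic_def
  proof (intro conjI allI impI; elim conjE)
    fix s p q i k
    assume "p \<noteq> q" "p \<in> maximizers a g s" "q \<in> maximizers a g s" "i \<noteq> k" "line_value a g s i = line_value a g s k"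
    then show "{i, k} = {p, q}" by (rule A1_slope_pair[OF A1])
  next
    fix s s' p q p' q'
    assume A: "s \<noteq> s'" "p \<noteq> q" "p \<in> maximizers a g s" "q \<in> maximizers a g s" "p' \<noteq> q'" "p' \<in> maximizers a g s'" "q' \<in> maximizers a g s'"
    obtain x y where x: "(x, y) \<in> edges a g" "s = slope a g x y" "line_value a g s p = root_level g x y x"
      using edge[OF A(2-4)] by blast
    obtain x' y' where x': "(x', y') \<in> edges a g" "s' = slope a g x' y'" "line_value a g s' p' = root_level g x' y' x'"
      using edge[OF A(5-7)] by blast
    have "(x, y) \<noteq> (x', y')" using A(1) x(2) x'(2) by auto
    then show "line_value a g s p \<noteq> line_value a g s' p'" using R x(1,3) x'(1,3) by auto
  qed
qed

text \<open>\<open>cond_A2\<close> speaks of enumerated vertices of the polygon,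
  \<open>generic\<close> of maximizers; the enumeration of the edges translates one into the
  other.\<close>

lemma A2_iff_generic:
  assumes nonneg: "\<And>i. 0 \<le> g $ i" and A1: "cond_A1 a g"
  shows "cond_A2 a g \<longleftrightarrow> generic a g"
proof -
  note simple = A1_imp_simple_hull[OF A1]
  let ?w = "w_vertex a g"
  let ?v = "\<lambda>j. root_level g (?w j) (?w (Suc j)) (?w j)"
  have e: "(?w j, ?w (Suc j)) \<in> edges a g" if "j < num_roots a g" for j
    using edges_enumeration[OF nonneg simple] that by auto
  have v: "(real_of_int (a (?w (Suc j))) * g $ ?w j - real_of_int (a (?w j)) * g $ ?w (Suc j)) / real_of_int (a (?w (Suc j)) - a (?w j)) = ?v j"
    if "j < num_roots a g" for j
    using e[OF that] by (simp add: root_level_def line_value_slope_value edges_def)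
  have "cond_A2 a g \<longleftrightarrow> (\<forall>j m. j < m \<and> m < num_roots a g \<longrightarrow> ?v j \<noteq> ?v m)"
    unfolding cond_A2_def Let_def by (intro all_cong1 imp_cong refl) (simp add: v del: of_int_diff)
  also have "\<dots> \<longleftrightarrow> (\<forall>j<num_roots a g. \<forall>m<num_roots a g. j \<noteq> m \<longrightarrow> ?v j \<noteq> ?v m)"
    by (rule distinct_values_ordered)
  also have "\<dots> \<longleftrightarrow> (\<forall>j<num_roots a g. \<forall>m<num_roots a g. (?w j, ?w (Suc j)) \<noteq> (?w m, ?w (Suc m)) \<longrightarrow> ?v j \<noteq> ?v m)"
    using w_vertex_pair_inj[of _ g] by blast
  also have "\<dots> \<longleftrightarrow> generic a g"
    unfolding A1_generic_iff[OF A1] edges_enumeration[OF nonneg simple] by auto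
  finally show ?thesis .
qed

lemma tropical_morse_iff:
  "g \<in> tropical_morse a \<longleftrightarrow> (\<forall>i. 0 \<le> g $ i) \<and> cond_A1 a g \<and> generic a g"
  using A2_iff_generic by (auto simp: tropical_morse_def)

lemma comb_type_eq:
  assumes "g \<in> tropical_morse a"
  shows "{h \<in> tropical_morse a. comb_data a h = comb_data a g} = tropical_morse a \<inter> region g"
proof -
  have "comb_data a h = comb_data a g \<longleftrightarrow> h \<in> region g" if "h \<in> tropical_morse a" for h
    using comb_data_eq_iff[of g h] assms that unfolding tropical_morse_iff by (metis (lifting))
  then show ?thesis by blast
qed

text \<open>\<open>region g\<close> is closed under sums and positive multiples but may miss the
  apex, which a convex cone has to contain.\<close>

lemma type_cone_subset:
  assumes "g \<in> tropical_morse a"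
  shows "type_cone a (comb_data a g) \<subseteq> insert 0 (region g)"
  unfolding type_cone_def comb_type_eq[OF assms]
proof (rule hull_minimal)
  show "convex_cone (insert 0 (region g))"
    unfolding convex_cone_iff
  proof (intro conjI ballI allI impI)
    fix x y assume "x \<in> insert 0 (region g)" "y \<in> insert 0 (region g)"
    then show "x + y \<in> insert 0 (region g)" by (auto intro: region_add)
  next
    fix x and c :: real assume "x \<in> insert 0 (region g)" "c \<ge> 0"
    then show "c *\<^sub>R x \<in> insert 0 (region g)" by (cases "c = 0") (auto intro: region_scaleR)
  qed simp
qed auto

text \<open>Finitely many strict inequalities survive a small step in each coordinate direction,
  taken positive to keep the entries nonnegative. The base point and its perturbations span the
  space, so a linear function is determined by its values on the cone.\<close>

lemma tropical_morse_perturb: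
  assumes g: "g \<in> tropical_morse a"
  shows "\<exists>e>0. \<forall>i. g + e *\<^sub>R axis i 1 \<in> tropical_morse a \<inter> region g"
proof -
  have ev: "\<forall>\<^sub>F e in at_right 0. x + e * x' < y + e * y'" if "x < y" for x y x' y' :: real
  proof -
    have "((\<lambda>e. x + e * x') \<longlongrightarrow> x + 0 * x') (at_right 0)" "((\<lambda>e. y + e * y') \<longlongrightarrow> y + 0 * y') (at_right 0)"
      by (intro tendsto_intros)+
    then show ?thesis using order_tendstoD(2)[of "\<lambda>e. x + e * x' - (y + e * y')" "x - y" "at_right 0" 0] that
      by (auto dest: tendsto_diff)
  qed
  have evne: "\<forall>\<^sub>F e in at_right 0. x + e * x' \<noteq> y + e * y'" if "x \<noteq> y" for x y x' y' :: real
    using ev[of x y x' y'] ev[of y x y' x'] that by (cases "x < y") (auto elim: eventually_mono)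
  let ?h = "\<lambda>e i. g + e *\<^sub>R axis i (1::real)"
  have Lh: "root_level (?h e i) p q k = root_level g p q k + e * root_level (axis i 1) p q k" for e i p q k
    by (simp add: root_level_add root_level_scaleR)
  have sl: "slope a (?h e i) p q = slope a g p q + e * slope a (axis i 1) p q" for e i p q
    by (simp add: slope_form_inner[symmetric] inner_add_right)
  have 1: "\<forall>\<^sub>F e in at_right 0. \<forall>i p q k l. root_level g p q k < root_level g p q l \<longrightarrow> root_level (?h e i) p q k < root_level (?h e i) p q l"
    unfolding Lh by (intro eventually_all_finite) (auto intro: ev)
  have 2: "\<forall>\<^sub>F e in at_right 0. \<forall>i p q p' q'. root_level g p q p < root_level g p' q' p' \<longrightarrow> root_level (?h e i) p q p < root_level (?h e i) p' q' p'"
    unfolding Lh by (intro eventually_all_finite) (auto intro: ev)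
  have 3: "\<forall>\<^sub>F e in at_right 0. \<forall>i p q r s. slope a g p q \<noteq> slope a g r s \<longrightarrow> slope a (?h e i) p q \<noteq> slope a (?h e i) r s"
    unfolding sl by (intro eventually_all_finite) (auto intro: evne)
  have "\<forall>\<^sub>F e in at_right 0. e > 0 \<and> (\<forall>i. ?h e i \<in> region g \<and> cond_A1 a (?h e i))"
    using 1 2 3 eventually_at_right_less[of 0]
  proof eventually_elim
    case (elim e)
    have "?h e i \<in> region g" for i by (rule regionI) (use elim in auto)
    moreover have "cond_A1 a (?h e i)" for i
      using elim(3) g unfolding tropical_morse_iff cond_A1_def by blast
    ultimately show ?case using elim by blast
  qed
  then obtain e where e: "e > 0" "\<And>i. ?h e i \<in> region g" "\<And>i. cond_A1 a (?h e i)"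
    using eventually_happens'[OF trivial_limit_at_right_real] by blast
  have "?h e i \<in> tropical_morse a" for i
    using g e region_generic(2)[of g "?h e i"] unfolding tropical_morse_iff by (auto simp: axis_def)
  with e show ?thesis by blast
qed

text \<open>Density of the generic covectors. Since \<open>edges\<close> depends on the covector
  being sought, values are separated for all pairs of indices.\<close>

lemma generic_covector_exists:
  assumes az: "\<And>i. a i \<noteq> 0" and "open A" "A \<noteq> {}"
  shows "\<exists>g\<in>A. cond_A1 a g \<and> generic a g"
proof -
  define Q where "Q = {((p, q), (r, s)) | (p::'n) q (r::'n) s. p < q \<and> r < s \<and> (p, q) \<noteq> (r, s)}"
  define W where "W = (\<lambda>((p, q), (r, s)). slope_form p q - slope_form r s) ` Q
    \<union> (\<lambda>((p, q), (r, s)). value_form p q - value_form r s) ` Q"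
  have "finite Q" by simp
  then have "finite W" by (simp add: W_def)
  have ne: "slope_form p q \<noteq> slope_form r s" "value_form p q \<noteq> value_form r s"
    if "p < q" "r < s" "(p, q) \<noteq> (r, s)" for p q r s
  proof -
    have "{p, q} \<noteq> {r, s}" using that by (auto simp: doubleton_eq_iff)
    then show "slope_form p q \<noteq> slope_form r s" "value_form p q \<noteq> value_form r s"
      using slope_form_support[OF that(1)] slope_form_support[OF that(2)]
        value_form_support[OF az that(1)] value_form_support[OF az that(2)] by (auto simp: set_eq_iff) metis+
  qed
  then have "0 \<notin> W" by (auto simp: W_def Q_def)
  from open_avoids_hyperplanes[OF assms(2,3) \<open>finite W\<close> this]
  obtain g where g: "g \<in> A" "\<And>w. w \<in> W \<Longrightarrow> w \<bullet> g \<noteq> 0" by blast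
  have s: "slope a g p q \<noteq> slope a g r s" and v: "line_value a g (slope a g p q) p \<noteq> line_value a g (slope a g r s) r"
    if "p < q" "r < s" "(p, q) \<noteq> (r, s)" for p q r s
  proof -
    have Q: "((p, q), (r, s)) \<in> Q" using that by (simp add: Q_def)
    then have "slope_form p q - slope_form r s \<in> W" "value_form p q - value_form r s \<in> W"
      unfolding W_def by force+
    from this[THEN g(2)] show "slope a g p q \<noteq> slope a g r s" "line_value a g (slope a g p q) p \<noteq> line_value a g (slope a g r s) r"
      using that(1,2) by (auto simp: inner_diff_left slope_form_inner value_form_inner)
  qed
  have A1: "cond_A1 a g" unfolding cond_A1_def using s by blast
  have "generic a g" unfolding A1_generic_iff[OF A1] using v by (auto simp: root_level_def edges_def)
  with A1 g(1) show ?thesis by blast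
qed

section \<open>Linearity on the type cones and the vertices of the Morse polytope\<close>

definition morse_exponents :: "(real, 'n) vec set" where
  "morse_exponents = expvec ` keys (morse_poly a)"

lemma morse_exponents: "finite morse_exponents" "morse_exponents \<noteq> {}"
  using morse_poly_nonzero[of a] by (simp_all add: morse_exponents_def)

lemma morse_polytope_eq: "morse_polytope a = convex hull morse_exponents"
  by (simp add: morse_polytope_def newton_polytope_def morse_exponents_def expvec_def[abs_def])

end

locale morse_support = increasing_exponents +
  assumes nonzero: "a i \<noteq> 0" and generating: "affinely_generates_int a"
begin

lemma generic_exposes:
  assumes "generic a g"
  shows "\<exists>v. exposes morse_exponents g v"
proof -
  have "inj a" using mono by (rule strict_mono_imp_inj_on)
  from generic_imp_unique_max_morse_poly[OF this nonzero generating assms]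
  obtain u where "u \<in> keys (morse_poly a)"
    "\<forall>u'\<in>keys (morse_poly a). u' \<noteq> u \<longrightarrow> g \<bullet> expvec u' < g \<bullet> expvec u"
    unfolding unique_max_def by blast
  then have "exposes morse_exponents g (expvec u)" by (auto simp: exposes_def morse_exponents_def)
  then show ?thesis ..
qed

text \<open>All covectors of the convex set \<open>region g\<close> are generic and hence expose
  some exponent, which is therefore constant on it.\<close>

lemma region_exposes:
  assumes "generic a g" "exposes morse_exponents g v" "h \<in> region g"
  shows "exposes morse_exponents h v"
proof (rule exposes_connected[OF morse_exponents(1) convex_connected[OF convex_region]])
  show "\<exists>v. exposes morse_exponents h v" if "h \<in> region g" for h
    using generic_exposes region_generic(2)[OF assms(1) that] by blast
qed (use assms self_in_region in auto)

lemma mu_A_on_type_cone: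
  assumes g: "g \<in> tropical_morse a" and v: "exposes morse_exponents g v"
    and h: "h \<in> type_cone a (comb_data a g)"
  shows "mu_A a h = h \<bullet> v"
proof -
  have generic: "generic a g" using g by (simp add: tropical_morse_iff)
  have "h \<in> insert 0 (region g)" using type_cone_subset[OF g] h by blast
  then have "h = 0 \<or> exposes morse_exponents h v" using region_exposes[OF generic v] by blast
  then show ?thesis
  proof
    assume "h = 0"
    then show ?thesis unfolding mu_A_def morse_polytope_eq
      using support_function_convex_hull[OF morse_exponents(1), of v 0] v by (simp add: exposes_def)
  qed (simp add: mu_A_def morse_polytope_eq support_function_exposes morse_exponents)
qed

lemma type_cone_spanning:
  assumes g: "g \<in> tropical_morse a" and eq: "\<And>h. h \<in> type_cone a (comb_data a g) \<Longrightarrow> h \<bullet> v = h \<bullet> w"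
  shows "v = w"
proof -
  obtain e where e: "e > 0" "\<And>i. g + e *\<^sub>R axis i 1 \<in> tropical_morse a \<inter> region g"
    using tropical_morse_perturb[OF g] by blast
  have sub: "tropical_morse a \<inter> region g \<subseteq> type_cone a (comb_data a g)"
    unfolding type_cone_def comb_type_eq[OF g] by (rule hull_subset)
  have "g \<bullet> v = g \<bullet> w" using sub g self_in_region by (intro eq) auto
  moreover have "(g + e *\<^sub>R axis i 1) \<bullet> v = (g + e *\<^sub>R axis i 1) \<bullet> w" for i
    using sub e(2) by (intro eq) auto
  ultimately have "v $ i = w $ i" for i
    using e(1) by (simp add: inner_add_left inner_axis')
  then show ?thesis by (simp add: vec_eq_iff)
qed

lemma linear_coeffs_type_cone:
  assumes g: "g \<in> tropical_morse a" and v: "exposes morse_exponents g v"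
  shows "linear_coeffs (mu_A a) (type_cone a (comb_data a g)) = v"
  unfolding linear_coeffs_def
proof (rule the_equality)
  show "\<forall>h\<in>type_cone a (comb_data a g). mu_A a h = h \<bullet> v" using mu_A_on_type_cone[OF g v] by blast
  fix w assume "\<forall>h\<in>type_cone a (comb_data a g). mu_A a h = h \<bullet> w"
  then show "w = v" using mu_A_on_type_cone[OF g v] by (intro type_cone_spanning[OF g]) auto
qed

lemma type_conesE:
  assumes "C \<in> type_cones a"
  obtains g v where "g \<in> tropical_morse a" "C = type_cone a (comb_data a g)" "exposes morse_exponents g v"
proof -
  obtain g where g: "g \<in> tropical_morse a" "C = type_cone a (comb_data a g)"
    using assms unfolding type_cones_def comb_types_def by blast
  moreover obtain v where "exposes morse_exponents g v"
    using generic_exposes g(1) unfolding tropical_morse_iff by blast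
  ultimately show ?thesis by (rule that)
qed

lemma inj_on_type_cone: "inj_on (type_cone a) (comb_types a)"
proof (rule inj_onI)
  fix S T assume ST: "S \<in> comb_types a" "T \<in> comb_types a" "type_cone a S = type_cone a T"
  obtain g h where gh: "g \<in> tropical_morse a" "S = comb_data a g" "h \<in> tropical_morse a" "T = comb_data a h"
    using ST(1,2) unfolding comb_types_def by blast
  obtain e where e: "e > 0" "\<And>i. h + e *\<^sub>R axis i 1 \<in> tropical_morse a \<inter> region h"
    using tropical_morse_perturb[OF gh(3)] by blast
  \<comment> \<open>A nonzero covector of the type is wanted, because a type cone is known to lie in
    its region only up to \<open>0\<close>; if \<open>h\<close> itself is \<open>0\<close>, its
    perturbation serves.\<close>
  have "h \<noteq> 0 \<or> h + e *\<^sub>R axis (Min UNIV) 1 \<noteq> 0" using e(1) by (auto simp: axis_eq_0_iff)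
  then obtain k where k: "k \<in> tropical_morse a \<inter> region h" "k \<noteq> 0"
    using e(2)[of "Min UNIV"] gh(3) self_in_region by blast
  then have "k \<in> type_cone a T"
    unfolding gh(4) type_cone_def comb_type_eq[OF gh(3)] by (auto intro: hull_inc)
  then have "k \<in> region g" using type_cone_subset[OF gh(1)] k(2) ST(3) unfolding gh(2) by auto
  then have "comb_data a k = comb_data a g" using k(1) comb_type_eq[OF gh(1)] by blast
  moreover have "comb_data a k = comb_data a h" using k(1) comb_type_eq[OF gh(3)] by blast
  ultimately show "S = T" by (simp add: gh)
qed

text \<open>The covectors exposing \<open>v\<close> form a nonempty open set, which contains a
  generic one, possibly with negative entries. Adding a large constant repairs the signs without
  leaving its region.\<close>

lemma vertex_exposed_by_tropical_morse:
  assumes "v extreme_point_of (convex hull morse_exponents)"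
  shows "\<exists>g\<in>tropical_morse a. exposes morse_exponents g v"
proof -
  have "{g. exposes morse_exponents g v} \<noteq> {}"
    using extreme_point_imp_exposes[OF morse_exponents(1) assms] by blast
  from generic_covector_exists[OF nonzero open_exposes[OF morse_exponents(1)] this]
  obtain g where g: "exposes morse_exponents g v" "cond_A1 a g" "generic a g" by blast
  define e where "e = (\<Sum>i\<in>UNIV. \<bar>g $ i\<bar>)"
  define h where "h = g + (\<chi> i. e)"
  have h: "h \<in> region g" unfolding h_def by (intro region_shift self_in_region)
  have "\<bar>g $ i\<bar> \<le> e" for i unfolding e_def by (rule member_le_sum) auto
  then have "0 \<le> h $ i" for i unfolding h_def using abs_le_D2[of "g $ i" e] by simp
  moreover have "slope a h p q = slope a g p q" for p q by (simp add: slope_def h_def)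
  then have "cond_A1 a h" using g(2) by (simp add: cond_A1_def)
  ultimately have "h \<in> tropical_morse a" using region_generic(2)[OF g(3) h] by (simp add: tropical_morse_iff)
  then show ?thesis using region_exposes[OF g(3,1) h] by blast
qed

end

theorem mainTheorem2:
  fixes a :: "'n::{finite,linorder} \<Rightarrow> int"
  assumes "strict_mono a"
    and "0 \<notin> range a"
    and "affinely_generates_int a"
    and "a (Max UNIV) - a (Min UNIV) \<ge> 3"
    and "assumption_G a"
  shows "piecewise_linear (mu_A a) \<and>
    convex_on UNIV (mu_A a) \<and>
    (\<forall>C\<in>type_cones a. \<exists>g. linear g \<and> (\<forall>\<gamma>\<in>C. mu_A a \<gamma> = g \<gamma>)) \<and>
    (\<forall>C\<in>type_cones a. \<exists>!v. \<forall>\<gamma>\<in>C. mu_A a \<gamma> = \<gamma> \<bullet> v) \<and>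
    bij_betw (type_cone a) (comb_types a) (type_cones a) \<and>
    linear_coeffs (mu_A a) ` type_cones a = {v. v extreme_point_of morse_polytope a}"
proof -
  interpret morse_support a
    using assms(1-3) by unfold_locales (metis rangeI)+
  have mu: "mu_A a = support_function (convex hull morse_exponents)"
    by (simp add: mu_A_def morse_polytope_eq)
  have uniq: "\<exists>!v. \<forall>\<gamma>\<in>C. mu_A a \<gamma> = \<gamma> \<bullet> v" if C: "C \<in> type_cones a" for C
  proof -
    obtain g v where g: "g \<in> tropical_morse a" "C = type_cone a (comb_data a g)" "exposes morse_exponents g v"
      using type_conesE[OF C] .
    show ?thesis
    proof (rule ex1I)
      show "\<forall>\<gamma>\<in>C. mu_A a \<gamma> = \<gamma> \<bullet> v" using mu_A_on_type_cone[OF g(1,3)] g(2) by blast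
      then show "w = v" if "\<forall>\<gamma>\<in>C. mu_A a \<gamma> = \<gamma> \<bullet> w" for w
        using that g(2) by (intro type_cone_spanning[OF g(1)]) auto
    qed
  qed
  have lin: "\<exists>g. linear g \<and> (\<forall>\<gamma>\<in>C. mu_A a \<gamma> = g \<gamma>)" if "C \<in> type_cones a" for C
    using uniq[OF that] bounded_linear.linear[OF bounded_linear_inner_left] by blast
  have "linear_coeffs (mu_A a) ` type_cones a = {v. v extreme_point_of morse_polytope a}"
  proof (intro equalityI subsetI)
    fix v assume "v \<in> linear_coeffs (mu_A a) ` type_cones a"
    then obtain C where C: "C \<in> type_cones a" "v = linear_coeffs (mu_A a) C" by blast
    obtain g w where "g \<in> tropical_morse a" "C = type_cone a (comb_data a g)" "exposes morse_exponents g w"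
      using type_conesE[OF C(1)] .
    then show "v \<in> {v. v extreme_point_of morse_polytope a}"
      using C(2) linear_coeffs_type_cone exposes_imp_extreme_point[OF morse_exponents(1)]
      by (simp add: morse_polytope_eq)
  next
    fix v assume "v \<in> {v. v extreme_point_of morse_polytope a}"
    then obtain g where g: "g \<in> tropical_morse a" "exposes morse_exponents g v"
      using vertex_exposed_by_tropical_morse by (auto simp: morse_polytope_eq)
    have "type_cone a (comb_data a g) \<in> type_cones a" using g(1) by (simp add: type_cones_def comb_types_def)
    then show "v \<in> linear_coeffs (mu_A a) ` type_cones a"
      using linear_coeffs_type_cone[OF g] by (metis imageI)
  qed
  moreover have "piecewise_linear (mu_A a)" "convex_on UNIV (mu_A a)"
    unfolding mu by (intro piecewise_linear_support_function convex_on_support_function morse_exponents)+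
  moreover have "bij_betw (type_cone a) (comb_types a) (type_cones a)"
    using inj_on_type_cone by (simp add: bij_betw_def type_cones_def)
  ultimately show ?thesis using uniq lin by blast
qed

end
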